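(* Let $q\in\mathbb N$. The Brown–Gitler module $J(2^q)$, with the multiplication given by its internal product $(\cdot Sq^{2^q})\circ\mu_{2^q,2^q}$, is the free $\star$-unstable $T_q\mathrm{Lev}$-algebra generated by the unstable module $F(1)$.
   Context: Base field $\mathbb F=\mathbb F_2$. $\mathcal A$ is the mod 2 Steenrod algebra ($Sq^0=1$). $\mathcal U$ is the category of unstable modules: graded left $\mathcal A$-modules $M$ with $Sq^ix=0$ for $i>|x|$; $Sq_0x:=Sq^{|x|}x$. Tensor products carry the Cartan action $Sq^i(x\otimes y)=\sum_{k+l=i}Sq^kx\otimes Sq^ly$. $V^\sharp$ is the dual of $V$. $F(n)$ is the free unstable module on a generator $\iota_n$ of degree $n$: $\operatorname{Hom}_{\mathcal U}(F(n),M)\cong M^n$. $\mathrm{Lev}$ is the operad of level algebras (vector spaces with a commutative bilinear operation $\star$ such that $(a\star b)\star(c\star d)=(a\star c)\star(b\star d)$), generated by $\star\in\mathrm{Lev}(2)^{\mathfrak S_2}$. $T_q\mathrm{Lev}$ is the quotient of $\mathrm{Lev}$ by the operadic ideal spanned by all compositions of the generator $\star$ whose composition tree has height greater than $q$ (the height being the maximal number of vertices on a path from a leaf to the root; the operadic unit has height $0$ and $\star$ has height $1$). We still write $\star$ for the image of the generator. A $\star$-unstable $T_q\mathrm{Lev}$-algebra is an unstable module $M$ with a graded $T_q\mathrm{Lev}$-algebra structure satisfying the Cartan formula $Sq^i(x\star y)=\sum_{k+l=i}Sq^kx\star Sq^ly$ and $Sq_0x=x\star x$ for all $x\in M$. The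 free one generated by $N\in\mathcal U$ is the value at $N$ of the left adjoint of the forgetful functor to $\mathcal U$; "is the free ..." means isomorphic to it as such an algebra. $J(n)$ is the object of $\mathcal U$ representing $M\mapsto(M^n)^\sharp$, so $\operatorname{Hom}_{\mathcal U}(M,J(n))\cong(M^n)^\sharp$, and $J(n)^m\cong(F(m)^n)^\sharp$. The external product $\mu_{m,n}:J(n)\otimes J(m)\to J(n+m)$ is the only non-zero element of $\operatorname{Hom}_{\mathcal U}(J(n)\otimes J(m),J(n+m))\cong((J(n)\otimes J(m))^{n+m})^\sharp$. The map $\cdot Sq^n:J(2n)\to J(n)$ is the element of $\operatorname{Hom}_{\mathcal U}(J(2n),J(n))\cong(J(2n)^n)^\sharp\cong F(n)^{2n}$ corresponding to $Sq_0\iota_n$. The internal product of $J(n)$ is $(\cdot Sq^n)\circ\mu_{n,n}:J(n)\otimes J(n)\to J(n)$. *)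

theory Defs
  imports "HOL-Library.Z2" "HOL-Library.FuncSet" "HOL-Algebra.Group"
begin

section \<open>Unstable modules over the mod 2 Steenrod algebra\<close>

text \<open>
  A structure \<open>M\<close> consists of a family of sets \<open>carr M n\<close> (the homogeneous component of
  degree \<open>n\<close>), with zero, addition and operations
  \<open>sq M i n\<close> from \<open>carr M n\<close> to \<open>carr M (n + i)\<close>. An \<open>\<bbbF>\<^sub>2\<close>-vector space is the same
  thing as an abelian group in which \<open>x + x = 0\<close>, so there is no field for scalars. An unstable
  module has no nonzero element of negative degree (\<open>x = Sq\<^sup>0 x = 0\<close> there), so degrees are
  natural numbers. The components need not be disjoint; every operation takes the degrees
  of its arguments.
\<close>

record 'a gmod =
  carr :: "nat \<Rightarrow> 'a set"
  zer :: "nat \<Rightarrow> 'a"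
  add :: "nat \<Rightarrow> 'a \<Rightarrow> 'a \<Rightarrow> 'a"
  sq :: "nat \<Rightarrow> nat \<Rightarrow> 'a \<Rightarrow> 'a"

definition gsum :: "('a, 'z) gmod_scheme \<Rightarrow> nat \<Rightarrow> 'a list \<Rightarrow> 'a" where
  "gsum M n xs = foldr (add M n) xs (zer M n)"

definition closed_gmod :: "('a, 'z) gmod_scheme \<Rightarrow> bool" where
  "closed_gmod M \<longleftrightarrow>
     (\<forall>n. zer M n \<in> carr M n) \<and>
     (\<forall>n. \<forall>x\<in>carr M n. \<forall>y\<in>carr M n. add M n x y \<in> carr M n) \<and>
     (\<forall>i n. \<forall>x\<in>carr M n. sq M i n x \<in> carr M (n + i))"

text \<open>
  The axioms are given as sets of pairs (left-hand side, right-hand side). A structure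
  satisfies them if these pairs lie in \<open>Id\<close>; free objects are obtained by imposing the same
  pairs on formal terms.
\<close>

definition vec_ids :: "('a, 'z) gmod_scheme \<Rightarrow> ('a \<times> 'a) set" where
  "vec_ids M =
     {(add M n (add M n x y) z, add M n x (add M n y z)) | n x y z.
        x \<in> carr M n \<and> y \<in> carr M n \<and> z \<in> carr M n} \<union>
     {(add M n x y, add M n y x) | n x y. x \<in> carr M n \<and> y \<in> carr M n} \<union>
     {(add M n (zer M n) x, x) | n x. x \<in> carr M n} \<union>
     {(add M n x x, zer M n) | n x. x \<in> carr M n}"

definition sq_additive_ids :: "('a, 'z) gmod_scheme \<Rightarrow> ('a \<times> 'a) set" where
  "sq_additive_ids M =
     {(sq M i n (add M n x y), add M (n + i) (sq M i n x) (sq M i n y)) | i n x y.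
        x \<in> carr M n \<and> y \<in> carr M n}"

text \<open>
  The Steenrod algebra is presented by the generators \<open>Sq\<^sup>i\<close>, the relation \<open>Sq\<^sup>0 = 1\<close> and the
  Adem relations
  \<open>Sq\<^sup>a Sq\<^sup>b = \<Sum>\<^sub>j (b - 1 - j choose a - 2j) Sq\<^bsup>a+b-j\<^esup> Sq\<^sup>j\<close> for \<open>0 < a < 2b\<close>.
  In the range \<open>j \<le> a div 2\<close> no natural subtraction below is truncated.
\<close>

definition steenrod_ids :: "('a, 'z) gmod_scheme \<Rightarrow> ('a \<times> 'a) set" where
  "steenrod_ids M =
     {(sq M 0 n x, x) | n x. x \<in> carr M n} \<union>
     {(sq M a (n + b) (sq M b n x),
       gsum M (n + a + b)
         (map (\<lambda>j. sq M (a + b - j) (n + j) (sq M j n x))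
           (filter (\<lambda>j. odd ((b - 1 - j) choose (a - 2 * j))) [0..<Suc (a div 2)]))) | a b n x.
        x \<in> carr M n \<and> 0 < a \<and> a < 2 * b}"

definition instability_ids :: "('a, 'z) gmod_scheme \<Rightarrow> ('a \<times> 'a) set" where
  "instability_ids M = {(sq M i n x, zer M (n + i)) | i n x. x \<in> carr M n \<and> n < i}"

definition unstable_ids :: "('a, 'z) gmod_scheme \<Rightarrow> ('a \<times> 'a) set" where
  "unstable_ids M = vec_ids M \<union> sq_additive_ids M \<union> steenrod_ids M \<union> instability_ids M"

definition unstable_module :: "('a, 'z) gmod_scheme \<Rightarrow> bool" where
  "unstable_module M \<longleftrightarrow> closed_gmod M \<and> unstable_ids M \<subseteq> Id"

definition mor :: "('a, 'y) gmod_scheme \<Rightarrow> ('b, 'z) gmod_scheme \<Rightarrow> (nat \<Rightarrow> 'a \<Rightarrow> 'b) set" where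
  "mor M N = {f.
     (\<forall>n. f n \<in> carr M n \<rightarrow>\<^sub>E carr N n) \<and>
     (\<forall>n. \<forall>x\<in>carr M n. \<forall>y\<in>carr M n. f n (add M n x y) = add N n (f n x) (f n y)) \<and>
     (\<forall>i n. \<forall>x\<in>carr M n. f (n + i) (sq M i n x) = sq N i n (f n x))}"

text \<open>\<open>dual M n\<close> is the dual vector space of the component of degree \<open>n\<close>.\<close>

definition dual :: "('a, 'z) gmod_scheme \<Rightarrow> nat \<Rightarrow> ('a \<Rightarrow> bit) set" where
  "dual M n = {\<phi> \<in> carr M n \<rightarrow>\<^sub>E UNIV.
     \<forall>x\<in>carr M n. \<forall>y\<in>carr M n. \<phi> (add M n x y) = \<phi> x + \<phi> y}"


section \<open>\<open>\<star>\<close>-unstable \<open>T\<^sub>q Lev\<close>-algebras\<close>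

record 'a salg = "'a gmod" +
  star :: "nat \<Rightarrow> nat \<Rightarrow> 'a \<Rightarrow> 'a \<Rightarrow> 'a"

definition closed_salg :: "('a, 'z) salg_scheme \<Rightarrow> bool" where
  "closed_salg A \<longleftrightarrow> closed_gmod A \<and>
     (\<forall>m n. \<forall>x\<in>carr A m. \<forall>y\<in>carr A n. star A m n x y \<in> carr A (m + n))"

definition lev_ids :: "('a, 'z) salg_scheme \<Rightarrow> ('a \<times> 'a) set" where
  "lev_ids A =
     {(star A m n (add A m x x') y, add A (m + n) (star A m n x y) (star A m n x' y)) | m n x x' y.
        x \<in> carr A m \<and> x' \<in> carr A m \<and> y \<in> carr A n} \<union>
     {(star A m n x (add A n y y'), add A (m + n) (star A m n x y) (star A m n x y')) | m n x y y'.
        x \<in> carr A m \<and> y \<in> carr A n \<and> y' \<in> carr A n} \<union>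
     {(star A m n x y, star A n m y x) | m n x y. x \<in> carr A m \<and> y \<in> carr A n} \<union>
     {(star A (k + l) (m + n) (star A k l a b) (star A m n c d),
       star A (k + m) (l + n) (star A k m a c) (star A l n b d)) | k l m n a b c d.
        a \<in> carr A k \<and> b \<in> carr A l \<and> c \<in> carr A m \<and> d \<in> carr A n}"

text \<open>
  Composition trees of \<open>\<star>\<close>, with leaves labelled by pairs (degree, element). An algebra
  over the quotient operad \<open>T\<^sub>q Lev\<close> is a \<open>Lev\<close>-algebra on which the generators of the ideal,
  i.e. the compositions whose tree has height greater than \<open>q\<close>, act as zero.
\<close>

datatype (leaves: 'x) stree = Leaf 'x | Node "'x stree" "'x stree"

primrec sheight :: "'x stree \<Rightarrow> nat" where
  "sheight (Leaf x) = 0"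
| "sheight (Node s t) = Suc (max (sheight s) (sheight t))"

primrec sdeg :: "(nat \<times> 'a) stree \<Rightarrow> nat" where
  "sdeg (Leaf p) = fst p"
| "sdeg (Node s t) = sdeg s + sdeg t"

primrec seval :: "('a, 'z) salg_scheme \<Rightarrow> (nat \<times> 'a) stree \<Rightarrow> 'a" where
  "seval A (Leaf p) = snd p"
| "seval A (Node s t) = star A (sdeg s) (sdeg t) (seval A s) (seval A t)"

definition truncation_ids :: "nat \<Rightarrow> ('a, 'z) salg_scheme \<Rightarrow> ('a \<times> 'a) set" where
  "truncation_ids q A = {(seval A t, zer A (sdeg t)) | t.
     (\<forall>(n, x)\<in>leaves t. x \<in> carr A n) \<and> q < sheight t}"

definition cartan_ids :: "('a, 'z) salg_scheme \<Rightarrow> ('a \<times> 'a) set" where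
  "cartan_ids A =
     {(sq A i (m + n) (star A m n x y),
       gsum A (m + n + i)
         (map (\<lambda>k. star A (m + k) (n + (i - k)) (sq A k m x) (sq A (i - k) n y)) [0..<Suc i])) |
       i m n x y. x \<in> carr A m \<and> y \<in> carr A n}"

definition star_sq0_ids :: "('a, 'z) salg_scheme \<Rightarrow> ('a \<times> 'a) set" where
  "star_sq0_ids A = {(sq A n n x, star A n n x x) | n x. x \<in> carr A n}"

definition star_unstable_ids :: "nat \<Rightarrow> ('a, 'z) salg_scheme \<Rightarrow> ('a \<times> 'a) set" where
  "star_unstable_ids q A = unstable_ids A \<union> lev_ids A \<union> truncation_ids q A \<union>
     cartan_ids A \<union> star_sq0_ids A"

definition star_unstable_algebra :: "nat \<Rightarrow> ('a, 'z) salg_scheme \<Rightarrow> bool" where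
  "star_unstable_algebra q A \<longleftrightarrow> closed_salg A \<and> star_unstable_ids q A \<subseteq> Id"

definition alg_mor :: "('a, 'y) salg_scheme \<Rightarrow> ('b, 'z) salg_scheme \<Rightarrow> (nat \<Rightarrow> 'a \<Rightarrow> 'b) set" where
  "alg_mor A B = {f \<in> mor A B. \<forall>m n. \<forall>x\<in>carr A m. \<forall>y\<in>carr A n.
     f (m + n) (star A m n x y) = star B m n (f m x) (f n y)}"

definition alg_iso :: "('a, 'y) salg_scheme \<Rightarrow> ('b, 'z) salg_scheme \<Rightarrow> bool" where
  "alg_iso A B \<longleftrightarrow> (\<exists>f\<in>alg_mor A B. \<forall>n. bij_betw (f n) (carr A n) (carr B n))"


section \<open>Objects presented by generators and relations\<close>

datatype 'g trm =
    Gen nat 'g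
  | Zero nat
  | Add "'g trm" "'g trm"
  | Sq nat "'g trm"
  | Star "'g trm" "'g trm"

primrec tdeg :: "'g trm \<Rightarrow> nat" where
  "tdeg (Gen n g) = n"
| "tdeg (Zero n) = n"
| "tdeg (Add s t) = tdeg s"
| "tdeg (Sq i t) = tdeg t + i"
| "tdeg (Star s t) = tdeg s + tdeg t"

inductive_set mod_terms :: "(nat \<Rightarrow> 'g set) \<Rightarrow> 'g trm set" for G where
  "g \<in> G n \<Longrightarrow> Gen n g \<in> mod_terms G"
| "Zero n \<in> mod_terms G"
| "s \<in> mod_terms G \<Longrightarrow> t \<in> mod_terms G \<Longrightarrow> tdeg s = tdeg t \<Longrightarrow> Add s t \<in> mod_terms G"
| "t \<in> mod_terms G \<Longrightarrow> Sq i t \<in> mod_terms G"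

inductive_set alg_terms :: "(nat \<Rightarrow> 'g set) \<Rightarrow> 'g trm set" for G where
  "g \<in> G n \<Longrightarrow> Gen n g \<in> alg_terms G"
| "Zero n \<in> alg_terms G"
| "s \<in> alg_terms G \<Longrightarrow> t \<in> alg_terms G \<Longrightarrow> tdeg s = tdeg t \<Longrightarrow> Add s t \<in> alg_terms G"
| "t \<in> alg_terms G \<Longrightarrow> Sq i t \<in> alg_terms G"
| "s \<in> alg_terms G \<Longrightarrow> t \<in> alg_terms G \<Longrightarrow> Star s t \<in> alg_terms G"

definition term_alg :: "'g trm set \<Rightarrow> 'g trm salg" where
  "term_alg W = \<lparr>carr = (\<lambda>n. {t \<in> W. tdeg t = n}), zer = Zero, add = (\<lambda>n. Add),
     sq = (\<lambda>i n. Sq i), star = (\<lambda>m n. Star)\<rparr>"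

text \<open>The congruence on the terms \<open>W\<close> generated by the pairs in \<open>E\<close>.\<close>

inductive_set congr :: "'g trm set \<Rightarrow> ('g trm \<times> 'g trm) set \<Rightarrow> ('g trm \<times> 'g trm) set"
  for W E where
  base: "(s, t) \<in> E \<Longrightarrow> (s, t) \<in> congr W E"
| refl: "t \<in> W \<Longrightarrow> (t, t) \<in> congr W E"
| sym: "(s, t) \<in> congr W E \<Longrightarrow> (t, s) \<in> congr W E"
| trans: "(r, s) \<in> congr W E \<Longrightarrow> (s, t) \<in> congr W E \<Longrightarrow> (r, t) \<in> congr W E"
| Add: "(s, s') \<in> congr W E \<Longrightarrow> (t, t') \<in> congr W E \<Longrightarrow> Add s t \<in> W \<Longrightarrow>
    (Add s t, Add s' t') \<in> congr W E"
| Sq: "(t, t') \<in> congr W E \<Longrightarrow> Sq i t \<in> W \<Longrightarrow> (Sq i t, Sq i t') \<in> congr W E"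
| Star: "(s, s') \<in> congr W E \<Longrightarrow> (t, t') \<in> congr W E \<Longrightarrow> Star s t \<in> W \<Longrightarrow>
    (Star s t, Star s' t') \<in> congr W E"

definition quot_mod :: "'g trm set \<Rightarrow> ('g trm \<times> 'g trm) set \<Rightarrow> 'g trm set gmod" where
  "quot_mod W E =
     \<lparr>carr = (\<lambda>n. {t \<in> W. tdeg t = n} // congr W E),
      zer = (\<lambda>n. congr W E `` {Zero n}),
      add = (\<lambda>n X Y. \<Union>s\<in>X. \<Union>t\<in>Y. congr W E `` {Add s t}),
      sq = (\<lambda>i n X. \<Union>t\<in>X. congr W E `` {Sq i t})\<rparr>"

definition quot_alg :: "'g trm set \<Rightarrow> ('g trm \<times> 'g trm) set \<Rightarrow> 'g trm set salg" where
  "quot_alg W E = gmod.extend (quot_mod W E)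
     \<lparr>star = (\<lambda>m n X Y. \<Union>s\<in>X. \<Union>t\<in>Y. congr W E `` {Star s t})\<rparr>"


subsection \<open>The free unstable module on a generator of degree \<open>n\<close>\<close>

definition F_terms :: "nat \<Rightarrow> unit trm set" where
  "F_terms n = mod_terms (\<lambda>m. if m = n then {()} else {})"

definition F :: "nat \<Rightarrow> unit trm set gmod" where
  "F n = quot_mod (F_terms n) (unstable_ids (term_alg (F_terms n)))"

definition iota :: "nat \<Rightarrow> unit trm set" where
  "iota n = congr (F_terms n) (unstable_ids (term_alg (F_terms n))) `` {Gen n ()}"

text \<open>The morphism from \<open>F(n)\<close> to \<open>M\<close> corresponding to \<open>x\<close> in degree \<open>n\<close> of \<open>M\<close>; it exists and is
  unique by lemma \<open>F_universal\<close> below.\<close>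

definition F_mor :: "('a, 'z) gmod_scheme \<Rightarrow> nat \<Rightarrow> 'a \<Rightarrow> nat \<Rightarrow> unit trm set \<Rightarrow> 'a" where
  "F_mor M n x = (THE f. f \<in> mor (F n) M \<and> f n (iota n) = x)"


subsection \<open>Tensor products\<close>

text \<open>
  The generator \<open>Gen (m + n) (m, x, n, y)\<close> is \<open>x \<otimes> y\<close> with \<open>x\<close> of degree \<open>m\<close> and \<open>y\<close> of degree
  \<open>n\<close>. By the Cartan formula and additivity every formal term \<open>Sq i t\<close> is
  congruent to a sum of such generators, so the quotient is the usual tensor product of
  graded vector spaces.
\<close>

definition pure :: "nat \<Rightarrow> 'a \<Rightarrow> nat \<Rightarrow> 'b \<Rightarrow> (nat \<times> 'a \<times> nat \<times> 'b) trm" where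
  "pure m x n y = Gen (m + n) (m, x, n, y)"

definition tensor_terms ::
  "('a, 'y) gmod_scheme \<Rightarrow> ('b, 'z) gmod_scheme \<Rightarrow> (nat \<times> 'a \<times> nat \<times> 'b) trm set" where
  "tensor_terms M N =
     mod_terms (\<lambda>k. {(m, x, n, y). m + n = k \<and> x \<in> carr M m \<and> y \<in> carr N n})"

definition tensor_ids :: "('a, 'y) gmod_scheme \<Rightarrow> ('b, 'z) gmod_scheme \<Rightarrow>
    ((nat \<times> 'a \<times> nat \<times> 'b) trm \<times> (nat \<times> 'a \<times> nat \<times> 'b) trm) set" where
  "tensor_ids M N =
     vec_ids (term_alg (tensor_terms M N)) \<union> sq_additive_ids (term_alg (tensor_terms M N)) \<union>
     {(pure m (add M m x x') n y, Add (pure m x n y) (pure m x' n y)) | m n x x' y.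
        x \<in> carr M m \<and> x' \<in> carr M m \<and> y \<in> carr N n} \<union>
     {(pure m x n (add N n y y'), Add (pure m x n y) (pure m x n y')) | m n x y y'.
        x \<in> carr M m \<and> y \<in> carr N n \<and> y' \<in> carr N n} \<union>
     {(Sq i (pure m x n y),
       gsum (term_alg (tensor_terms M N)) (m + n + i)
         (map (\<lambda>k. pure (m + k) (sq M k m x) (n + (i - k)) (sq N (i - k) n y)) [0..<Suc i])) |
       i m n x y. x \<in> carr M m \<and> y \<in> carr N n}"

definition tensor :: "('a, 'y) gmod_scheme \<Rightarrow> ('b, 'z) gmod_scheme \<Rightarrow>
    (nat \<times> 'a \<times> nat \<times> 'b) trm set gmod" where
  "tensor M N = quot_mod (tensor_terms M N) (tensor_ids M N)"

definition tens :: "('a, 'y) gmod_scheme \<Rightarrow> ('b, 'z) gmod_scheme \<Rightarrow>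
    nat \<Rightarrow> 'a \<Rightarrow> nat \<Rightarrow> 'b \<Rightarrow> (nat \<times> 'a \<times> nat \<times> 'b) trm set" where
  "tens M N m x n y = congr (tensor_terms M N) (tensor_ids M N) `` {pure m x n y}"


subsection \<open>The free \<open>\<star>\<close>-unstable \<open>T\<^sub>q Lev\<close>-algebra on an unstable module\<close>

text \<open>
  Its universal property, for algebras over arbitrary carrier types, is theorem
  \<open>free_alg_universal\<close> below; it identifies \<open>free_alg q N\<close> with the value at \<open>N\<close> of the left
  adjoint of the forgetful functor to unstable modules.
\<close>

definition free_ids :: "nat \<Rightarrow> ('a, 'z) gmod_scheme \<Rightarrow> ('a trm \<times> 'a trm) set" where
  "free_ids q N = star_unstable_ids q (term_alg (alg_terms (carr N))) \<union>
     {(Gen n (add N n x y), Add (Gen n x) (Gen n y)) | n x y. x \<in> carr N n \<and> y \<in> carr N n} \<union>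
     {(Gen (n + i) (sq N i n x), Sq i (Gen n x)) | i n x. x \<in> carr N n}"

definition free_alg :: "nat \<Rightarrow> ('a, 'z) gmod_scheme \<Rightarrow> 'a trm set salg" where
  "free_alg q N = quot_alg (alg_terms (carr N)) (free_ids q N)"

definition free_unit :: "nat \<Rightarrow> ('a, 'z) gmod_scheme \<Rightarrow> nat \<Rightarrow> 'a \<Rightarrow> 'a trm set" where
  "free_unit q N n = (\<lambda>x\<in>carr N n. congr (alg_terms (carr N)) (free_ids q N) `` {Gen n x})"


section \<open>Brown--Gitler modules\<close>

text \<open>
  The component of degree \<open>m\<close> of \<open>J(n)\<close> is the dual of the component of degree \<open>n\<close> of
  \<open>F(m)\<close>; the operation \<open>Sq\<^sup>i\<close> is dual to the morphism from \<open>F(m + i)\<close> to \<open>F(m)\<close> which sends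
  \<open>\<iota>\<^bsub>m+i\<^esub>\<close> to \<open>Sq\<^sup>i \<iota>\<^sub>m\<close>. Representability is lemma \<open>J_represents\<close> below.
\<close>

definition J :: "nat \<Rightarrow> (unit trm set \<Rightarrow> bit) gmod" where
  "J n =
     \<lparr>carr = (\<lambda>m. dual (F m) n),
      zer = (\<lambda>m. \<lambda>z\<in>carr (F m) n. 0),
      add = (\<lambda>m f g. \<lambda>z\<in>carr (F m) n. f z + g z),
      sq = (\<lambda>i m f. \<lambda>z\<in>carr (F (m + i)) n. f (F_mor (F m) (m + i) (sq (F m) i m (iota m)) n z))\<rparr>"

text \<open>
  \<open>J_mor M n \<phi>\<close> is the morphism from \<open>M\<close> to \<open>J(n)\<close> corresponding to the functional \<open>\<phi>\<close>; it sends
  \<open>x\<close> in degree \<open>m\<close> to the functional \<open>\<theta> \<iota>\<^sub>m \<mapsto> \<phi>(\<theta> x)\<close>.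
\<close>

definition J_mor :: "('a, 'z) gmod_scheme \<Rightarrow> nat \<Rightarrow> ('a \<Rightarrow> bit) \<Rightarrow>
    nat \<Rightarrow> 'a \<Rightarrow> unit trm set \<Rightarrow> bit" where
  "J_mor M n \<phi> = (\<lambda>m. \<lambda>x\<in>carr M m. \<lambda>z\<in>carr (F m) n. \<phi> (F_mor M m x n z))"

definition mu :: "nat \<Rightarrow> nat \<Rightarrow> nat \<Rightarrow>
    (nat \<times> (unit trm set \<Rightarrow> bit) \<times> nat \<times> (unit trm set \<Rightarrow> bit)) trm set \<Rightarrow>
    unit trm set \<Rightarrow> bit" where
  "mu m n = (THE f. f \<in> mor (tensor (J n) (J m)) (J (n + m)) \<and>
     (\<exists>k. \<exists>w\<in>carr (tensor (J n) (J m)) k. f k w \<noteq> zer (J (n + m)) k))"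

text \<open>The functional on degree \<open>n\<close> of \<open>J(2n)\<close> given by an element of degree \<open>2n\<close> of \<open>F(n)\<close> is
  evaluation at that element.\<close>

definition dot_Sq :: "nat \<Rightarrow> nat \<Rightarrow> (unit trm set \<Rightarrow> bit) \<Rightarrow> unit trm set \<Rightarrow> bit" where
  "dot_Sq n = J_mor (J (2 * n)) n (\<lambda>f\<in>carr (J (2 * n)) n. f (sq (F n) n n (iota n)))"

definition J_alg :: "nat \<Rightarrow> (unit trm set \<Rightarrow> bit) salg" where
  "J_alg n = gmod.extend (J n)
     \<lparr>star = (\<lambda>i j x y. dot_Sq n (i + j) (mu n n (i + j) (tens (J n) (J n) i x j y)))\<rparr>"


section \<open>The universal properties\<close>

subsection \<open>Quotients of term structures\<close>

primrec teval :: "('b, 'z) gmod_scheme \<Rightarrow> (nat \<Rightarrow> nat \<Rightarrow> 'b \<Rightarrow> 'b \<Rightarrow> 'b) \<Rightarrow> (nat \<Rightarrow> 'g \<Rightarrow> 'b) \<Rightarrow>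
    'g trm \<Rightarrow> 'b" where
  "teval M st h (Gen n g) = h n g"
| "teval M st h (Zero n) = zer M n"
| "teval M st h (Add s t) = add M (tdeg s) (teval M st h s) (teval M st h t)"
| "teval M st h (Sq i t) = sq M i (tdeg t) (teval M st h t)"
| "teval M st h (Star s t) = st (tdeg s) (tdeg t) (teval M st h s) (teval M st h t)"

lemma term_alg_simps [simp]:
  "carr (term_alg W) n = {t \<in> W. tdeg t = n}"
  "zer (term_alg W) = Zero" "add (term_alg W) n = Add" "sq (term_alg W) i n = Sq i"
  "star (term_alg W) m n = Star"
  by (simp_all add: term_alg_def)

lemma gsum_simps [simp]:
  "gsum M n [] = zer M n" "gsum M n (x # xs) = add M n x (gsum M n xs)"
  by (simp_all add: gsum_def)

lemma closed_gsum:
  assumes "closed_gmod M" "\<And>x. x \<in> set xs \<Longrightarrow> x \<in> carr M n"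
  shows "gsum M n xs \<in> carr M n"
  using assms(2) by (induction xs) (use assms(1) in \<open>auto simp: closed_gmod_def\<close>)

lemma Id_D: "S \<subseteq> Id \<Longrightarrow> (a, b) \<in> S \<Longrightarrow> a = b"
  by auto

lemma Id_ex: "{u. \<exists>x. Q x u} \<subseteq> S \<longleftrightarrow> (\<forall>x. {u. Q x u} \<subseteq> S)"
  by auto

lemma Id_eq: "{u. u = (a, b) \<and> P} \<subseteq> Id \<longleftrightarrow> (P \<longrightarrow> a = b)"
  by auto

lemmas Id_simps = Un_subset_iff Id_ex Id_eq conj_assoc imp_conjL

lemma vec_ids_iff: "vec_ids M \<subseteq> Id \<longleftrightarrow>
    (\<forall>n. \<forall>x\<in>carr M n. \<forall>y\<in>carr M n. \<forall>z\<in>carr M n.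
       add M n (add M n x y) z = add M n x (add M n y z)) \<and>
    (\<forall>n. \<forall>x\<in>carr M n. \<forall>y\<in>carr M n. add M n x y = add M n y x) \<and>
    (\<forall>n. \<forall>x\<in>carr M n. add M n (zer M n) x = x) \<and>
    (\<forall>n. \<forall>x\<in>carr M n. add M n x x = zer M n)"
  unfolding vec_ids_def Id_simps Ball_def by meson

lemma sq_additive_ids_iff: "sq_additive_ids M \<subseteq> Id \<longleftrightarrow>
    (\<forall>i n. \<forall>x\<in>carr M n. \<forall>y\<in>carr M n.
       sq M i n (add M n x y) = add M (n + i) (sq M i n x) (sq M i n y))"
  unfolding sq_additive_ids_def Id_simps Ball_def by meson

lemma steenrod_ids_iff: "steenrod_ids M \<subseteq> Id \<longleftrightarrow>
    (\<forall>n. \<forall>x\<in>carr M n. sq M 0 n x = x) \<and>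
    (\<forall>a b n. \<forall>x\<in>carr M n. 0 < a \<longrightarrow> a < 2 * b \<longrightarrow>
       sq M a (n + b) (sq M b n x) =
       gsum M (n + a + b)
         (map (\<lambda>j. sq M (a + b - j) (n + j) (sq M j n x))
           (filter (\<lambda>j. odd ((b - 1 - j) choose (a - 2 * j))) [0..<Suc (a div 2)])))"
  unfolding steenrod_ids_def Id_simps Ball_def by meson

lemma instability_ids_iff: "instability_ids M \<subseteq> Id \<longleftrightarrow>
    (\<forall>i n. \<forall>x\<in>carr M n. n < i \<longrightarrow> sq M i n x = zer M (n + i))"
  unfolding instability_ids_def Id_simps Ball_def by meson

lemma lev_ids_iff: "lev_ids A \<subseteq> Id \<longleftrightarrow>
    (\<forall>m n. \<forall>x\<in>carr A m. \<forall>x'\<in>carr A m. \<forall>y\<in>carr A n.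
       star A m n (add A m x x') y = add A (m + n) (star A m n x y) (star A m n x' y)) \<and>
    (\<forall>m n. \<forall>x\<in>carr A m. \<forall>y\<in>carr A n. \<forall>y'\<in>carr A n.
       star A m n x (add A n y y') = add A (m + n) (star A m n x y) (star A m n x y')) \<and>
    (\<forall>m n. \<forall>x\<in>carr A m. \<forall>y\<in>carr A n. star A m n x y = star A n m y x) \<and>
    (\<forall>k l m n. \<forall>a\<in>carr A k. \<forall>b\<in>carr A l. \<forall>c\<in>carr A m. \<forall>d\<in>carr A n.
       star A (k + l) (m + n) (star A k l a b) (star A m n c d) =
       star A (k + m) (l + n) (star A k m a c) (star A l n b d))"
  unfolding lev_ids_def Id_simps Ball_def by meson

lemma truncation_ids_iff: "truncation_ids q A \<subseteq> Id \<longleftrightarrow>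
    (\<forall>t. (\<forall>(n, x)\<in>leaves t. x \<in> carr A n) \<longrightarrow> q < sheight t \<longrightarrow> seval A t = zer A (sdeg t))"
  unfolding truncation_ids_def Id_simps Ball_def by meson

lemma cartan_ids_iff: "cartan_ids A \<subseteq> Id \<longleftrightarrow>
    (\<forall>i m n. \<forall>x\<in>carr A m. \<forall>y\<in>carr A n.
       sq A i (m + n) (star A m n x y) =
       gsum A (m + n + i)
         (map (\<lambda>k. star A (m + k) (n + (i - k)) (sq A k m x) (sq A (i - k) n y)) [0..<Suc i]))"
  unfolding cartan_ids_def Id_simps Ball_def by meson

lemma star_sq0_ids_iff: "star_sq0_ids A \<subseteq> Id \<longleftrightarrow>
    (\<forall>n. \<forall>x\<in>carr A n. sq A n n x = star A n n x x)"
  unfolding star_sq0_ids_def Id_simps Ball_def by meson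

lemma adem_memI:
  "x \<in> carr M n \<Longrightarrow> 0 < a \<Longrightarrow> a < 2 * b \<Longrightarrow>
     (sq M a (n + b) (sq M b n x),
       gsum M (n + a + b)
         (map (\<lambda>j. sq M (a + b - j) (n + j) (sq M j n x))
           (filter (\<lambda>j. odd ((b - 1 - j) choose (a - 2 * j))) [0..<Suc (a div 2)])))
     \<in> steenrod_ids M"
  unfolding steenrod_ids_def by (rule UnI2, rule CollectI, intro exI conjI) (rule HOL.refl | assumption)+

lemma cartan_memI:
  "x \<in> carr A m \<Longrightarrow> y \<in> carr A n \<Longrightarrow>
     (sq A i (m + n) (star A m n x y),
       gsum A (m + n + i)
         (map (\<lambda>k. star A (m + k) (n + (i - k)) (sq A k m x) (sq A (i - k) n y)) [0..<Suc i]))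
     \<in> cartan_ids A"
  unfolding cartan_ids_def by (rule CollectI, intro exI conjI) (rule HOL.refl | assumption)+

locale term_quotient =
  fixes W :: "'g trm set" and E :: "('g trm \<times> 'g trm) set"
  assumes closed: "closed_gmod (term_alg W)"
    and E: "(s, t) \<in> E \<Longrightarrow> s \<in> W \<and> t \<in> W \<and> tdeg s = tdeg t"
    and Add_D: "Add s t \<in> W \<Longrightarrow> tdeg s = tdeg t"
    and Star_cong: "Star s t \<in> W \<Longrightarrow> s' \<in> W \<Longrightarrow> t' \<in> W \<Longrightarrow> Star s' t' \<in> W"
begin

abbreviation cl :: "'g trm \<Rightarrow> 'g trm set" where
  "cl t \<equiv> congr W E `` {t}"

abbreviation Q :: "'g trm set gmod" where
  "Q \<equiv> quot_mod W E"

lemma Zero_W [simp]: "Zero n \<in> W"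
  and Add_W [simp]: "s \<in> W \<Longrightarrow> t \<in> W \<Longrightarrow> tdeg s = tdeg t \<Longrightarrow> Add s t \<in> W"
  and Sq_W [simp]: "t \<in> W \<Longrightarrow> Sq i t \<in> W"
  using closed by (auto simp: closed_gmod_def)

lemma congr_W: "(s, t) \<in> congr W E \<Longrightarrow> s \<in> W \<and> t \<in> W \<and> tdeg s = tdeg t"
proof (induction rule: congr.induct)
  case (Add s s' t t')
  then show ?case using Add_D[OF Add.hyps(3)] by auto
qed (use E Star_cong in auto)

lemma equiv_congr: "equiv W (congr W E)"
proof (rule equivI)
  show "congr W E \<subseteq> W \<times> W" using congr_W by auto
  show "refl_on W (congr W E)" by (rule refl_onI) (rule congr.refl)
  show "sym (congr W E)" by (rule symI) (rule congr.sym)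
  show "trans (congr W E)" by (rule transI) (rule congr.trans)
qed

lemma cl_eq_iff: "s \<in> W \<Longrightarrow> t \<in> W \<Longrightarrow> cl s = cl t \<longleftrightarrow> (s, t) \<in> congr W E"
  using eq_equiv_class_iff[OF equiv_congr] by blast

lemma cl_eqI: "(s, t) \<in> congr W E \<Longrightarrow> cl s = cl t"
  using equiv_class_eq[OF equiv_congr] by blast

lemma carr_Q: "carr Q n = cl ` {t \<in> W. tdeg t = n}"
  by (auto simp: quot_mod_def quotient_def)

lemma cl_carr [simp]: "t \<in> W \<Longrightarrow> tdeg t = n \<Longrightarrow> cl t \<in> carr Q n"
  by (auto simp: carr_Q)

lemma cl_E:
  assumes "X \<in> carr Q n" obtains t where "t \<in> W" "tdeg t = n" "X = cl t"
  using assms by (auto simp: carr_Q)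

lemma zer_Q [simp]: "zer Q n = cl (Zero n)"
  by (simp add: quot_mod_def)

lemma add_Q [simp]:
  assumes "s \<in> W" "t \<in> W" "tdeg s = tdeg t"
  shows "add Q n (cl s) (cl t) = cl (Add s t)"
proof -
  have *: "cl (Add s' t') = cl (Add s t)" if "s' \<in> cl s" "t' \<in> cl t" for s' t'
    using cl_eqI[OF congr.Add[of s s' W E t t']] that assms by simp
  have ne: "s \<in> cl s" "t \<in> cl t" using assms by (auto intro: congr.refl)
  have "add Q n (cl s) (cl t) = (\<Union>s'\<in>cl s. \<Union>t'\<in>cl t. cl (Add s' t'))"
    by (simp add: quot_mod_def)
  also have "\<dots> = (\<Union>s'\<in>cl s. \<Union>t'\<in>cl t. cl (Add s t))"
    by (intro SUP_cong HOL.refl *)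
  also have "\<dots> = cl (Add s t)"
    using ne by blast
  finally show ?thesis .
qed

lemma sq_Q [simp]:
  assumes "t \<in> W"
  shows "sq Q i n (cl t) = cl (Sq i t)"
proof -
  have *: "cl (Sq i t') = cl (Sq i t)" if "t' \<in> cl t" for t'
    using cl_eqI[OF congr.Sq[of t t' W E i]] that assms by simp
  have ne: "t \<in> cl t" using assms by (auto intro: congr.refl)
  have "sq Q i n (cl t) = (\<Union>t'\<in>cl t. cl (Sq i t'))"
    by (simp add: quot_mod_def)
  also have "\<dots> = (\<Union>t'\<in>cl t. cl (Sq i t))"
    by (intro SUP_cong HOL.refl *)
  also have "\<dots> = cl (Sq i t)"
    using ne by blast
  finally show ?thesis .
qed

lemma gsum_W: "set ts \<subseteq> {t \<in> W. tdeg t = n} \<Longrightarrow>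
    gsum (term_alg W) n ts \<in> W \<and> tdeg (gsum (term_alg W) n ts) = n"
  by (induction ts) auto

lemma gsum_Q: "set ts \<subseteq> {t \<in> W. tdeg t = n} \<Longrightarrow>
    gsum Q n (map cl ts) = cl (gsum (term_alg W) n ts)"
  by (induction ts) (use gsum_W in auto)

lemma closed_Q: "closed_gmod Q"
proof -
  have "add Q n X Y \<in> carr Q n" if XY: "X \<in> carr Q n" "Y \<in> carr Q n" for n X Y
  proof -
    from XY obtain s t where "s \<in> W" "tdeg s = n" "X = cl s" "t \<in> W" "tdeg t = n" "Y = cl t"
      by (meson cl_E)
    then show ?thesis by simp
  qed
  moreover have "sq Q i n X \<in> carr Q (n + i)" if X: "X \<in> carr Q n" for i n X
  proof -
    from X obtain t where "t \<in> W" "tdeg t = n" "X = cl t" by (meson cl_E)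
    then show ?thesis by simp
  qed
  ultimately show ?thesis unfolding closed_gmod_def by simp
qed

lemma base_cl:
  assumes "S \<subseteq> E" "(s, t) \<in> S" shows "cl s = cl t"
  by (rule cl_eqI, rule congr.base) (use assms in blast)

lemma vec_Q:
  assumes *: "vec_ids (term_alg W) \<subseteq> E" shows "vec_ids Q \<subseteq> Id"
proof -
  have assoc: "add Q n (add Q n X Y) Z = add Q n X (add Q n Y Z)"
    if XYZ: "X \<in> carr Q n" "Y \<in> carr Q n" "Z \<in> carr Q n" for n X Y Z
  proof -
    from XYZ obtain r s t where "r \<in> W" "tdeg r = n" "X = cl r" "s \<in> W" "tdeg s = n" "Y = cl s"
      "t \<in> W" "tdeg t = n" "Z = cl t" by (meson cl_E)
    moreover from this have m: "(Add (Add r s) t, Add r (Add s t)) \<in> vec_ids (term_alg W)"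
      by (simp add: vec_ids_def)
    ultimately show ?thesis using base_cl[OF * m] by simp
  qed
  have comm: "add Q n X Y = add Q n Y X" if XY: "X \<in> carr Q n" "Y \<in> carr Q n" for n X Y
  proof -
    from XY obtain s t where "s \<in> W" "tdeg s = n" "X = cl s" "t \<in> W" "tdeg t = n" "Y = cl t"
      by (meson cl_E)
    moreover from this have m: "(Add s t, Add t s) \<in> vec_ids (term_alg W)"
      by (simp add: vec_ids_def)
    ultimately show ?thesis using base_cl[OF * m] by simp
  qed
  have zero: "add Q n (zer Q n) X = X" "add Q n X X = zer Q n" if X: "X \<in> carr Q n" for n X
  proof -
    from X obtain t where "t \<in> W" "tdeg t = n" "X = cl t" by (meson cl_E)
    moreover from this have m: "(Add (Zero n) t, t) \<in> vec_ids (term_alg W)"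
      "(Add t t, Zero n) \<in> vec_ids (term_alg W)"
      by (simp_all add: vec_ids_def)
    ultimately show "add Q n (zer Q n) X = X" "add Q n X X = zer Q n"
      using base_cl[OF * m(1)] base_cl[OF * m(2)] by simp_all
  qed
  show ?thesis
    unfolding vec_ids_iff using assoc comm zero by blast
qed


lemma sq_additive_Q:
  assumes *: "sq_additive_ids (term_alg W) \<subseteq> E" shows "sq_additive_ids Q \<subseteq> Id"
proof -
  have "sq Q i n (add Q n X Y) = add Q (n + i) (sq Q i n X) (sq Q i n Y)"
    if XY: "X \<in> carr Q n" "Y \<in> carr Q n" for i n X Y
  proof -
    from XY obtain s t where "s \<in> W" "tdeg s = n" "X = cl s" "t \<in> W" "tdeg t = n" "Y = cl t"
      by (meson cl_E)
    moreover from this have m: "(Sq i (Add s t), Add (Sq i s) (Sq i t)) \<in> sq_additive_ids (term_alg W)"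
      by (auto simp: sq_additive_ids_def)
    ultimately show ?thesis using base_cl[OF * m] by simp
  qed
  then show ?thesis unfolding sq_additive_ids_iff by blast
qed

lemma instability_Q:
  assumes *: "instability_ids (term_alg W) \<subseteq> E" shows "instability_ids Q \<subseteq> Id"
proof -
  have "sq Q i n X = zer Q (n + i)" if X: "X \<in> carr Q n" "n < i" for i n X
  proof -
    from X obtain t where "t \<in> W" "tdeg t = n" "X = cl t" by (meson cl_E)
    moreover from this have m: "(Sq i t, Zero (n + i)) \<in> instability_ids (term_alg W)"
      using X by (auto simp: instability_ids_def)
    ultimately show ?thesis using base_cl[OF * m] by simp
  qed
  then show ?thesis unfolding instability_ids_iff by blast
qed

lemma steenrod_Q:
  assumes *: "steenrod_ids (term_alg W) \<subseteq> E" shows "steenrod_ids Q \<subseteq> Id"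
proof -
  have sq0: "sq Q 0 n X = X" if X: "X \<in> carr Q n" for n X
  proof -
    from X obtain t where "t \<in> W" "tdeg t = n" "X = cl t" by (meson cl_E)
    moreover from this have m: "(Sq 0 t, t) \<in> steenrod_ids (term_alg W)"
      by (auto simp: steenrod_ids_def)
    ultimately show ?thesis using base_cl[OF * m] by simp
  qed
  have adem: "sq Q a (n + b) (sq Q b n X) =
       gsum Q (n + a + b)
         (map (\<lambda>j. sq Q (a + b - j) (n + j) (sq Q j n X))
           (filter (\<lambda>j. odd ((b - 1 - j) choose (a - 2 * j))) [0..<Suc (a div 2)]))"
    if X: "X \<in> carr Q n" and ab: "0 < a" "a < 2 * b" for a b n X
  proof -
    let ?js = "filter (\<lambda>j. odd ((b - 1 - j) choose (a - 2 * j))) [0..<Suc (a div 2)]"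
    let ?r = "\<lambda>t. map (\<lambda>j. Sq (a + b - j) (Sq j t)) ?js"
    from X obtain t where t: "t \<in> W" "tdeg t = n" "X = cl t" by (meson cl_E)
    have m: "(Sq a (Sq b t), gsum (term_alg W) (n + a + b) (?r t)) \<in> steenrod_ids (term_alg W)"
      using adem_memI[of t "term_alg W" n a b, unfolded term_alg_simps mem_Collect_eq] t(1,2) ab
      by blast
    have "sq Q a (n + b) (sq Q b n X) = cl (Sq a (Sq b t))"
      using t by simp
    also have "\<dots> = cl (gsum (term_alg W) (n + a + b) (?r t))"
      by (rule base_cl[OF * m])
    also have "\<dots> = gsum Q (n + a + b) (map cl (?r t))"
    proof (rule gsum_Q[symmetric], rule subsetI)
      fix u assume "u \<in> set (?r t)"
      then obtain j where "j \<le> a div 2" and u: "u = Sq (a + b - j) (Sq j t)"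
        by (auto simp del: upt_Suc)
      then have "j \<le> a + b" by linarith
      with t(1,2) show "u \<in> {t \<in> W. tdeg t = n + a + b}" unfolding u by simp
    qed
    also have "map cl (?r t) = map (\<lambda>j. sq Q (a + b - j) (n + j) (sq Q j n X)) ?js"
      unfolding t(3) by (simp only: map_map comp_def sq_Q[OF t(1)] sq_Q[OF Sq_W[OF t(1)]])
    finally show ?thesis .
  qed
  show ?thesis
    unfolding steenrod_ids_iff by (intro conjI allI ballI impI) (rule sq0 adem, assumption+)+
qed

lemma unstable_Q:
  assumes "unstable_ids (term_alg W) \<subseteq> E" shows "unstable_module Q"
  using assms vec_Q sq_additive_Q instability_Q steenrod_Q closed_Q
  unfolding unstable_module_def unstable_ids_def by simp

end

locale term_eval = term_quotient W E
  for W :: "'g trm set" and E :: "('g trm \<times> 'g trm) set" +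
  fixes M :: "('b, 'z) gmod_scheme" and st :: "nat \<Rightarrow> nat \<Rightarrow> 'b \<Rightarrow> 'b \<Rightarrow> 'b" and h :: "nat \<Rightarrow> 'g \<Rightarrow> 'b"
  assumes teval_carr: "t \<in> W \<Longrightarrow> teval M st h t \<in> carr M (tdeg t)"
    and teval_E: "(s, t) \<in> E \<Longrightarrow> teval M st h s = teval M st h t"
begin

abbreviation ev :: "'g trm \<Rightarrow> 'b" where
  "ev \<equiv> teval M st h"

definition qmap :: "nat \<Rightarrow> 'g trm set \<Rightarrow> 'b" where
  "qmap n = (\<lambda>X\<in>carr Q n. the_elem (ev ` X))"

lemma teval_congr: "(s, t) \<in> congr W E \<Longrightarrow> ev s = ev t"
proof (induction rule: congr.induct)
  case (Add s s' t t')
  then show ?case using congr_W[of s s'] by simp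
next
  case (Sq t t' i)
  then show ?case using congr_W[of t t'] by simp
next
  case (Star s s' t t')
  then show ?case using congr_W[of s s'] congr_W[of t t'] by simp
qed (simp_all add: teval_E)

lemma qmap_cl:
  assumes "t \<in> W" "tdeg t = n" shows "qmap n (cl t) = ev t"
proof -
  have "ev ` cl t = {ev t}"
  proof
    show "ev ` cl t \<subseteq> {ev t}" using teval_congr by fastforce
    show "{ev t} \<subseteq> ev ` cl t" using congr.refl[OF assms(1)] by blast
  qed
  then show ?thesis using assms by (simp add: qmap_def)
qed

lemma qmap_mor: "qmap \<in> mor Q M"
proof -
  have carr: "qmap n X \<in> carr M n" if X: "X \<in> carr Q n" for n X
  proof -
    from X obtain t where "t \<in> W" "tdeg t = n" "X = cl t" by (meson cl_E)
    then show ?thesis using teval_carr[of t] by (simp add: qmap_cl)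
  qed
  have add: "qmap n (add Q n X Y) = add M n (qmap n X) (qmap n Y)"
    if XY: "X \<in> carr Q n" "Y \<in> carr Q n" for n X Y
  proof -
    from XY obtain s t where "s \<in> W" "tdeg s = n" "X = cl s" "t \<in> W" "tdeg t = n" "Y = cl t"
      by (meson cl_E)
    then show ?thesis by (simp add: qmap_cl)
  qed
  have sq: "qmap (n + i) (sq Q i n X) = sq M i n (qmap n X)" if X: "X \<in> carr Q n" for i n X
  proof -
    from X obtain t where "t \<in> W" "tdeg t = n" "X = cl t" by (meson cl_E)
    then show ?thesis by (simp add: qmap_cl)
  qed
  have "qmap n \<in> extensional (carr Q n)" for n by (simp add: qmap_def)
  then show ?thesis unfolding mor_def PiE_def using carr add sq by auto
qed

end

lemma closed_ids:
  assumes W: "closed_gmod (term_alg W)" and st: "(s, t) \<in> unstable_ids (term_alg W)"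
  shows "s \<in> W \<and> t \<in> W \<and> tdeg s = tdeg t"
proof -
  have [simp]: "Zero n \<in> W" "s \<in> W \<Longrightarrow> t \<in> W \<Longrightarrow> tdeg s = tdeg t \<Longrightarrow> Add s t \<in> W"
    "t \<in> W \<Longrightarrow> Sq i t \<in> W" for n s t i
    using W by (auto simp: closed_gmod_def)
  consider "(s, t) \<in> vec_ids (term_alg W)" | "(s, t) \<in> sq_additive_ids (term_alg W)" |
    "(s, t) \<in> steenrod_ids (term_alg W)" | "(s, t) \<in> instability_ids (term_alg W)"
    using st by (auto simp: unstable_ids_def)
  then show ?thesis
  proof cases
    case 3
    then consider "t \<in> W" "s = Sq 0 t" | u a b where "u \<in> W" "s = Sq a (Sq b u)"
      "t = gsum (term_alg W) (tdeg u + a + b)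
         (map (\<lambda>j. Sq (a + b - j) (Sq j u))
           (filter (\<lambda>j. odd ((b - 1 - j) choose (a - 2 * j))) [0..<Suc (a div 2)]))"
      unfolding steenrod_ids_def term_alg_simps by blast
    then show ?thesis
    proof cases
      case 2
      have "t \<in> carr (term_alg W) (tdeg u + a + b)"
        unfolding 2(3)
      proof (rule closed_gsum[OF W])
        fix v assume "v \<in> set (map (\<lambda>j. Sq (a + b - j) (Sq j u))
           (filter (\<lambda>j. odd ((b - 1 - j) choose (a - 2 * j))) [0..<Suc (a div 2)]))"
        then obtain j where "j \<le> a div 2" and v: "v = Sq (a + b - j) (Sq j u)"
          by (auto simp del: upt_Suc)
        then have "j \<le> a + b" by linarith
        with 2(1) show "v \<in> carr (term_alg W) (tdeg u + a + b)" unfolding v by simp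
      qed
      then show ?thesis using 2(1,2) by simp
    qed auto
  qed (auto simp: vec_ids_def sq_additive_ids_def instability_ids_def)
qed

lemma teval_gsum:
  assumes "\<forall>t\<in>set ts. tdeg t = n"
  shows "teval M st h (gsum (term_alg W) n ts) = gsum M n (map (teval M st h) ts)"
  using assms by (induction ts) auto

lemma teval_unstable_ids:
  assumes M: "unstable_module M" and W: "\<And>t. t \<in> W \<Longrightarrow> teval M st h t \<in> carr M (tdeg t)"
    and st: "(s, t) \<in> unstable_ids (term_alg W)"
  shows "teval M st h s = teval M st h t"
proof -
  let ?e = "teval M st h"
  have ids: "vec_ids M \<subseteq> Id" "sq_additive_ids M \<subseteq> Id" "steenrod_ids M \<subseteq> Id" "instability_ids M \<subseteq> Id"
    using M by (auto simp: unstable_module_def unstable_ids_def)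
  note vec = ids(1)[unfolded vec_ids_iff, THEN conjunct1, rule_format]
    ids(1)[unfolded vec_ids_iff, THEN conjunct2, THEN conjunct1, rule_format]
    ids(1)[unfolded vec_ids_iff, THEN conjunct2, THEN conjunct2, THEN conjunct1, rule_format]
    ids(1)[unfolded vec_ids_iff, THEN conjunct2, THEN conjunct2, THEN conjunct2, rule_format]
  note sqa = ids(2)[unfolded sq_additive_ids_iff, rule_format]
  note ste = ids(3)[unfolded steenrod_ids_iff, THEN conjunct1, rule_format]
  note ins = ids(4)[unfolded instability_ids_iff, rule_format]
  consider "(s, t) \<in> vec_ids (term_alg W)" | "(s, t) \<in> sq_additive_ids (term_alg W)" |
    "(s, t) \<in> steenrod_ids (term_alg W)" | "(s, t) \<in> instability_ids (term_alg W)"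
    using st by (auto simp: unstable_ids_def)
  then show ?thesis
  proof cases
    case 1
    then consider
      x y z where "x \<in> W" "y \<in> W" "z \<in> W" "tdeg y = tdeg x" "tdeg z = tdeg x"
        "s = Add (Add x y) z" "t = Add x (Add y z)" |
      x y where "x \<in> W" "y \<in> W" "tdeg y = tdeg x" "s = Add x y" "t = Add y x" |
      "t \<in> W" "s = Add (Zero (tdeg t)) t" |
      x where "x \<in> W" "s = Add x x" "t = Zero (tdeg x)"
      unfolding vec_ids_def term_alg_simps by blast
    then show ?thesis
    proof cases
      case (1 x y z)
      then show ?thesis using vec(1)[of "?e x" "tdeg x" "?e y" "?e z"] W[of x] W[of y] W[of z] by simp
    next
      case (2 x y)
      then show ?thesis using vec(2)[of "?e x" "tdeg x" "?e y"] W[of x] W[of y] by simp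
    next
      case 3
      then show ?thesis using vec(3)[of "?e t" "tdeg t"] W[of t] by simp
    next
      case (4 x)
      then show ?thesis using vec(4)[of "?e x" "tdeg x"] W[of x] by simp
    qed
  next
    case 2
    then obtain i x y where "x \<in> W" "y \<in> W" "tdeg y = tdeg x"
      "s = Sq i (Add x y)" "t = Add (Sq i x) (Sq i y)"
      unfolding sq_additive_ids_def term_alg_simps by blast
    then show ?thesis using sqa[of "?e x" "tdeg x" "?e y" i] W[of x] W[of y] by simp
  next
    case 4
    then obtain i x where "x \<in> W" "tdeg x < i" "s = Sq i x" "t = Zero (tdeg x + i)"
      unfolding instability_ids_def term_alg_simps by blast
    then show ?thesis using ins[of "?e x" "tdeg x" i] W[of x] by simp
  next
    case 3
    then consider "t \<in> W" "s = Sq 0 t" | u a b where "u \<in> W" "0 < a" "a < 2 * b" "s = Sq a (Sq b u)"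
      "t = gsum (term_alg W) (tdeg u + a + b)
         (map (\<lambda>j. Sq (a + b - j) (Sq j u))
           (filter (\<lambda>j. odd ((b - 1 - j) choose (a - 2 * j))) [0..<Suc (a div 2)]))"
      unfolding steenrod_ids_def term_alg_simps by blast
    then show ?thesis
    proof cases
      case 1
      then show ?thesis using ste[of "?e t" "tdeg t"] W[of t] by simp
    next
      case (2 u a b)
      let ?js = "filter (\<lambda>j. odd ((b - 1 - j) choose (a - 2 * j))) [0..<Suc (a div 2)]"
      have "?e t = gsum M (tdeg u + a + b) (map ?e (map (\<lambda>j. Sq (a + b - j) (Sq j u)) ?js))"
        unfolding 2(5)
      proof (rule teval_gsum, rule ballI)
        fix v assume "v \<in> set (map (\<lambda>j. Sq (a + b - j) (Sq j u)) ?js)"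
        then obtain j where "j \<le> a div 2" and v: "v = Sq (a + b - j) (Sq j u)"
          by (auto simp del: upt_Suc)
        then have "j \<le> a + b" by linarith
        then show "tdeg v = tdeg u + a + b" unfolding v by simp
      qed
      also have "map ?e (map (\<lambda>j. Sq (a + b - j) (Sq j u)) ?js) =
          map (\<lambda>j. sq M (a + b - j) (tdeg u + j) (sq M j (tdeg u) (?e u))) ?js"
        by (simp only: map_map comp_def teval.simps tdeg.simps)
      also have "gsum M (tdeg u + a + b) \<dots> = sq M a (tdeg u + b) (sq M b (tdeg u) (?e u))"
        by (rule Id_D[OF ids(3) adem_memI[OF W[OF 2(1)] 2(2,3)], symmetric])
      finally show ?thesis unfolding 2(4) by simp
    qed
  qed
qed

subsection \<open>Morphisms\<close>

lemma mor_carr: "f \<in> mor M N \<Longrightarrow> x \<in> carr M n \<Longrightarrow> f n x \<in> carr N n"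
  and mor_add: "f \<in> mor M N \<Longrightarrow> x \<in> carr M n \<Longrightarrow> y \<in> carr M n \<Longrightarrow>
    f n (add M n x y) = add N n (f n x) (f n y)"
  and mor_sq: "f \<in> mor M N \<Longrightarrow> x \<in> carr M n \<Longrightarrow> f (n + i) (sq M i n x) = sq N i n (f n x)"
  and mor_undefined: "f \<in> mor M N \<Longrightarrow> x \<notin> carr M n \<Longrightarrow> f n x = undefined"
  unfolding mor_def by (auto simp: PiE_def extensional_def)

lemma mor_eqI:
  assumes "f \<in> mor M N" "g \<in> mor M N" "\<And>n x. x \<in> carr M n \<Longrightarrow> f n x = g n x"
  shows "f = g"
proof (intro ext)
  fix n x show "f n x = g n x"
    by (cases "x \<in> carr M n")
      (simp_all add: assms(3) mor_undefined[OF assms(1)] mor_undefined[OF assms(2)])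
qed

lemma morI:
  assumes "\<And>n x. x \<in> carr M n \<Longrightarrow> f n x \<in> carr N n"
    "\<And>n x. x \<notin> carr M n \<Longrightarrow> f n x = undefined"
    "\<And>n x y. x \<in> carr M n \<Longrightarrow> y \<in> carr M n \<Longrightarrow> f n (add M n x y) = add N n (f n x) (f n y)"
    "\<And>i n x. x \<in> carr M n \<Longrightarrow> f (n + i) (sq M i n x) = sq N i n (f n x)"
  shows "f \<in> mor M N"
  unfolding mor_def PiE_def extensional_def using assms by simp

lemma closed_gmodD:
  assumes "closed_gmod M"
  shows "zer M n \<in> carr M n"
    and "x \<in> carr M n \<Longrightarrow> y \<in> carr M n \<Longrightarrow> add M n x y \<in> carr M n"
    and "x \<in> carr M n \<Longrightarrow> sq M i n x \<in> carr M (n + i)"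
  using assms by (auto simp: closed_gmod_def)

lemma unstable_closed: "unstable_module M \<Longrightarrow> closed_gmod M"
  by (simp add: unstable_module_def)

lemmas unstableD = closed_gmodD[OF unstable_closed]

lemma unstable_vec:
  assumes "unstable_module M"
  shows "x \<in> carr M n \<Longrightarrow> y \<in> carr M n \<Longrightarrow> z \<in> carr M n \<Longrightarrow>
      add M n (add M n x y) z = add M n x (add M n y z)"
    and "x \<in> carr M n \<Longrightarrow> y \<in> carr M n \<Longrightarrow> add M n x y = add M n y x"
    and "x \<in> carr M n \<Longrightarrow> add M n (zer M n) x = x"
    and "x \<in> carr M n \<Longrightarrow> add M n x x = zer M n"
proof -
  have "vec_ids M \<subseteq> Id" using assms by (simp add: unstable_module_def unstable_ids_def)
  note v = this[unfolded vec_ids_iff]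
  show "x \<in> carr M n \<Longrightarrow> y \<in> carr M n \<Longrightarrow> z \<in> carr M n \<Longrightarrow>
      add M n (add M n x y) z = add M n x (add M n y z)"
    using v[THEN conjunct1] by blast
  show "x \<in> carr M n \<Longrightarrow> y \<in> carr M n \<Longrightarrow> add M n x y = add M n y x"
    using v[THEN conjunct2, THEN conjunct1] by blast
  show "x \<in> carr M n \<Longrightarrow> add M n (zer M n) x = x"
    using v[THEN conjunct2, THEN conjunct2, THEN conjunct1] by blast
  show "x \<in> carr M n \<Longrightarrow> add M n x x = zer M n"
    using v[THEN conjunct2, THEN conjunct2, THEN conjunct2] by blast
qed

lemma unstable_comm_group:
  assumes M: "unstable_module M"
  shows "comm_group \<lparr>carrier = carr M n, mult = add M n, one = zer M n\<rparr>"
proof (rule comm_groupI)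
  fix x assume "x \<in> carrier \<lparr>carrier = carr M n, mult = add M n, one = zer M n\<rparr>"
  then show "\<exists>y\<in>carrier \<lparr>carrier = carr M n, mult = add M n, one = zer M n\<rparr>.
      y \<otimes>\<^bsub>\<lparr>carrier = carr M n, mult = add M n, one = zer M n\<rparr>\<^esub> x =
      \<one>\<^bsub>\<lparr>carrier = carr M n, mult = add M n, one = zer M n\<rparr>\<^esub>"
    using unstable_vec(4)[OF M] by auto
qed (simp_all add: unstable_vec(1,3)[OF M] unstableD[OF M], simp add: unstable_vec(2)[OF M])

lemma unstable_sq_add:
  assumes "unstable_module M" "x \<in> carr M n" "y \<in> carr M n"
  shows "sq M i n (add M n x y) = add M (n + i) (sq M i n x) (sq M i n y)"
proof -
  have "sq_additive_ids M \<subseteq> Id" using assms by (simp add: unstable_module_def unstable_ids_def)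
  then show ?thesis using assms(2,3) unfolding sq_additive_ids_iff by blast
qed

lemma unstable_sq0:
  assumes "unstable_module M" "x \<in> carr M n"
  shows "sq M 0 n x = x"
proof -
  have "steenrod_ids M \<subseteq> Id" using assms by (simp add: unstable_module_def unstable_ids_def)
  then show ?thesis using assms(2) unfolding steenrod_ids_iff by simp
qed

lemma unstable_adem:
  assumes "unstable_module M" "x \<in> carr M n" "0 < a" "a < 2 * b"
  shows "sq M a (n + b) (sq M b n x) =
       gsum M (n + a + b)
         (map (\<lambda>j. sq M (a + b - j) (n + j) (sq M j n x))
           (filter (\<lambda>j. odd ((b - 1 - j) choose (a - 2 * j))) [0..<Suc (a div 2)]))"
proof -
  have "steenrod_ids M \<subseteq> Id" using assms by (simp add: unstable_module_def unstable_ids_def)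
  from Id_D[OF this adem_memI] assms show ?thesis by blast
qed

lemma unstable_vanish:
  assumes "unstable_module M" "x \<in> carr M n" "n < i"
  shows "sq M i n x = zer M (n + i)"
proof -
  have "instability_ids M \<subseteq> Id" using assms by (simp add: unstable_module_def unstable_ids_def)
  then show ?thesis using assms(2,3) unfolding instability_ids_iff by blast
qed

lemma mor_zer:
  assumes "f \<in> mor M N" "unstable_module M" "unstable_module N"
  shows "f n (zer M n) = zer N n"
proof -
  have z: "zer M n \<in> carr M n" using assms(2) by (rule unstableD)
  have "f n (zer M n) = f n (add M n (zer M n) (zer M n))"
    using unstable_vec(4)[OF assms(2) z] by simp
  also have "\<dots> = zer N n"
    using mor_add[OF assms(1) z z] unstable_vec(4)[OF assms(3) mor_carr[OF assms(1) z]] by simp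
  finally show ?thesis .
qed

lemma mor_comp:
  assumes "f \<in> mor A B" "g \<in> mor B C" "closed_gmod A"
  shows "(\<lambda>n. \<lambda>x\<in>carr A n. g n (f n x)) \<in> mor A C"
  by (rule morI)
    (simp_all add: closed_gmodD[OF assms(3)] mor_carr[OF assms(1)] mor_carr[OF assms(2)]
      mor_add[OF assms(1)] mor_add[OF assms(2)] mor_sq[OF assms(1)] mor_sq[OF assms(2)])

lemma mor_sum:
  assumes "f \<in> mor A B" "g \<in> mor A B" and A: "closed_gmod A" and B: "unstable_module B"
  shows "(\<lambda>n. \<lambda>x\<in>carr A n. add B n (f n x) (g n x)) \<in> mor A B"
proof (rule morI)
  fix n x y assume x: "x \<in> carr A n" and y: "y \<in> carr A n"
  note c = mor_carr[OF assms(1)] mor_carr[OF assms(2)] unstableD(2)[OF B]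
  have "add B n (add B n (f n x) (f n y)) (add B n (g n x) (g n y)) =
      add B n (f n x) (add B n (f n y) (add B n (g n x) (g n y)))"
    by (rule unstable_vec(1)[OF B]) (use c x y in blast)+
  also have "add B n (f n y) (add B n (g n x) (g n y)) =
      add B n (add B n (f n y) (g n x)) (g n y)"
    by (rule unstable_vec(1)[OF B, symmetric]) (use c x y in blast)+
  also have "add B n (f n y) (g n x) = add B n (g n x) (f n y)"
    by (rule unstable_vec(2)[OF B]) (use c x y in blast)+
  also have "add B n (add B n (g n x) (f n y)) (g n y) = add B n (g n x) (add B n (f n y) (g n y))"
    by (rule unstable_vec(1)[OF B]) (use c x y in blast)+
  also have "add B n (f n x) \<dots> = add B n (add B n (f n x) (g n x)) (add B n (f n y) (g n y))"
    by (rule unstable_vec(1)[OF B, symmetric]) (use c x y in blast)+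
  finally show "(\<lambda>x\<in>carr A n. add B n (f n x) (g n x)) (add A n x y) =
      add B n ((\<lambda>x\<in>carr A n. add B n (f n x) (g n x)) x)
        ((\<lambda>x\<in>carr A n. add B n (f n x) (g n x)) y)"
    using x y by (simp add: closed_gmodD[OF A] mor_add[OF assms(1)] mor_add[OF assms(2)])
qed (simp_all add: closed_gmodD[OF A] unstableD[OF B] mor_carr[OF assms(1)] mor_carr[OF assms(2)]
      mor_sq[OF assms(1)] mor_sq[OF assms(2)] unstable_sq_add[OF B])


subsection \<open>\<open>F(n)\<close> represents \<open>M \<mapsto> M\<^sup>n\<close>\<close>

lemma F_terms_D:
  "Add s t \<in> F_terms n \<Longrightarrow> s \<in> F_terms n \<and> t \<in> F_terms n \<and> tdeg s = tdeg t"
  "Sq i t \<in> F_terms n \<Longrightarrow> t \<in> F_terms n"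
  "Star s t \<notin> F_terms n"
  unfolding F_terms_def by (auto elim: mod_terms.cases)

lemma closed_F_terms: "closed_gmod (term_alg (F_terms n))"
  by (auto simp: closed_gmod_def F_terms_def intro: mod_terms.intros)

interpretation Fq: term_quotient "F_terms n" "unstable_ids (term_alg (F_terms n))" for n
  by unfold_locales (use closed_ids closed_F_terms F_terms_D in blast)+

lemma F_unstable: "unstable_module (F n)"
  unfolding F_def by (rule Fq.unstable_Q) simp

lemma Gen_F: "Gen n () \<in> F_terms n"
  unfolding F_terms_def by (rule mod_terms.intros) simp

lemma iota_carr: "iota n \<in> carr (F n) n"
  unfolding F_def iota_def using Gen_F by (intro Fq.cl_carr) simp_all

lemma F_universal:
  assumes M: "unstable_module M" and x: "x \<in> carr M n"
  shows "\<exists>!f. f \<in> mor (F n) M \<and> f n (iota n) = x"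
proof -
  have c: "teval M undefined (\<lambda>_ _. x) t \<in> carr M (tdeg t)" if "t \<in> F_terms n" for t
    using that unfolding F_terms_def
    by (induction rule: mod_terms.induct) (use x unstableD[OF M] in \<open>auto split: if_splits\<close>)
  interpret term_eval "F_terms n" "unstable_ids (term_alg (F_terms n))" M undefined "\<lambda>_ _. x"
    by unfold_locales (use c teval_unstable_ids[OF M c] in blast)+
  have 1: "qmap \<in> mor (F n) M \<and> qmap n (iota n) = x"
    using qmap_mor qmap_cl[OF Gen_F] by (simp add: F_def iota_def)
  have 2: "f (tdeg t) (Fq.cl n t) = ev t"
    if f: "f \<in> mor (F n) M" "f n (iota n) = x" and t: "t \<in> F_terms n" for f t
    using t
  proof (induction t)
    case (Gen m g)
    then have "m = n" by (auto simp: F_terms_def elim: mod_terms.cases split: if_splits)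
    then show ?case using f by (simp add: iota_def)
  next
    case (Zero m)
    then show ?case using mor_zer[OF f(1) F_unstable M, of m] by (simp add: F_def)
  next
    case (Add s t)
    note st = F_terms_D(1)[OF Add.prems]
    then show ?case using mor_add[OF f(1), of "Fq.cl n s" "tdeg s" "Fq.cl n t"] Add.IH by (simp add: F_def)
  next
    case (Sq i t)
    note t = F_terms_D(2)[OF Sq.prems]
    then show ?case using mor_sq[OF f(1), of "Fq.cl n t" "tdeg t" i] Sq.IH by (simp add: F_def)
  qed (simp add: F_terms_D(3))
  show ?thesis
  proof (rule ex1I, rule 1)
    fix f assume f: "f \<in> mor (F n) M \<and> f n (iota n) = x"
    show "f = qmap"
    proof (rule mor_eqI)
      fix m X assume "X \<in> carr (F n) m"
      then obtain t where "t \<in> F_terms n" "tdeg t = m" "X = Fq.cl n t"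
        unfolding F_def by (meson Fq.cl_E)
      then show "f m X = qmap m X" using 2[of f t] f qmap_cl[of t m] by simp
    qed (use f 1 in auto)
  qed
qed

lemma F_mor:
  assumes "unstable_module M" "x \<in> carr M n"
  shows "F_mor M n x \<in> mor (F n) M" "F_mor M n x n (iota n) = x"
  using theI'[OF F_universal[OF assms]] by (auto simp: F_mor_def)

lemma F_mor_unique:
  assumes "unstable_module M" "x \<in> carr M n" "f \<in> mor (F n) M" "f n (iota n) = x"
  shows "f = F_mor M n x"
  using F_universal[OF assms(1,2)] F_mor[OF assms(1,2)] assms(3,4) by blast

lemma F_mor_carr:
  "unstable_module M \<Longrightarrow> x \<in> carr M m \<Longrightarrow> z \<in> carr (F m) n \<Longrightarrow> F_mor M m x n z \<in> carr M n"
  by (rule mor_carr[OF F_mor(1)])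

lemma F_mor_comp:
  assumes M: "unstable_module M" and N: "unstable_module N" and g: "g \<in> mor M N"
    and x: "x \<in> carr M m" and z: "z \<in> carr (F m) n"
  shows "g n (F_mor M m x n z) = F_mor N m (g m x) n z"
proof -
  have "(\<lambda>n. \<lambda>z\<in>carr (F m) n. g n (F_mor M m x n z)) = F_mor N m (g m x)"
    using mor_comp[OF F_mor(1)[OF M x] g unstable_closed[OF F_unstable]] iota_carr F_mor(2)[OF M x]
    by (intro F_mor_unique[OF N mor_carr[OF g x]]) simp_all
  from fun_cong[OF fun_cong[OF this, of n], of z] show ?thesis using z by simp
qed

lemma F_mor_add:
  assumes M: "unstable_module M" and x: "x \<in> carr M m" and y: "y \<in> carr M m"
    and z: "z \<in> carr (F m) n"
  shows "F_mor M m (add M m x y) n z = add M n (F_mor M m x n z) (F_mor M m y n z)"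
proof -
  have "(\<lambda>n. \<lambda>z\<in>carr (F m) n. add M n (F_mor M m x n z) (F_mor M m y n z)) =
      F_mor M m (add M m x y)"
    using mor_sum[OF F_mor(1)[OF M x] F_mor(1)[OF M y] unstable_closed[OF F_unstable] M]
      iota_carr F_mor(2)[OF M x] F_mor(2)[OF M y]
    by (intro F_mor_unique[OF M unstableD(2)[OF M x y]]) simp_all
  from fun_cong[OF fun_cong[OF this, of n], of z] show ?thesis using z by simp
qed

lemma F_mor_zer:
  assumes M: "unstable_module M" and z: "z \<in> carr (F m) n"
  shows "F_mor M m (zer M m) n z = zer M n"
  using F_mor_add[OF M unstableD(1)[OF M] unstableD(1)[OF M] z]
    unstable_vec(4)[OF M unstableD(1)[OF M]]
    unstable_vec(4)[OF M F_mor_carr[OF M unstableD(1)[OF M] z]] by simp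

lemma F_mor_iota:
  assumes z: "z \<in> carr (F m) n"
  shows "F_mor (F m) m (iota m) n z = z"
proof -
  have "(\<lambda>n. \<lambda>z\<in>carr (F m) n. z) = F_mor (F m) m (iota m)"
    by (rule F_mor_unique[OF F_unstable iota_carr])
      (auto intro!: morI simp: iota_carr unstableD[OF F_unstable])
  from fun_cong[OF fun_cong[OF this, of n], of z] show ?thesis using z by simp
qed

lemma F_mor_sq:
  assumes M: "unstable_module M" and x: "x \<in> carr M m" and z: "z \<in> carr (F (m + i)) n"
  shows "F_mor M (m + i) (sq M i m x) n z =
    F_mor M m x n (F_mor (F m) (m + i) (sq (F m) i m (iota m)) n z)"
  using F_mor_comp[OF F_unstable M F_mor(1)[OF M x] unstableD(3)[OF F_unstable iota_carr] z]
    mor_sq[OF F_mor(1)[OF M x] iota_carr] F_mor(2)[OF M x] by simp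


subsection \<open>\<open>J(n)\<close> represents the dual of \<open>M \<mapsto> M\<^sup>n\<close>\<close>

lemma dualI:
  assumes "\<And>x. x \<notin> carr M n \<Longrightarrow> \<phi> x = undefined"
    "\<And>x y. x \<in> carr M n \<Longrightarrow> y \<in> carr M n \<Longrightarrow> \<phi> (add M n x y) = \<phi> x + \<phi> y"
  shows "\<phi> \<in> dual M n"
  using assms by (simp add: dual_def PiE_def extensional_def)

lemma dualD:
  assumes "\<phi> \<in> dual M n"
  shows "x \<notin> carr M n \<Longrightarrow> \<phi> x = undefined"
    "x \<in> carr M n \<Longrightarrow> y \<in> carr M n \<Longrightarrow> \<phi> (add M n x y) = \<phi> x + \<phi> y"
  using assms by (simp_all add: dual_def PiE_def extensional_def)

lemma dual_eqI:
  "\<phi> \<in> dual M n \<Longrightarrow> \<psi> \<in> dual M n \<Longrightarrow> (\<And>x. x \<in> carr M n \<Longrightarrow> \<phi> x = \<psi> x) \<Longrightarrow> \<phi> = \<psi>"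
  by (rule ext) (metis dualD(1))

definition J_act :: "nat \<Rightarrow> nat \<Rightarrow> nat \<Rightarrow> unit trm set \<Rightarrow> (unit trm set \<Rightarrow> bit) \<Rightarrow> unit trm set \<Rightarrow> bit"
  where "J_act n m k \<theta> f = (\<lambda>z\<in>carr (F k) n. f (F_mor (F m) k \<theta> n z))"

lemma J_simps:
  "carr (J n) m = dual (F m) n"
  "zer (J n) m = (\<lambda>z\<in>carr (F m) n. 0)"
  "add (J n) m f g = (\<lambda>z\<in>carr (F m) n. f z + g z)"
  "sq (J n) i m f = J_act n m (m + i) (sq (F m) i m (iota m)) f"
  by (simp_all add: J_def J_act_def)

lemma closed_J_vec:
  "zer (J n) m \<in> carr (J n) m"
  "f \<in> carr (J n) m \<Longrightarrow> g \<in> carr (J n) m \<Longrightarrow> add (J n) m f g \<in> carr (J n) m"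
  by (auto intro!: dualI simp: J_simps unstableD[OF F_unstable] dualD simp del: add_bit_eq_xor)

lemma J_act_dual:
  assumes \<theta>: "\<theta> \<in> carr (F m) k" and f: "f \<in> dual (F m) n"
  shows "J_act n m k \<theta> f \<in> dual (F k) n"
  using F_mor_carr[OF F_unstable \<theta>] mor_add[OF F_mor(1)[OF F_unstable \<theta>]]
  by (auto intro!: dualI simp: J_act_def unstableD[OF F_unstable] dualD[OF f])

lemma J_act_add:
  assumes "\<theta> \<in> carr (F m) k" "\<eta> \<in> carr (F m) k" and f: "f \<in> dual (F m) n"
  shows "J_act n m k (add (F m) k \<theta> \<eta>) f = add (J n) k (J_act n m k \<theta> f) (J_act n m k \<eta> f)"
  using assms(1,2) F_mor_carr[OF F_unstable]
  by (auto intro!: restrict_ext simp: J_act_def J_simps F_mor_add[OF F_unstable] dualD[OF f])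

lemma dual_zer:
  assumes "\<phi> \<in> dual M n" "unstable_module M"
  shows "\<phi> (zer M n) = 0"
proof -
  have z: "zer M n \<in> carr M n" using assms(2) by (rule unstableD)
  have "\<phi> (zer M n) = \<phi> (add M n (zer M n) (zer M n))"
    using unstable_vec(4)[OF assms(2) z] by simp
  also have "\<dots> = \<phi> (zer M n) + \<phi> (zer M n)" by (rule dualD(2)[OF assms(1) z z])
  finally show ?thesis by simp
qed

lemma J_act_zer:
  assumes f: "f \<in> dual (F m) n"
  shows "J_act n m k (zer (F m) k) f = zer (J n) k"
  by (auto intro!: restrict_ext simp: J_act_def J_simps F_mor_zer[OF F_unstable]
      dual_zer[OF f F_unstable])

lemma J_act_iota:
  assumes f: "f \<in> dual (F m) n"
  shows "J_act n m m (iota m) f = f"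
  by (rule dual_eqI[OF J_act_dual[OF iota_carr f] f]) (simp add: J_act_def F_mor_iota)

lemma J_act_sq:
  assumes \<theta>: "\<theta> \<in> carr (F m) k"
  shows "sq (J n) i k (J_act n m k \<theta> f) = J_act n m (k + i) (sq (F m) i k \<theta>) f"
  unfolding J_simps J_act_def
proof (rule restrict_ext)
  fix z assume z: "z \<in> carr (F (k + i)) n"
  have "F_mor (F k) (k + i) (sq (F k) i k (iota k)) n z \<in> carr (F k) n"
    using z by (intro F_mor_carr[OF F_unstable unstableD(3)[OF F_unstable iota_carr]])
  then show "(\<lambda>z\<in>carr (F k) n. f (F_mor (F m) k \<theta> n z))
      (F_mor (F k) (k + i) (sq (F k) i k (iota k)) n z) =
      f (F_mor (F m) (k + i) (sq (F m) i k \<theta>) n z)"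
    using F_mor_sq[OF F_unstable \<theta> z] by simp
qed

lemma J_act_gsum:
  assumes f: "f \<in> dual (F m) n" and "set \<theta>s \<subseteq> carr (F m) k"
  shows "J_act n m k (gsum (F m) k \<theta>s) f = gsum (J n) k (map (\<lambda>\<theta>. J_act n m k \<theta> f) \<theta>s)"
  using assms(2)
proof (induction \<theta>s)
  case (Cons \<theta> \<theta>s)
  then have "gsum (F m) k \<theta>s \<in> carr (F m) k"
    by (intro closed_gsum unstable_closed F_unstable) auto
  with Cons show ?case using J_act_add[OF _ _ f] by simp
qed (simp add: J_act_zer[OF f])

lemma J_unstable: "unstable_module (J n)"
proof -
  note sq_iota = unstableD(3)[OF F_unstable iota_carr]
  have sq_carr: "sq (J n) i m f \<in> carr (J n) (m + i)" if f: "f \<in> carr (J n) m" for i m f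
    using J_act_dual[OF sq_iota] f by (simp add: J_simps)
  have J_sq: "sq (J n) i (m + j) (J_act n m (m + j) \<theta> f) = J_act n m (m + j + i) (sq (F m) i (m + j) \<theta>) f"
    if "\<theta> \<in> carr (F m) (m + j)" for i m j \<theta> f
    using J_act_sq[OF that] .
  have vec: "vec_ids (J n) \<subseteq> Id"
    unfolding vec_ids_iff
    by (intro conjI allI ballI)
      (auto intro!: restrict_ext dual_eqI[OF closed_J_vec(2)[unfolded J_simps]]
        simp: J_simps dualD add_ac)
  have "sq (J n) i m (add (J n) m f g) = add (J n) (m + i) (sq (J n) i m f) (sq (J n) i m g)" for i m f g
    using F_mor_carr[OF F_unstable sq_iota]
    by (auto intro!: restrict_ext simp: J_simps J_act_def)
  then have sqa: "sq_additive_ids (J n) \<subseteq> Id"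
    unfolding sq_additive_ids_iff by blast
  have sq0: "sq (J n) 0 m f = f" if "f \<in> carr (J n) m" for m f
    using that J_act_iota unstable_sq0[OF F_unstable iota_carr] by (simp add: J_simps)
  have adem: "sq (J n) a (m + b) (sq (J n) b m f) =
       gsum (J n) (m + a + b)
         (map (\<lambda>j. sq (J n) (a + b - j) (m + j) (sq (J n) j m f))
           (filter (\<lambda>j. odd ((b - 1 - j) choose (a - 2 * j))) [0..<Suc (a div 2)]))"
    if f: "f \<in> carr (J n) m" and ab: "0 < a" "a < 2 * b" for a b m f
  proof -
    let ?js = "filter (\<lambda>j. odd ((b - 1 - j) choose (a - 2 * j))) [0..<Suc (a div 2)]"
    let ?\<theta> = "\<lambda>j. sq (F m) (a + b - j) (m + j) (sq (F m) j m (iota m))"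
    have js: "m + j + (a + b - j) = m + a + b" if "j \<in> set ?js" for j
      using that by (auto simp del: upt_Suc)
    have f': "f \<in> dual (F m) n" using f by (simp add: J_simps)
    have sqJ: "sq (J n) j m f = J_act n m (m + j) (sq (F m) j m (iota m)) f" for j
      by (simp add: J_simps)
    have "sq (J n) a (m + b) (sq (J n) b m f) =
        J_act n m (m + b + a) (sq (F m) a (m + b) (sq (F m) b m (iota m))) f"
      unfolding sqJ by (rule J_act_sq[OF sq_iota])
    also have "\<dots> = J_act n m (m + a + b) (gsum (F m) (m + a + b) (map ?\<theta> ?js)) f"
      unfolding unstable_adem[OF F_unstable iota_carr ab] by (simp add: add_ac)
    also have "\<dots> = gsum (J n) (m + a + b) (map (\<lambda>\<theta>. J_act n m (m + a + b) \<theta> f) (map ?\<theta> ?js))"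
    proof (rule J_act_gsum[OF f'], rule subsetI)
      fix \<theta> assume "\<theta> \<in> set (map ?\<theta> ?js)"
      then obtain j where j: "j \<in> set ?js" and \<theta>: "\<theta> = ?\<theta> j" unfolding set_map by blast
      have "?\<theta> j \<in> carr (F m) (m + j + (a + b - j))"
        by (rule unstableD(3)[OF F_unstable sq_iota])
      then show "\<theta> \<in> carr (F m) (m + a + b)"
        unfolding \<theta> js[OF j] .
    qed
    also have "map (\<lambda>\<theta>. J_act n m (m + a + b) \<theta> f) (map ?\<theta> ?js) =
        map (\<lambda>j. sq (J n) (a + b - j) (m + j) (sq (J n) j m f)) ?js"
      unfolding map_map
    proof (rule map_cong[OF HOL.refl])
      fix j assume j: "j \<in> set ?js"
      show "((\<lambda>\<theta>. J_act n m (m + a + b) \<theta> f) \<circ> ?\<theta>) j =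
          sq (J n) (a + b - j) (m + j) (sq (J n) j m f)"
        unfolding sqJ J_act_sq[OF sq_iota] js[OF j] comp_def ..
    qed
    finally show ?thesis .
  qed
  have ste: "steenrod_ids (J n) \<subseteq> Id"
    unfolding steenrod_ids_iff by (intro conjI allI ballI impI) (rule sq0 adem, assumption+)+
  have ins: "instability_ids (J n) \<subseteq> Id"
    unfolding instability_ids_iff
    using unstable_vanish[OF F_unstable iota_carr] by (simp add: J_simps(1,4) J_act_zer)
  show ?thesis
    unfolding unstable_module_def unstable_ids_def closed_gmod_def
    using vec sqa ste ins closed_J_vec sq_carr by simp
qed

lemma J_mor_mor:
  assumes M: "unstable_module M" and \<phi>: "\<phi> \<in> dual M n"
  shows "J_mor M n \<phi> \<in> mor M (J n)"
proof (rule morI)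
  fix m x assume x: "x \<in> carr M m"
  show "J_mor M n \<phi> m x \<in> carr (J n) m"
    using x F_mor_carr[OF M x] mor_add[OF F_mor(1)[OF M x]]
    by (auto intro!: dualI simp: J_simps J_mor_def dualD[OF \<phi>] unstableD[OF F_unstable])
next
  fix m x y assume "x \<in> carr M m" "y \<in> carr M m"
  then show "J_mor M n \<phi> m (add M m x y) = add (J n) m (J_mor M n \<phi> m x) (J_mor M n \<phi> m y)"
    using F_mor_carr[OF M]
    by (auto intro!: restrict_ext simp: J_simps J_mor_def dualD[OF \<phi>] unstableD[OF M] F_mor_add[OF M])
next
  fix i m x assume "x \<in> carr M m"
  then show "J_mor M n \<phi> (m + i) (sq M i m x) = sq (J n) i m (J_mor M n \<phi> m x)"
    using F_mor_carr[OF F_unstable unstableD(3)[OF F_unstable iota_carr]]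
    by (auto intro!: restrict_ext simp: J_simps J_act_def J_mor_def unstableD[OF M] F_mor_sq[OF M])
qed (simp add: J_mor_def)

lemma J_mor_iota:
  "unstable_module M \<Longrightarrow> x \<in> carr M n \<Longrightarrow> J_mor M n \<phi> n x (iota n) = \<phi> x"
  by (simp add: J_mor_def iota_carr F_mor(2))

lemma F_mor_J:
  assumes f: "f \<in> carr (J n) m" and z: "z \<in> carr (F m) k"
  shows "F_mor (J n) m f k z = J_act n m k z f"
proof -
  have f': "f \<in> dual (F m) n" using f by (simp add: J_simps)
  have "(\<lambda>k. \<lambda>z\<in>carr (F m) k. J_act n m k z f) = F_mor (J n) m f"
  proof (rule F_mor_unique[OF J_unstable f])
    show "(\<lambda>k. \<lambda>z\<in>carr (F m) k. J_act n m k z f) \<in> mor (F m) (J n)"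
      by (rule morI) (simp_all add: unstableD[OF F_unstable] J_act_add[OF _ _ f'] J_act_sq
          J_act_dual[OF _ f'] J_simps(1))
  qed (simp add: iota_carr J_act_iota[OF f'])
  from fun_cong[OF fun_cong[OF this, of k], of z] show ?thesis using z by simp
qed

lemma J_represents:
  assumes M: "unstable_module M"
  shows "bij_betw (J_mor M n) (dual M n) (mor M (J n))"
proof (rule bij_betw_byWitness[where f' = "\<lambda>f. \<lambda>x\<in>carr M n. f n x (iota n)"])
  show "\<forall>\<phi>\<in>dual M n. (\<lambda>x\<in>carr M n. J_mor M n \<phi> n x (iota n)) = \<phi>"
  proof
    fix \<phi> assume \<phi>: "\<phi> \<in> dual M n"
    show "(\<lambda>x\<in>carr M n. J_mor M n \<phi> n x (iota n)) = \<phi>"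
      using J_mor_iota[OF M] dualD(1)[OF \<phi>] by (auto simp: restrict_def)
  qed
  show "J_mor M n ` dual M n \<subseteq> mor M (J n)"
    using J_mor_mor[OF M] by blast
  have dual: "(\<lambda>x\<in>carr M n. f n x (iota n)) \<in> dual M n" if f: "f \<in> mor M (J n)" for f
    by (rule dualI) (simp_all add: unstableD[OF M] mor_add[OF f] J_simps iota_carr)
  then show "(\<lambda>f. \<lambda>x\<in>carr M n. f n x (iota n)) ` mor M (J n) \<subseteq> dual M n"
    by blast
  show "\<forall>f\<in>mor M (J n). J_mor M n (\<lambda>x\<in>carr M n. f n x (iota n)) = f"
  proof
    fix f assume f: "f \<in> mor M (J n)"
    show "J_mor M n (\<lambda>x\<in>carr M n. f n x (iota n)) = f"
    proof (rule mor_eqI[OF J_mor_mor[OF M dual[OF f]] f])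
      fix m x assume x: "x \<in> carr M m"
      note c = mor_carr[OF J_mor_mor[OF M dual[OF f]] x] mor_carr[OF f x]
      show "J_mor M n (\<lambda>x\<in>carr M n. f n x (iota n)) m x = f m x"
      proof (rule dual_eqI[OF c[unfolded J_simps]])
        fix z assume z: "z \<in> carr (F m) n"
        have "f n (F_mor M m x n z) (iota n) = f m x z"
          using F_mor_comp[OF M J_unstable f x z] F_mor_J[OF c(2) z] F_mor(2)[OF F_unstable z]
          by (simp add: J_act_def iota_carr)
        then show "J_mor M n (\<lambda>x\<in>carr M n. f n x (iota n)) m x z = f m x z"
          using x z F_mor_carr[OF M x z] by (simp add: J_mor_def)
      qed
    qed
  qed
qed

subsection \<open>The free \<open>\<star>\<close>-unstable \<open>T\<^sub>q Lev\<close>-algebra\<close>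

lemma quot_alg_simps [simp]:
  "carr (quot_alg W E) = carr (quot_mod W E)" "zer (quot_alg W E) = zer (quot_mod W E)"
  "add (quot_alg W E) = add (quot_mod W E)" "sq (quot_alg W E) = sq (quot_mod W E)"
  "star (quot_alg W E) m n X Y = (\<Union>s\<in>X. \<Union>t\<in>Y. congr W E `` {Star s t})"
  by (simp_all add: quot_alg_def gmod.defs)

lemma gmod_cong:
  assumes "carr A = carr B" "zer A = zer B" "add A = add B" "sq A = sq B"
  shows "unstable_ids A = unstable_ids B" "closed_gmod A = closed_gmod B" "gsum A = gsum B"
proof -
  show g: "gsum A = gsum B" by (intro ext) (simp add: gsum_def assms)
  show "unstable_ids A = unstable_ids B" "closed_gmod A = closed_gmod B"
    by (simp_all add: unstable_ids_def vec_ids_def sq_additive_ids_def steenrod_ids_def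
        instability_ids_def closed_gmod_def assms g)
qed

lemma star_unstableD:
  assumes "star_unstable_algebra q A"
  shows "unstable_module A"
    and "x \<in> carr A m \<Longrightarrow> y \<in> carr A n \<Longrightarrow> star A m n x y \<in> carr A (m + n)"
  using assms by (auto simp: star_unstable_algebra_def closed_salg_def star_unstable_ids_def
      unstable_module_def)

lemma lev_memI:
  "x \<in> carr A m \<Longrightarrow> x' \<in> carr A m \<Longrightarrow> y \<in> carr A n \<Longrightarrow>
    (star A m n (add A m x x') y, add A (m + n) (star A m n x y) (star A m n x' y)) \<in> lev_ids A"
  "x \<in> carr A m \<Longrightarrow> y \<in> carr A n \<Longrightarrow> y' \<in> carr A n \<Longrightarrow>
    (star A m n x (add A n y y'), add A (m + n) (star A m n x y) (star A m n x y')) \<in> lev_ids A"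
  "x \<in> carr A m \<Longrightarrow> y \<in> carr A n \<Longrightarrow> (star A m n x y, star A n m y x) \<in> lev_ids A"
  "a \<in> carr A k \<Longrightarrow> b \<in> carr A l \<Longrightarrow> c \<in> carr A m \<Longrightarrow> d \<in> carr A n \<Longrightarrow>
    (star A (k + l) (m + n) (star A k l a b) (star A m n c d),
      star A (k + m) (l + n) (star A k m a c) (star A l n b d)) \<in> lev_ids A"
  subgoal unfolding lev_ids_def Un_iff mem_Collect_eq
    by (rule disjI1, rule disjI1, rule disjI1, intro exI conjI) (rule HOL.refl | assumption)+
  subgoal unfolding lev_ids_def Un_iff mem_Collect_eq
    by (rule disjI1, rule disjI1, rule disjI2, intro exI conjI) (rule HOL.refl | assumption)+
  subgoal unfolding lev_ids_def Un_iff mem_Collect_eq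
    by (rule disjI1, rule disjI2, intro exI conjI) (rule HOL.refl | assumption)+
  subgoal unfolding lev_ids_def Un_iff mem_Collect_eq
    by (rule disjI2, intro exI conjI) (rule HOL.refl | assumption)+
  done

lemma lev_memE:
  assumes "(s, t) \<in> lev_ids A"
  obtains m n x x' y where "x \<in> carr A m" "x' \<in> carr A m" "y \<in> carr A n"
      "s = star A m n (add A m x x') y" "t = add A (m + n) (star A m n x y) (star A m n x' y)" |
    m n x y y' where "x \<in> carr A m" "y \<in> carr A n" "y' \<in> carr A n"
      "s = star A m n x (add A n y y')" "t = add A (m + n) (star A m n x y) (star A m n x y')" |
    m n x y where "x \<in> carr A m" "y \<in> carr A n" "s = star A m n x y" "t = star A n m y x" |
    k l m n a b c d where "a \<in> carr A k" "b \<in> carr A l" "c \<in> carr A m" "d \<in> carr A n"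
      "s = star A (k + l) (m + n) (star A k l a b) (star A m n c d)"
      "t = star A (k + m) (l + n) (star A k m a c) (star A l n b d)"
proof -
  from assms show thesis
    unfolding lev_ids_def
  proof (elim UnE CollectE exE conjE Pair_inject)
    fix m n x x' y
    assume "x \<in> carr A m" "x' \<in> carr A m" "y \<in> carr A n"
      "s = star A m n (add A m x x') y" "t = add A (m + n) (star A m n x y) (star A m n x' y)"
    then show thesis by (rule that(1))
  next
    fix m n x y y'
    assume "x \<in> carr A m" "y \<in> carr A n" "y' \<in> carr A n"
      "s = star A m n x (add A n y y')" "t = add A (m + n) (star A m n x y) (star A m n x y')"
    then show thesis by (rule that(2))
  next
    fix m n x y
    assume "x \<in> carr A m" "y \<in> carr A n" "s = star A m n x y" "t = star A n m y x"
    then show thesis by (rule that(3))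
  next
    fix k l m n a b c d
    assume "a \<in> carr A k" "b \<in> carr A l" "c \<in> carr A m" "d \<in> carr A n"
      "s = star A (k + l) (m + n) (star A k l a b) (star A m n c d)"
      "t = star A (k + m) (l + n) (star A k m a c) (star A l n b d)"
    then show thesis by (rule that(4))
  qed
qed

locale alg_quotient = term_quotient W E
  for W :: "'g trm set" and E :: "('g trm \<times> 'g trm) set" +
  assumes Star_W [simp]: "s \<in> W \<Longrightarrow> t \<in> W \<Longrightarrow> Star s t \<in> W"
begin

abbreviation QA :: "'g trm set salg" where
  "QA \<equiv> quot_alg W E"

lemma star_Q [simp]:
  assumes "s \<in> W" "t \<in> W"
  shows "star QA m n (cl s) (cl t) = cl (Star s t)"
proof -
  have *: "cl (Star s' t') = cl (Star s t)" if "s' \<in> cl s" "t' \<in> cl t" for s' t'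
    using cl_eqI[OF congr.Star[of s s' W E t t']] that assms by simp
  have ne: "s \<in> cl s" "t \<in> cl t" using assms by (auto intro: congr.refl)
  have "star QA m n (cl s) (cl t) = (\<Union>s'\<in>cl s. \<Union>t'\<in>cl t. cl (Star s' t'))"
    by simp
  also have "\<dots> = (\<Union>s'\<in>cl s. \<Union>t'\<in>cl t. cl (Star s t))"
    by (intro SUP_cong HOL.refl *)
  also have "\<dots> = cl (Star s t)"
    using ne by blast
  finally show ?thesis .
qed

declare quot_alg_simps(5) [simp del]

lemma star_closed:
  assumes "X \<in> carr Q m" "Y \<in> carr Q n" shows "star QA m n X Y \<in> carr Q (m + n)"
proof -
  from assms obtain s t where "s \<in> W" "tdeg s = m" "X = cl s" "t \<in> W" "tdeg t = n" "Y = cl t"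
    by (meson cl_E)
  then show ?thesis by simp
qed

lemma lev_Q:
  assumes *: "lev_ids (term_alg W) \<subseteq> E" shows "lev_ids QA \<subseteq> Id"
proof -
  have l: "star QA m n (add QA m X X') Y = add QA (m + n) (star QA m n X Y) (star QA m n X' Y)"
    if X: "X \<in> carr QA m" "X' \<in> carr QA m" "Y \<in> carr QA n" for m n X X' Y
  proof -
    from X obtain s s' t where st: "s \<in> W" "tdeg s = m" "X = cl s" "s' \<in> W" "tdeg s' = m" "X' = cl s'"
      "t \<in> W" "tdeg t = n" "Y = cl t"
      unfolding quot_alg_simps by (meson cl_E)
    then have "(Star (Add s s') t, Add (Star s t) (Star s' t)) \<in> lev_ids (term_alg W)"
      using lev_memI(1)[of s "term_alg W" m s' t n] by simp
    from base_cl[OF * this] st show ?thesis by simp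
  qed
  have r: "star QA m n X (add QA n Y Y') = add QA (m + n) (star QA m n X Y) (star QA m n X Y')"
    if X: "X \<in> carr QA m" "Y \<in> carr QA n" "Y' \<in> carr QA n" for m n X Y Y'
  proof -
    from X obtain s t t' where st: "s \<in> W" "tdeg s = m" "X = cl s" "t \<in> W" "tdeg t = n" "Y = cl t"
      "t' \<in> W" "tdeg t' = n" "Y' = cl t'"
      unfolding quot_alg_simps by (meson cl_E)
    then have "(Star s (Add t t'), Add (Star s t) (Star s t')) \<in> lev_ids (term_alg W)"
      using lev_memI(2)[of s "term_alg W" m t n t'] by simp
    from base_cl[OF * this] st show ?thesis by simp
  qed
  have c: "star QA m n X Y = star QA n m Y X" if X: "X \<in> carr QA m" "Y \<in> carr QA n" for m n X Y
  proof -
    from X obtain s t where st: "s \<in> W" "tdeg s = m" "X = cl s" "t \<in> W" "tdeg t = n" "Y = cl t"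
      unfolding quot_alg_simps by (meson cl_E)
    then have "(Star s t, Star t s) \<in> lev_ids (term_alg W)"
      using lev_memI(3)[of s "term_alg W" m t n] by simp
    from base_cl[OF * this] st show ?thesis by simp
  qed
  have i: "star QA (k + l) (m + n) (star QA k l A B) (star QA m n C D) =
       star QA (k + m) (l + n) (star QA k m A C) (star QA l n B D)"
    if X: "A \<in> carr QA k" "B \<in> carr QA l" "C \<in> carr QA m" "D \<in> carr QA n" for k l m n A B C D
  proof -
    from X obtain a b c d where st: "a \<in> W" "tdeg a = k" "A = cl a" "b \<in> W" "tdeg b = l" "B = cl b"
      "c \<in> W" "tdeg c = m" "C = cl c" "d \<in> W" "tdeg d = n" "D = cl d"
      unfolding quot_alg_simps by (meson cl_E)
    then have "(Star (Star a b) (Star c d), Star (Star a c) (Star b d)) \<in> lev_ids (term_alg W)"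
      using lev_memI(4)[of a "term_alg W" k b l c m d n] by simp
    from base_cl[OF * this] st show ?thesis by simp
  qed
  show ?thesis
    unfolding lev_ids_iff by (intro conjI allI ballI) (rule l r c i, assumption+)+
qed

lemma lift_stree:
  "\<forall>(n, X)\<in>leaves T. X \<in> carr Q n \<Longrightarrow>
   \<exists>T'. (\<forall>(n, x)\<in>leaves T'. x \<in> carr (term_alg W) n) \<and> sheight T' = sheight T \<and> sdeg T' = sdeg T \<and>
     seval (term_alg W) T' \<in> W \<and> tdeg (seval (term_alg W) T') = sdeg T \<and>
     seval QA T = cl (seval (term_alg W) T')"
proof (induction T)
  case (Leaf p)
  then obtain t where "t \<in> W" "tdeg t = fst p" "snd p = cl t"
    by (auto elim!: cl_E)
  then show ?case by (intro exI[of _ "Leaf (fst p, t)"]) simp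
next
  case (Node S T)
  then obtain S' T' where
    "\<forall>(n, x)\<in>leaves S'. x \<in> carr (term_alg W) n" "sheight S' = sheight S" "sdeg S' = sdeg S"
    "seval (term_alg W) S' \<in> W" "tdeg (seval (term_alg W) S') = sdeg S"
    "seval QA S = cl (seval (term_alg W) S')"
    "\<forall>(n, x)\<in>leaves T'. x \<in> carr (term_alg W) n" "sheight T' = sheight T" "sdeg T' = sdeg T"
    "seval (term_alg W) T' \<in> W" "tdeg (seval (term_alg W) T') = sdeg T"
    "seval QA T = cl (seval (term_alg W) T')"
    by (metis UnCI stree.set(2))
  then show ?case by (intro exI[of _ "Node S' T'"]) auto
qed

lemma truncation_Q:
  assumes *: "truncation_ids q (term_alg W) \<subseteq> E" shows "truncation_ids q QA \<subseteq> Id"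
  unfolding truncation_ids_iff
proof (intro allI impI)
  fix T assume "\<forall>(n, x)\<in>leaves T. x \<in> carr QA n" and h: "q < sheight T"
  then obtain T' where T': "\<forall>(n, x)\<in>leaves T'. x \<in> carr (term_alg W) n" "sheight T' = sheight T"
    "sdeg T' = sdeg T" "seval QA T = cl (seval (term_alg W) T')"
    using lift_stree by (metis quot_alg_simps(1))
  then have "(seval (term_alg W) T', Zero (sdeg T')) \<in> truncation_ids q (term_alg W)"
    unfolding truncation_ids_def term_alg_simps using h by auto
  from base_cl[OF * this] T' show "seval QA T = zer QA (sdeg T)" by simp
qed

lemma cartan_Q:
  assumes *: "cartan_ids (term_alg W) \<subseteq> E" shows "cartan_ids QA \<subseteq> Id"
proof -
  have "sq QA i (m + n) (star QA m n X Y) =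
       gsum QA (m + n + i)
         (map (\<lambda>k. star QA (m + k) (n + (i - k)) (sq QA k m X) (sq QA (i - k) n Y)) [0..<Suc i])"
    if X: "X \<in> carr QA m" "Y \<in> carr QA n" for i m n X Y
  proof -
    from X obtain s t where st: "s \<in> W" "tdeg s = m" "X = cl s" "t \<in> W" "tdeg t = n" "Y = cl t"
      unfolding quot_alg_simps by (meson cl_E)
    let ?r = "map (\<lambda>k. Star (Sq k s) (Sq (i - k) t)) [0..<Suc i]"
    have m: "(Sq i (Star s t), gsum (term_alg W) (m + n + i) ?r) \<in> cartan_ids (term_alg W)"
      using cartan_memI[of s "term_alg W" m t n i, unfolded term_alg_simps mem_Collect_eq] st
      by blast
    have "sq QA i (m + n) (star QA m n X Y) = cl (Sq i (Star s t))"
      using st by simp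
    also have "\<dots> = cl (gsum (term_alg W) (m + n + i) ?r)"
      by (rule base_cl[OF * m])
    also have "\<dots> = gsum Q (m + n + i) (map cl ?r)"
    proof (rule gsum_Q[symmetric], rule subsetI)
      fix u assume "u \<in> set ?r"
      then obtain k where "k \<le> i" and u: "u = Star (Sq k s) (Sq (i - k) t)"
        by (auto simp del: upt_Suc)
      then show "u \<in> {t \<in> W. tdeg t = m + n + i}" using st unfolding u by simp
    qed
    also have "map cl ?r =
        map (\<lambda>k. star QA (m + k) (n + (i - k)) (sq QA k m X) (sq QA (i - k) n Y)) [0..<Suc i]"
      unfolding st(3,6) quot_alg_simps(1-4)
      by (simp only: map_map comp_def sq_Q[OF st(1)] sq_Q[OF st(4)]
          star_Q[OF Sq_W[OF st(1)] Sq_W[OF st(4)]])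
    finally show ?thesis using gmod_cong(3)[of QA Q] by simp
  qed
  then show ?thesis unfolding cartan_ids_iff by blast
qed

lemma star_sq0_Q:
  assumes *: "star_sq0_ids (term_alg W) \<subseteq> E" shows "star_sq0_ids QA \<subseteq> Id"
proof -
  have "sq QA n n X = star QA n n X X" if X: "X \<in> carr QA n" for n X
  proof -
    from X obtain t where t: "t \<in> W" "tdeg t = n" "X = cl t"
      unfolding quot_alg_simps by (meson cl_E)
    then have "(Sq n t, Star t t) \<in> star_sq0_ids (term_alg W)"
      unfolding star_sq0_ids_def term_alg_simps by blast
    from base_cl[OF * this] t show ?thesis by simp
  qed
  then show ?thesis unfolding star_sq0_ids_iff by blast
qed

lemma star_unstable_Q:
  assumes "star_unstable_ids q (term_alg W) \<subseteq> E" shows "star_unstable_algebra q QA"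
proof -
  have "unstable_module Q" "lev_ids QA \<subseteq> Id" "truncation_ids q QA \<subseteq> Id" "cartan_ids QA \<subseteq> Id"
    "star_sq0_ids QA \<subseteq> Id"
    using assms unstable_Q lev_Q truncation_Q cartan_Q star_sq0_Q
    unfolding star_unstable_ids_def by simp_all
  then show ?thesis
    using gmod_cong[of QA Q] star_closed
    by (simp add: star_unstable_algebra_def star_unstable_ids_def closed_salg_def
        unstable_module_def)
qed

end

lemma seval_term:
  assumes S: "\<And>s t. s \<in> W \<Longrightarrow> t \<in> W \<Longrightarrow> Star s t \<in> W"
    and "\<forall>(n, x)\<in>leaves T. x \<in> carr (term_alg W) n"
  shows "seval (term_alg W) T \<in> W \<and> tdeg (seval (term_alg W) T) = sdeg T"
  using assms(2) by (induction T) (auto intro: S)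

lemma closed_star_ids:
  assumes W: "closed_gmod (term_alg W)" and S: "\<And>s t. s \<in> W \<Longrightarrow> t \<in> W \<Longrightarrow> Star s t \<in> W"
    and st: "(s, t) \<in> star_unstable_ids q (term_alg W)"
  shows "s \<in> W \<and> t \<in> W \<and> tdeg s = tdeg t"
proof -
  have [simp]: "Zero n \<in> W" "s \<in> W \<Longrightarrow> t \<in> W \<Longrightarrow> tdeg s = tdeg t \<Longrightarrow> Add s t \<in> W"
    "t \<in> W \<Longrightarrow> Sq i t \<in> W" for n s t i
    using W by (auto simp: closed_gmod_def)
  note S [simp]
  consider "(s, t) \<in> unstable_ids (term_alg W)" | "(s, t) \<in> lev_ids (term_alg W)" |
    "(s, t) \<in> truncation_ids q (term_alg W)" | "(s, t) \<in> cartan_ids (term_alg W)" |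
    "(s, t) \<in> star_sq0_ids (term_alg W)"
    using st unfolding star_unstable_ids_def by blast
  then show ?thesis
  proof cases
    case 1
    then show ?thesis by (rule closed_ids[OF W])
  next
    case 3
    then obtain T where "\<forall>(n, x)\<in>leaves T. x \<in> carr (term_alg W) n"
      "s = seval (term_alg W) T" "t = Zero (sdeg T)"
      unfolding truncation_ids_def by auto
    with seval_term[of W T] S show ?thesis by simp
  next
    case 4
    then obtain i u v where uv: "u \<in> W" "v \<in> W" "s = Sq i (Star u v)"
      "t = gsum (term_alg W) (tdeg u + tdeg v + i)
        (map (\<lambda>k. Star (Sq k u) (Sq (i - k) v)) [0..<Suc i])"
      unfolding cartan_ids_def term_alg_simps by blast
    have "t \<in> carr (term_alg W) (tdeg u + tdeg v + i)"
      unfolding uv(4)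
    proof (rule closed_gsum[OF W])
      fix w assume "w \<in> set (map (\<lambda>k. Star (Sq k u) (Sq (i - k) v)) [0..<Suc i])"
      then obtain k where "k \<le> i" and w: "w = Star (Sq k u) (Sq (i - k) v)"
        by (auto simp del: upt_Suc)
      then show "w \<in> carr (term_alg W) (tdeg u + tdeg v + i)" using uv(1,2) unfolding w by simp
    qed
    then show ?thesis using uv by simp
  qed (auto simp: lev_ids_def star_sq0_ids_def)
qed

lemma seval_teval:
  assumes "\<forall>(n, x)\<in>leaves T. x \<in> carr (term_alg W) n"
    and S: "\<And>s t. s \<in> W \<Longrightarrow> t \<in> W \<Longrightarrow> Star s t \<in> W"
  shows "teval A (star A) h (seval (term_alg W) T) =
    seval A (map_stree (\<lambda>(n, t). (n, teval A (star A) h t)) T)"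
    and "sdeg (map_stree (\<lambda>(n, t). (n, teval A (star A) h t)) T) = sdeg T"
    and "sheight (map_stree (\<lambda>(n, t). (n, teval A (star A) h t)) T) = sheight T"
proof -
  show d: "sdeg (map_stree (\<lambda>(n, t). (n, teval A (star A) h t)) T) = sdeg T" for T
    by (induction T) (auto split: prod.splits)
  show "sheight (map_stree (\<lambda>(n, t). (n, teval A (star A) h t)) T) = sheight T"
    by (induction T) auto
  show "teval A (star A) h (seval (term_alg W) T) =
    seval A (map_stree (\<lambda>(n, t). (n, teval A (star A) h t)) T)"
    using assms(1)
  proof (induction T)
    case (Node T1 T2)
    then show ?case using seval_term[of W T1, OF S] seval_term[of W T2, OF S] by (simp add: d)
  qed (auto split: prod.splits)
qed

lemma teval_star_ids:
  assumes A: "star_unstable_algebra q A"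
    and W: "\<And>t. t \<in> W \<Longrightarrow> teval A (star A) h t \<in> carr A (tdeg t)"
    and S: "\<And>s t. s \<in> W \<Longrightarrow> t \<in> W \<Longrightarrow> Star s t \<in> W"
    and st: "(s, t) \<in> star_unstable_ids q (term_alg W)"
  shows "teval A (star A) h s = teval A (star A) h t"
proof -
  let ?e = "teval A (star A) h"
  have ids: "lev_ids A \<subseteq> Id" "truncation_ids q A \<subseteq> Id" "cartan_ids A \<subseteq> Id" "star_sq0_ids A \<subseteq> Id"
    using A by (auto simp: star_unstable_algebra_def star_unstable_ids_def)
  note lev = ids(1)[unfolded lev_ids_iff, THEN conjunct1, rule_format]
    ids(1)[unfolded lev_ids_iff, THEN conjunct2, THEN conjunct1, rule_format]
    ids(1)[unfolded lev_ids_iff, THEN conjunct2, THEN conjunct2, THEN conjunct1, rule_format]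
    ids(1)[unfolded lev_ids_iff, THEN conjunct2, THEN conjunct2, THEN conjunct2, rule_format]
  consider "(s, t) \<in> unstable_ids (term_alg W)" | "(s, t) \<in> lev_ids (term_alg W)" |
    "(s, t) \<in> truncation_ids q (term_alg W)" | "(s, t) \<in> cartan_ids (term_alg W)" |
    "(s, t) \<in> star_sq0_ids (term_alg W)"
    using st unfolding star_unstable_ids_def by blast
  then show ?thesis
  proof cases
    case 1
    show ?thesis by (rule teval_unstable_ids[OF star_unstableD(1)[OF A] W 1])
  next
    case 2
    then show ?thesis
    proof (cases rule: lev_memE)
      case (1 m n x x' y)
      then show ?thesis
        using lev(1)[of "?e x" "tdeg x" "?e x'" "?e y" "tdeg y"] W[of x] W[of x'] W[of y] by simp
    next
      case (2 m n x y y')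
      then show ?thesis
        using lev(2)[of "?e x" "tdeg x" "?e y" "tdeg y" "?e y'"] W[of x] W[of y] W[of y'] by simp
    next
      case (3 m n x y)
      then show ?thesis using lev(3)[of "?e x" "tdeg x" "?e y" "tdeg y"] W[of x] W[of y] by simp
    next
      case (4 k l m n a b c d)
      then show ?thesis
        using lev(4)[of "?e a" "tdeg a" "?e b" "tdeg b" "?e c" "tdeg c" "?e d" "tdeg d"]
          W[of a] W[of b] W[of c] W[of d] by simp
    qed
  next
    case 3
    then obtain T where T: "\<forall>(n, x)\<in>leaves T. x \<in> carr (term_alg W) n" "q < sheight T"
      "s = seval (term_alg W) T" "t = Zero (sdeg T)"
      unfolding truncation_ids_def term_alg_simps(2) by blast
    let ?T = "map_stree (\<lambda>(n, t). (n, ?e t)) T"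
    have "\<forall>(n, x)\<in>leaves ?T. x \<in> carr A n"
      using T(1) W by (fastforce simp: stree.set_map)
    moreover have "sheight ?T = sheight T" "sdeg ?T = sdeg T"
      by (rule seval_teval(2,3)[OF T(1) S]; assumption)+
    ultimately have "seval A ?T = zer A (sdeg T)"
      using ids(2)[unfolded truncation_ids_iff] T(2) by metis
    moreover have "?e s = seval A ?T"
      unfolding T(3) by (rule seval_teval(1)[OF T(1) S])
    ultimately show ?thesis
      unfolding T(4) by simp
  next
    case 4
    then obtain i u v where uv: "u \<in> W" "v \<in> W" "s = Sq i (Star u v)"
      "t = gsum (term_alg W) (tdeg u + tdeg v + i)
        (map (\<lambda>k. Star (Sq k u) (Sq (i - k) v)) [0..<Suc i])"
      unfolding cartan_ids_def term_alg_simps by blast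
    have "?e t = gsum A (tdeg u + tdeg v + i)
        (map ?e (map (\<lambda>k. Star (Sq k u) (Sq (i - k) v)) [0..<Suc i]))"
      unfolding uv(4)
    proof (rule teval_gsum, rule ballI)
      fix w assume "w \<in> set (map (\<lambda>k. Star (Sq k u) (Sq (i - k) v)) [0..<Suc i])"
      then obtain k where "k \<le> i" and w: "w = Star (Sq k u) (Sq (i - k) v)"
        by (auto simp del: upt_Suc)
      then show "tdeg w = tdeg u + tdeg v + i" unfolding w by simp
    qed
    also have "map ?e (map (\<lambda>k. Star (Sq k u) (Sq (i - k) v)) [0..<Suc i]) =
        map (\<lambda>k. star A (tdeg u + k) (tdeg v + (i - k)) (sq A k (tdeg u) (?e u))
          (sq A (i - k) (tdeg v) (?e v))) [0..<Suc i]"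
      by (simp only: map_map comp_def teval.simps tdeg.simps)
    also have "gsum A (tdeg u + tdeg v + i) \<dots> =
        sq A i (tdeg u + tdeg v) (star A (tdeg u) (tdeg v) (?e u) (?e v))"
      by (rule Id_D[OF ids(3) cartan_memI[OF W[OF uv(1)] W[OF uv(2)]], symmetric])
    finally show ?thesis unfolding uv(3) by simp
  next
    case 5
    then obtain u where "u \<in> W" "s = Sq (tdeg u) u" "t = Star u u"
      unfolding star_sq0_ids_def term_alg_simps by blast
    then show ?thesis using ids(4)[unfolded star_sq0_ids_iff] W[of u] by simp
  qed
qed

lemma alg_terms_D:
  "Add s t \<in> alg_terms G \<Longrightarrow> s \<in> alg_terms G \<and> t \<in> alg_terms G \<and> tdeg s = tdeg t"
  "Sq i t \<in> alg_terms G \<Longrightarrow> t \<in> alg_terms G"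
  "Star s t \<in> alg_terms G \<Longrightarrow> s \<in> alg_terms G \<and> t \<in> alg_terms G"
  "Gen n g \<in> alg_terms G \<Longrightarrow> g \<in> G n"
  by (auto elim: alg_terms.cases)

lemma closed_alg_terms: "closed_gmod (term_alg (alg_terms G))"
  by (auto simp: closed_gmod_def intro: alg_terms.intros)

lemma free_quotient:
  assumes N: "unstable_module N"
  shows "alg_quotient (alg_terms (carr N)) (free_ids q N)"
proof unfold_locales
  fix s t assume "(s, t) \<in> free_ids q N"
  then consider "(s, t) \<in> star_unstable_ids q (term_alg (alg_terms (carr N)))" |
    n x y where "s = Gen n (add N n x y)" "t = Add (Gen n x) (Gen n y)" "x \<in> carr N n" "y \<in> carr N n" |
    i n x where "s = Gen (n + i) (sq N i n x)" "t = Sq i (Gen n x)" "x \<in> carr N n"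
    unfolding free_ids_def by blast
  then show "s \<in> alg_terms (carr N) \<and> t \<in> alg_terms (carr N) \<and> tdeg s = tdeg t"
  proof cases
    case 1
    show ?thesis
      by (rule closed_star_ids[OF closed_alg_terms alg_terms.intros(5) 1])
  qed (auto intro!: alg_terms.intros unstableD[OF N])
qed (use closed_alg_terms alg_terms_D in \<open>blast intro: alg_terms.intros\<close>)+

lemma free_alg_algebra:
  "unstable_module N \<Longrightarrow> star_unstable_algebra q (free_alg q N)"
  unfolding free_alg_def
  by (rule alg_quotient.star_unstable_Q[OF free_quotient]) (auto simp: free_ids_def)

lemma free_unit_mor:
  assumes N: "unstable_module N" shows "free_unit q N \<in> mor N (free_alg q N)"
proof -
  interpret alg_quotient "alg_terms (carr N)" "free_ids q N" by (rule free_quotient[OF N])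
  have G: "Gen n x \<in> alg_terms (carr N)" if "x \<in> carr N n" for n x
    using that by (rule alg_terms.intros)
  have add: "cl (Gen n (add N n x y)) = cl (Add (Gen n x) (Gen n y))"
    if "x \<in> carr N n" "y \<in> carr N n" for n x y
    by (rule cl_eqI, rule congr.base) (use that in \<open>auto simp: free_ids_def\<close>)
  have sq: "cl (Gen (n + i) (sq N i n x)) = cl (Sq i (Gen n x))" if "x \<in> carr N n" for i n x
    by (rule cl_eqI, rule congr.base) (use that in \<open>auto simp: free_ids_def\<close>)
  show ?thesis
  proof (rule morI)
    fix n x assume "x \<in> carr N n"
    then show "free_unit q N n x \<in> carr (free_alg q N) n"
      using cl_carr[OF G] by (simp add: free_unit_def free_alg_def)
  next
    fix n x y assume "x \<in> carr N n" "y \<in> carr N n"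
    then show "free_unit q N n (add N n x y) =
        add (free_alg q N) n (free_unit q N n x) (free_unit q N n y)"
      using add_Q[OF G G] by (simp add: free_unit_def free_alg_def unstableD[OF N] add)
  next
    fix i n x assume "x \<in> carr N n"
    then show "free_unit q N (n + i) (sq N i n x) = sq (free_alg q N) i n (free_unit q N n x)"
      using sq_Q[OF G] by (simp add: free_unit_def free_alg_def unstableD[OF N] sq)
  qed (simp add: free_unit_def)
qed

theorem free_alg_universal:
  assumes N: "unstable_module N" and A: "star_unstable_algebra q A" and f: "f \<in> mor N A"
  shows "\<exists>!g. g \<in> alg_mor (free_alg q N) A \<and>
    (\<forall>n. \<forall>x\<in>carr N n. g n (free_unit q N n x) = f n x)"
proof -
  let ?W = "alg_terms (carr N)"
  interpret aq: alg_quotient ?W "free_ids q N" by (rule free_quotient[OF N])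
  note AD = star_unstableD[OF A]
  have c: "teval A (star A) f t \<in> carr A (tdeg t)" if "t \<in> ?W" for t
    using that by (induction rule: alg_terms.induct) (use mor_carr[OF f] unstableD[OF AD(1)] AD(2) in auto)
  interpret te: term_eval ?W "free_ids q N" A "star A" f
  proof unfold_locales
    fix s t assume "(s, t) \<in> free_ids q N"
    then consider "(s, t) \<in> star_unstable_ids q (term_alg ?W)" |
      n x y where "s = Gen n (add N n x y)" "t = Add (Gen n x) (Gen n y)" "x \<in> carr N n" "y \<in> carr N n" |
      i n x where "s = Gen (n + i) (sq N i n x)" "t = Sq i (Gen n x)" "x \<in> carr N n"
      unfolding free_ids_def by blast
    then show "teval A (star A) f s = teval A (star A) f t"
    proof cases
      case 1
      show ?thesis by (rule teval_star_ids[OF A c alg_terms.intros(5) 1])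
    qed (simp_all add: mor_add[OF f] mor_sq[OF f])
  qed (rule c)
  have G: "Gen n x \<in> ?W" if "x \<in> carr N n" for n x
    using that by (rule alg_terms.intros)
  have mor_eq: "mor (free_alg q N) A = mor aq.Q A"
    unfolding mor_def free_alg_def by simp
  have 1: "te.qmap \<in> alg_mor (free_alg q N) A \<and>
      (\<forall>n. \<forall>x\<in>carr N n. te.qmap n (free_unit q N n x) = f n x)"
  proof
    have "te.qmap (m + n) (star aq.QA m n X Y) = star A m n (te.qmap m X) (te.qmap n Y)"
      if X: "X \<in> carr aq.Q m" "Y \<in> carr aq.Q n" for m n X Y
    proof -
      from X obtain s t where "s \<in> ?W" "tdeg s = m" "X = aq.cl s" "t \<in> ?W" "tdeg t = n" "Y = aq.cl t"
        by (meson aq.cl_E)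
      then show ?thesis by (simp add: te.qmap_cl)
    qed
    then show "te.qmap \<in> alg_mor (free_alg q N) A"
      unfolding alg_mor_def mor_eq using te.qmap_mor by (simp add: free_alg_def)
    show "\<forall>n. \<forall>x\<in>carr N n. te.qmap n (free_unit q N n x) = f n x"
      using te.qmap_cl[OF G] by (simp add: free_unit_def)
  qed
  have 2: "g (tdeg t) (aq.cl t) = te.ev t"
    if g: "g \<in> mor (free_alg q N) A" and gs: "\<And>m n x y. x \<in> carr aq.Q m \<Longrightarrow> y \<in> carr aq.Q n \<Longrightarrow>
      g (m + n) (star aq.QA m n x y) = star A m n (g m x) (g n y)"
      and gf: "\<And>n x. x \<in> carr N n \<Longrightarrow> g n (free_unit q N n x) = f n x" and t: "t \<in> ?W" for g t
    using t
  proof (induction t rule: trm.induct)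
    case (Gen m x)
    then show ?case using gf[of x m] alg_terms_D(4)[OF Gen.prems] by (simp add: free_unit_def)
  next
    case (Zero m)
    then show ?case
      using mor_zer[OF g star_unstableD(1)[OF free_alg_algebra[OF N]] AD(1), of m]
      by (simp add: free_alg_def)
  next
    case (Add s t)
    note st = alg_terms_D(1)[OF Add.prems]
    then show ?case
      using mor_add[OF g, of "aq.cl s" "tdeg s" "aq.cl t"] Add.IH by (simp add: free_alg_def)
  next
    case (Sq i t)
    note t = alg_terms_D(2)[OF Sq.prems]
    then show ?case using mor_sq[OF g, of "aq.cl t" "tdeg t" i] Sq.IH by (simp add: free_alg_def)
  next
    case (Star s t)
    note st = alg_terms_D(3)[OF Star.prems]
    then show ?case using gs[of "aq.cl s" "tdeg s" "aq.cl t" "tdeg t"] Star.IH by simp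
  qed
  show ?thesis
  proof (rule ex1I, rule 1)
    fix g assume g: "g \<in> alg_mor (free_alg q N) A \<and>
      (\<forall>n. \<forall>x\<in>carr N n. g n (free_unit q N n x) = f n x)"
    then have gm: "g \<in> mor aq.Q A" and gs: "\<And>m n x y. x \<in> carr aq.Q m \<Longrightarrow> y \<in> carr aq.Q n \<Longrightarrow>
      g (m + n) (star aq.QA m n x y) = star A m n (g m x) (g n y)"
      unfolding alg_mor_def mor_eq by (simp_all add: free_alg_def)
    show "g = te.qmap"
    proof (rule mor_eqI[OF gm te.qmap_mor])
      fix m X assume "X \<in> carr aq.Q m"
      then obtain t where "t \<in> ?W" "tdeg t = m" "X = aq.cl t"
        by (meson aq.cl_E)
      then show "g m X = te.qmap m X"
        using 2[of g t] gm gs g te.qmap_cl[of t m] mor_eq by simp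
    qed
  qed
qed

end

theory Submission
  imports Defs "HOL-Library.Poly_Mapping" "HOL-Computational_Algebra.Polynomial_FPS"
    "HOL-Algebra.FiniteProduct"
begin

text \<open>
  By Miller's theorem the Brown--Gitler modules together form the polynomial ring on classes
  \<open>x\<^sub>i\<close> of degree 1 and weight \<open>2\<^sup>i\<close> with \<open>Sq\<^sup>1 x\<^sub>i = x\<^bsub>i-1\<^esub>\<^sup>2\<close>, where \<open>J(n)\<close> is the part of weight \<open>n\<close>, the external
  product is multiplication and \<open>\<cdot>Sq\<^sup>n\<close> is the shift \<open>x\<^sub>i \<mapsto> x\<^bsub>i-1\<^esub>\<close>, \<open>x\<^sub>0 \<mapsto> 0\<close>. The identification is
  proved by induction on \<open>n\<close>, comparing the Mahowald sequence \<open>0 \<rightarrow> \<Sigma>J(n-1) \<rightarrow> J(n) \<rightarrow> J(n/2)\<close> with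
  multiplication by \<open>x\<^sub>0\<close> followed by the shift.

  The internal product of \<open>J(2\<^sup>q)\<close> thus sends a pair of monomials to the shift of their product. In a
  \<open>\<star>\<close>-unstable algebra generated by \<open>F(1)\<close> every element is a sum of products of the generator
  \<open>\<iota>\<^sub>1\<close> along trees, because \<open>Sq\<^sub>0\<close> is the \<open>\<star>\<close>-square. By the level relation such a product depends only on
  the multiset of depths of the leaves; a leaf of depth \<open>d\<close> corresponds to the factor \<open>x\<^bsub>q-d\<^esub>\<close>, and Kraft's
  equality \<open>\<Sum> 2\<^bsup>-d\<^esup> = 1\<close> says that the monomial has weight \<open>2\<^sup>q\<close>.
\<close>

section \<open>The polynomial ring on generators of degree 1 and weight a power of 2\<close>

text \<open>The input on the size of F(m) is that it vanishes below degree m, is spanned by the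
  generator in degree m, and that F(0) lives in degree 0. This suffices because the comparison map
  \<open>kappa\<close> runs from polynomials to J(n), so that elements can be lifted along the shift
  by raising all indices. The kernel of the shift is the truncation seen on monomials: x_0 stands
  for a leaf of depth q, and one further product would put that leaf at depth q + 1. The hard point
  is that the multiset of depths determines the product. The level relation only interchanges
  grandchildren of one vertex, while two trees may split the same multiset at the root in unrelated
  ways. Two such splittings into halves of equal weight always share half of the weight on each
  side, possibly after exchanging the sides of one of them; the rest is then a splitting problem for
  a smaller multiset. Freeness comes from maps in both directions: monomials define a map
  \<open>sigma\<close> from the polynomials to the free algebra, the universal property gives a left
  inverse, and generation by F(1) gives surjectivity.\<close>

type_synonym poly2 = "nat multiset \<Rightarrow>\<^sub>0 bit"

abbreviation keys :: "poly2 \<Rightarrow> nat multiset set" where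
  "keys \<equiv> Poly_Mapping.keys"

abbreviation lookup :: "poly2 \<Rightarrow> nat multiset \<Rightarrow> bit" where
  "lookup \<equiv> Poly_Mapping.lookup"

abbreviation mon :: "nat multiset \<Rightarrow> poly2" where
  "mon M \<equiv> Poly_Mapping.single M 1"

definition var :: "nat \<Rightarrow> poly2" where
  "var i = mon {#i#}"

lemma bit_double: "(x::bit) + x = 0"
  by (cases x) simp_all

lemma poly2_double: "(p::poly2) + p = 0"
  by (rule poly_mapping_eqI) (simp only: lookup_add bit_double lookup_zero)

lemma keys_add_poly2: "keys (p + q :: poly2) = (keys p - keys q) \<union> (keys q - keys p)"
proof -
  have "M \<in> keys (p + q) \<longleftrightarrow> M \<in> (keys p - keys q) \<union> (keys q - keys p)" for M
    by (cases "lookup p M"; cases "lookup q M") (simp_all add: in_keys_iff lookup_add)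
  then show ?thesis by blast
qed

lemma poly2_eqI: "keys p = keys q \<Longrightarrow> p = (q::poly2)"
proof (rule poly_mapping_eqI)
  fix M assume "keys p = keys q"
  then have "M \<in> keys p \<longleftrightarrow> M \<in> keys q" by simp
  then show "lookup p M = lookup q M"
    by (cases "lookup p M"; cases "lookup q M") (simp_all add: in_keys_iff)
qed

lemma poly2_induct [case_names zero add]:
  assumes "Q 0" and "\<And>M p. M \<notin> keys p \<Longrightarrow> Q p \<Longrightarrow> Q (mon M + p)"
  shows "Q (p::poly2)"
proof (induction "card (keys p)" arbitrary: p)
  case 0
  then have "p = 0" by (intro poly2_eqI) simp
  with assms(1) show ?case by simp
next
  case (Suc n)
  then obtain M where M: "M \<in> keys p" by fastforce
  let ?p = "mon M + p"
  have k: "keys ?p = keys p - {M}" using M by (auto simp: keys_add_poly2)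
  have "Q ?p" using Suc.hyps M by (intro Suc.hyps(1)) (simp add: k)
  then have "Q (mon M + ?p)" by (rule assms(2)[of M ?p, rotated]) (simp add: k)
  moreover have "mon M + ?p = p" by (simp add: poly2_double flip: add.assoc)
  ultimately show ?case by simp
qed

subsection \<open>Ring homomorphisms\<close>

text \<open>A predicate on bare functions, so that composites of substitution,
  \<open>map_poly\<close>, \<open>pcompose\<close> and evaluation can be compared on the variables
  by \<open>hom_eqI\<close>.\<close>

definition is_hom :: "('a::comm_ring_1 \<Rightarrow> 'b::comm_ring_1) \<Rightarrow> bool" where
  "is_hom h \<longleftrightarrow> h 1 = 1 \<and> (\<forall>x y. h (x + y) = h x + h y) \<and> (\<forall>x y. h (x * y) = h x * h y)"

lemma is_homI:
  assumes "h 1 = 1" "\<And>x y. h (x + y) = h x + h y" "\<And>x y. h (x * y) = h x * h y"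
  shows "is_hom h"
  using assms by (simp add: is_hom_def)

lemma is_homD:
  assumes "is_hom h"
  shows "h 1 = 1" "h (x + y) = h x + h y" "h (x * y) = h x * h y" "h 0 = 0" "h (x ^ n) = h x ^ n"
    "h (sum f A) = (\<Sum>a\<in>A. h (f a))"
proof -
  have 1: "h 1 = 1" and p: "\<And>x y. h (x + y) = h x + h y" and t: "\<And>x y. h (x * y) = h x * h y"
    using assms by (simp_all add: is_hom_def)
  then show "h 1 = 1" "h (x + y) = h x + h y" "h (x * y) = h x * h y" by blast+
  show z: "h 0 = 0" using p[of 0 0] by simp
  show "h (x ^ n) = h x ^ n" by (induction n) (simp_all add: 1 t)
  show "h (sum f A) = (\<Sum>a\<in>A. h (f a))" by (induction A rule: infinite_finite_induct) (simp_all add: z p)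
qed

lemma is_hom_comp: "is_hom g \<Longrightarrow> is_hom h \<Longrightarrow> is_hom (\<lambda>x. h (g x))"
  by (simp add: is_hom_def)

lemma mon_add: "mon (M + N) = mon M * mon N"
  by (simp add: mult_single)

lemma mon_eq_prod: "mon M = (\<Prod>i\<in>#M. var i)"
proof (induction M)
  case (add i M)
  have "mon (add_mset i M) = mon {#i#} * mon M" by (simp add: mult_single)
  then show ?case by (simp add: add var_def)
qed simp

lemma is_hom_mon: "is_hom h \<Longrightarrow> h (mon M) = (\<Prod>i\<in>#M. h (var i))"
  unfolding mon_eq_prod by (induction M) (simp_all add: is_homD)

lemma hom_eqI:
  assumes "is_hom g" "is_hom h" "\<And>i. g (var i) = h (var i)"
  shows "g p = h p"
  by (induction p rule: poly2_induct)
    (simp_all add: is_homD(2,4)[OF assms(1)] is_homD(2,4)[OF assms(2)] is_hom_mon[OF assms(1)]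
      is_hom_mon[OF assms(2)] assms(3))

definition subst :: "(nat \<Rightarrow> 'r::comm_ring_1) \<Rightarrow> poly2 \<Rightarrow> 'r" where
  "subst f p = (\<Sum>M\<in>keys p. \<Prod>i\<in>#M. f i)"

lemma subst_mon: "subst f (mon M) = (\<Prod>i\<in>#M. f i)"
  by (simp add: subst_def)

lemma subst_var [simp]: "subst f (var i) = f i"
  by (simp add: var_def subst_mon)

text \<open>A monomial common to \<open>p\<close> and \<open>q\<close> disappears from
  \<open>p + q\<close> but is counted twice in the sum of the images; this agrees because the target
  has characteristic 2.\<close>

lemma subst_hom:
  assumes "(1::'r::comm_ring_1) + 1 = 0"
  shows "is_hom (subst (f :: nat \<Rightarrow> 'r))"
proof (rule is_homI)
  have two: "x + x = 0" for x :: 'r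
    using arg_cong[OF assms, of "\<lambda>y. x * y"]
    by (simp only: distrib_left mult_1_right mult_zero_right)
  show plus: "subst f (p + q) = subst f p + subst f q" for p q
  proof -
    let ?g = "\<lambda>M. \<Prod>i\<in>#M. f i"
    let ?I = "keys p \<inter> keys q"
    have "subst f p = sum ?g (keys p - keys q) + sum ?g ?I"
      unfolding subst_def by (subst sum.union_disjoint[symmetric]) (auto intro!: sum.cong)
    moreover have "subst f q = sum ?g (keys q - keys p) + sum ?g ?I"
      unfolding subst_def by (subst sum.union_disjoint[symmetric]) (auto intro!: sum.cong)
    moreover have "subst f (p + q) = sum ?g (keys p - keys q) + sum ?g (keys q - keys p)"
      unfolding subst_def keys_add_poly2 by (rule sum.union_disjoint) auto
    ultimately show ?thesis
      by (simp add: algebra_simps two)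
  qed
  show "subst f 1 = 1"
    using subst_mon[of f "{#}"] by simp
  have mult_mon: "subst f (mon M * q) = subst f (mon M) * subst f q" for M q
  proof (induction q rule: poly2_induct)
    case (add N q)
    have "subst f (mon M * mon N) = subst f (mon M) * subst f (mon N)"
      by (simp only: mult_single subst_mon) (simp add: subst_mon)
    with add.IH show ?case by (simp add: distrib_left plus)
  qed (simp add: subst_def)
  show "subst f (p * q) = subst f p * subst f q" for p q
    by (induction p rule: poly2_induct) (simp add: subst_def, simp add: distrib_right plus mult_mon)
qed

lemma poly2_char: "(1::poly2) + 1 = 0"
  by (rule poly2_double)

lemma poly_poly2_double: "(f::poly2 poly) + f = 0"
  by (rule poly_eqI) (simp only: coeff_add poly2_double coeff_0)

lemma poly2_add_left: "(p::poly2) + (p + q) = q"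
  by (simp add: poly2_double flip: add.assoc)

lemma square_add:
  assumes "\<And>x::'r::comm_ring_1. x + x = 0"
  shows "(x + y :: 'r)\<^sup>2 = x\<^sup>2 + y\<^sup>2"
proof -
  have "(x + y)\<^sup>2 = x\<^sup>2 + y\<^sup>2 + (x * y + x * y)" by (simp add: power2_eq_square algebra_simps)
  then show ?thesis by (simp only: assms add_0_right)
qed

lemma map_poly_hom: "is_hom h \<Longrightarrow> is_hom (map_poly h)"
proof (rule is_homI)
  assume h: "is_hom h"
  show "map_poly h 1 = 1" using is_homD(1)[OF h] by simp
  show "map_poly h (p + q) = map_poly h p + map_poly h q" for p q
    by (rule poly_eqI) (simp add: coeff_map_poly is_homD[OF h])
  show "map_poly h (p * q) = map_poly h p * map_poly h q" for p q
    by (rule poly_eqI) (simp add: coeff_map_poly coeff_mult is_homD[OF h])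
qed

lemma poly_hom: "is_hom (\<lambda>f. poly f x)"
  by (rule is_homI) simp_all

lemma pcompose_hom: "is_hom (\<lambda>f. pcompose f u)"
  by (rule is_homI) (simp_all add: pcompose_1 pcompose_add pcompose_mult)

subsection \<open>Steenrod operations\<close>

definition low :: "nat \<Rightarrow> poly2" where
  "low i = (case i of 0 \<Rightarrow> 0 | Suc j \<Rightarrow> var j)"

definition shift :: "poly2 \<Rightarrow> poly2" where
  "shift = subst low"

text \<open>The total Steenrod square, with Sq^k as the coefficient of t^k. The Cartan formula is
  its multiplicativity, so only the values x_i + t x_{i-1}^2 on the variables have to be
  prescribed.\<close>

definition Sqt :: "poly2 \<Rightarrow> poly2 poly" where
  "Sqt = subst (\<lambda>i. [:var i, (low i)\<^sup>2:])"

lemma shift_hom: "is_hom shift"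
  unfolding shift_def by (rule subst_hom[OF poly2_char])

lemma Sqt_hom: "is_hom Sqt"
  unfolding Sqt_def by (rule subst_hom[OF poly_poly2_double])

lemmas shift_simps = is_homD[OF shift_hom]
lemmas Sqt_simps = is_homD[OF Sqt_hom]

lemma shift_var [simp]: "shift (var i) = low i" by (simp add: shift_def)
lemma Sqt_var [simp]: "Sqt (var i) = [:var i, (low i)\<^sup>2:]" by (simp add: Sqt_def)

lemma low_simps [simp]: "low 0 = 0" "low (Suc j) = var j"
  by (simp_all add: low_def)

text \<open>Both sides are ring homomorphisms, so the variables suffice. This makes the shift
  commute with the Steenrod operations, as needed for \<open>shift_mor\<close> and for the Cartan
  formula of the shifted product.\<close>

lemma Sqt_shift: "Sqt (shift p) = map_poly shift (Sqt p)"
proof (rule hom_eqI[OF is_hom_comp[OF shift_hom Sqt_hom] is_hom_comp[OF Sqt_hom map_poly_hom[OF shift_hom]]])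
  fix i
  have "shift (low i) = (case i of 0 \<Rightarrow> 0 | Suc j \<Rightarrow> low j)" by (cases i) (simp_all add: shift_simps)
  then show "Sqt (shift (var i)) = map_poly shift (Sqt (var i))"
    by (cases i) (simp_all add: shift_simps Sqt_simps map_poly_pCons)
qed

definition Sqp :: "nat \<Rightarrow> poly2 \<Rightarrow> poly2" where
  "Sqp k p = coeff (Sqt p) k"

lemma Sqp_add: "Sqp k (p + q) = Sqp k p + Sqp k q"
  and Sqp_zero [simp]: "Sqp k 0 = 0"
  by (simp_all add: Sqp_def Sqt_simps)

lemma Sqp_mult: "Sqp k (p * q) = (\<Sum>i\<le>k. Sqp i p * Sqp (k - i) q)"
  by (simp add: Sqp_def Sqt_simps coeff_mult)

lemma Sqp_shift: "Sqp k (shift p) = shift (Sqp k p)"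
  by (simp add: Sqp_def Sqt_shift coeff_map_poly shift_simps)

lemma Sqp_0: "Sqp 0 p = p"
proof -
  have "poly (Sqt p) 0 = p"
    by (rule hom_eqI[OF is_hom_comp[OF Sqt_hom poly_hom]]) (simp_all add: is_hom_def)
  then show ?thesis by (simp add: Sqp_def poly_0_coeff_0)
qed

lemma Sqp_var_mult:
  "Sqp k (var i * p) = var i * Sqp k p + (case k of 0 \<Rightarrow> 0 | Suc l \<Rightarrow> (low i)\<^sup>2 * Sqp l p)"
  by (simp add: Sqp_def Sqt_simps coeff_pCons split: nat.split)

lemma Sqp_var0_mult: "Sqp k (var 0 * p) = var 0 * Sqp k p"
  by (simp add: Sqp_var_mult split: nat.split)

subsection \<open>The Adem relations\<close>

text \<open>
  Following Bullett and Macdonald: the total operation \<open>\<Sum> u\<^sup>j v\<^sup>i Sq\<^sup>i Sq\<^sup>j\<close> is a ring homomorphism whose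
  values on the generators depend only on \<open>u + v\<close> and \<open>u v\<^sup>2\<close>. The pairs \<open>(u, v) = (1, s + s\<^sup>2)\<close> and
  \<open>(u, v) = (s\<^sup>2, 1 + s)\<close> agree in both, and the Adem relations are the residues of the resulting
  identity.
\<close>

definition Sq2 :: "poly2 poly \<Rightarrow> poly2 poly \<Rightarrow> poly2 \<Rightarrow> poly2 poly" where
  "Sq2 v u p = poly (map_poly (\<lambda>c. pcompose (Sqt c) v) (Sqt p)) u"

lemma Sq2_hom: "is_hom (Sq2 v u)"
  unfolding Sq2_def
  by (rule is_hom_comp[OF is_hom_comp[OF Sqt_hom map_poly_hom] poly_hom])
    (rule is_hom_comp[OF Sqt_hom pcompose_hom])

lemma Sq2_var:
  "Sq2 v u (var i) = [:var i:] + (u + v) * [:(low i)\<^sup>2:] + u * v\<^sup>2 * [:(shift (low i))^4:]"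
proof -
  have 1: "pcompose (Sqt (low i)) v = [:low i:] + v * [:(shift (low i))\<^sup>2:]"
    by (cases i) (simp_all add: pcompose_pCons Sqt_simps shift_simps)
  have "pcompose (Sqt ((low i)\<^sup>2)) v = ([:low i:] + v * [:(shift (low i))\<^sup>2:])\<^sup>2"
    by (simp only: Sqt_simps(5) is_homD(5)[OF pcompose_hom] 1)
  also have "\<dots> = [:low i:]\<^sup>2 + (v * [:(shift (low i))\<^sup>2:])\<^sup>2"
    by (rule square_add[OF poly_poly2_double])
  also have "\<dots> = [:(low i)\<^sup>2:] + v\<^sup>2 * [:(shift (low i))^4:]"
    by (simp add: power2_eq_square power4_eq_xxxx algebra_simps)
  finally show ?thesis
    by (simp add: Sq2_def map_poly_pCons pcompose_pCons Sqt_simps algebra_simps smult_add_right)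
qed

lemma Sq2_cong: "u + v = u' + v' \<Longrightarrow> u * v\<^sup>2 = u' * v'\<^sup>2 \<Longrightarrow> Sq2 v u p = Sq2 v' u' p"
  by (rule hom_eqI[OF Sq2_hom Sq2_hom]) (simp add: Sq2_var)

lemma poly_bounded_sum:
  "degree f \<le> B \<Longrightarrow> poly f (x::'a::comm_ring_1) = (\<Sum>i\<le>B. coeff f i * x ^ i)"
  unfolding poly_altdef by (rule sum.mono_neutral_left) (auto simp: coeff_eq_0)

lemma Sq2_expand:
  assumes "degree (Sqt p) \<le> B" "\<And>j. degree (Sqt (Sqp j p)) \<le> B"
  shows "Sq2 v u p = (\<Sum>j\<le>B. \<Sum>i\<le>B. v ^ i * u ^ j * [:Sqp i (Sqp j p):])"
proof -
  have 1: "pcompose (Sqt (Sqp j p)) v = (\<Sum>i\<le>B. [:Sqp i (Sqp j p):] * v ^ i)" for j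
  proof -
    have "pcompose (Sqt (Sqp j p)) v = (\<Sum>i\<le>B. coeff (map_poly (\<lambda>c. [:c:]) (Sqt (Sqp j p))) i * v ^ i)"
      unfolding pcompose_altdef using assms(2)[of j]
      by (intro poly_bounded_sum) (simp add: degree_map_poly)
    then show ?thesis by (simp add: coeff_map_poly Sqp_def)
  qed
  let ?h = "\<lambda>c. pcompose (Sqt c) v"
  have "Sq2 v u p = (\<Sum>j\<le>B. coeff (map_poly ?h (Sqt p)) j * u ^ j)"
    unfolding Sq2_def using assms(1) order.trans[OF map_poly_degree_leq]
    by (intro poly_bounded_sum) blast
  also have "\<dots> = (\<Sum>j\<le>B. ?h (Sqp j p) * u ^ j)"
    by (simp add: coeff_map_poly Sqp_def Sqt_simps)
  also have "\<dots> = (\<Sum>j\<le>B. \<Sum>i\<le>B. v ^ i * u ^ j * [:Sqp i (Sqp j p):])"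
    by (simp only: 1 sum_distrib_left sum_distrib_right mult_ac)
  finally show ?thesis .
qed

section \<open>Residues and binomial coefficients modulo 2\<close>

text \<open>The power series 1/(1 + s), whose coefficients are all 1 since signs do not matter in
  characteristic 2.\<close>

definition geom :: "poly2 fps" where
  "geom = Abs_fps (\<lambda>_. 1)"

lemma geom_inverse: "geom * (1 + fps_X) = 1"
  by (rule fps_ext) (simp add: geom_def distrib_left poly2_double)

lemma nth_geom_power: "fps_nth (geom ^ Suc m) r = of_nat ((m + r) choose r)"
proof (induction m arbitrary: r)
  case (Suc m)
  have "geom ^ Suc (Suc m) * (1 + fps_X) = (geom * (1 + fps_X)) * geom ^ Suc m"
    by (simp only: power_Suc mult_ac)
  then have g: "geom ^ Suc (Suc m) * (1 + fps_X) = geom ^ Suc m"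
    by (simp only: geom_inverse mult_1)
  have two: "a = b + c \<Longrightarrow> a + c = b" for a b c :: poly2
    by (simp add: add.assoc poly2_double)
  show ?case
  proof (induction r)
    case 0
    show ?case using arg_cong[OF g, of "\<lambda>f. fps_nth f 0"] Suc[of 0] by (simp add: geom_def)
  next
    case (Suc r)
    have "fps_nth (geom ^ Suc (Suc m)) (Suc r) + fps_nth (geom ^ Suc (Suc m)) r = fps_nth (geom ^ Suc m) (Suc r)"
      using arg_cong[OF g, of "\<lambda>f. fps_nth f (Suc r)"]
      by (simp add: distrib_left del: power_Suc)
    then have "fps_nth (geom ^ Suc (Suc m)) (Suc r) =
        fps_nth (geom ^ Suc m) (Suc r) + fps_nth (geom ^ Suc (Suc m)) r"
      using two by metis
    also have "\<dots> = of_nat ((Suc m + Suc r) choose Suc r)"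
      by (simp only: Suc.IH \<open>\<And>r. fps_nth (geom ^ Suc m) r = of_nat ((m + r) choose r)\<close> flip: of_nat_add) simp
    finally show ?case .
  qed
qed (simp add: geom_def)

text \<open>\<open>res a f\<close> is the residue at \<open>0\<close> of \<open>f (s + s\<^sup>2)\<^bsup>-a-1\<^esup> ds\<close>; in characteristic 2 we have
  \<open>ds = d(s + s\<^sup>2)\<close>.\<close>

definition res :: "nat \<Rightarrow> poly2 poly \<Rightarrow> poly2" where
  "res a f = fps_nth (fps_of_poly f * geom ^ Suc a) a"

lemma res_sum: "res a (sum f A) = (\<Sum>x\<in>A. res a (f x))"
  by (simp add: res_def fps_of_poly_sum sum_distrib_right fps_sum_nth)

lemma res_const: "res a (f * [:c:]) = res a f * c"
proof -
  have "fps_of_poly (f * [:c:]) * geom ^ Suc a = fps_const c * (fps_of_poly f * geom ^ Suc a)"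
    by (simp only: fps_of_poly_mult fps_of_poly_const mult_ac)
  then show ?thesis by (simp add: res_def mult.commute)
qed

lemma even_central: "even ((Suc r + Suc r) choose Suc r)"
  using binomial_symmetric[of r "Suc (r + r)"] by simp

lemma of_nat_poly2: "(of_nat n :: poly2) = (if odd n then 1 else 0)"
  by (induction n) (simp_all add: poly2_double)

text \<open>With w = s + s^2 this is the residue of w^(k-a-1) dw. For k = a - r the coefficient is
  the central binomial coefficient (2r choose r), which is even unless r = 0.\<close>

lemma res_u: "res a ([:0, 1, 1:] ^ k) = (if k = a then 1 else 0)"
proof -
  have X: "fps_of_poly [:0, 1, 1::poly2:] = fps_X * (1 + fps_X)"
    by (simp add: fps_of_poly_pCons algebra_simps)
  have r: "res a ([:0, 1, 1:] ^ k) = fps_nth (fps_X ^ k * ((1 + fps_X) ^ k * geom ^ Suc a)) a"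
    by (simp add: res_def fps_of_poly_power X power_mult_distrib mult.assoc)
  show ?thesis
  proof (cases "k \<le> a")
    case True
    then obtain r where a: "a = k + r" using le_Suc_ex by blast
    have "(1 + fps_X) ^ k * geom ^ Suc a = (geom * (1 + fps_X)) ^ k * geom ^ Suc r"
      by (simp add: a power_add power_mult_distrib mult_ac)
    then have "res a ([:0, 1, 1:] ^ k) = of_nat ((r + r) choose r)"
      unfolding r by (simp only: geom_inverse power_one mult_1 fps_X_power_mult_nth) (simp add: a nth_geom_power del: power_Suc)
    then show ?thesis using even_central by (cases r) (simp_all add: a of_nat_poly2 del: binomial_Suc_Suc)
  next
    case False
    then show ?thesis unfolding r by (simp add: fps_X_power_mult_nth)
  qed
qed

text \<open>The residue is a constant, 0 or 1. Multiplication by it therefore respects degrees, and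
  \<open>Sqp_adem\<close> can compare homogeneous parts.\<close>

lemma res_v_const: "\<exists>n. res a ([:1, 1:] ^ i * ([:0, 1:]\<^sup>2) ^ j) = of_nat n"
proof -
  have "[:1, 1:] ^ i * ([:0, 1:]\<^sup>2) ^ j = monom 1 (2 * j) * [:1, 1::poly2:] ^ i"
    by (simp only: monom_altdef power_mult[symmetric] mult.commute smult_1_left)
  then have 1: "coeff ([:1, 1:] ^ i * ([:0, 1:]\<^sup>2) ^ j) k =
      (of_nat (if 2 * j \<le> k then i choose (k - 2 * j) else 0) :: poly2)" for k
    by (cases "k - 2 * j \<le> i")
      (simp_all add: coeff_monom_mult coeff_linear_poly_power coeff_eq_0 degree_linear_power
        binomial_eq_0)
  show ?thesis
    unfolding res_def fps_mult_nth nth_geom_power fps_of_poly_nth 1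
    by (simp only: flip: of_nat_mult of_nat_sum) blast
qed

lemma res_v_zero: "a < 2 * j \<Longrightarrow> res a ([:1, 1:] ^ i * ([:0, 1:]\<^sup>2) ^ j) = 0"
proof -
  assume "a < 2 * j"
  moreover have "fps_of_poly ([:1, 1:] ^ i * ([:0, 1:]\<^sup>2) ^ j) * geom ^ Suc a =
      fps_X ^ (2 * j) * (fps_of_poly ([:1, 1::poly2:] ^ i) * geom ^ Suc a)"
    by (simp only: fps_of_poly_mult fps_of_poly_power fps_of_poly_fps_X power_mult[symmetric] mult_ac)
  ultimately show ?thesis by (simp only: res_def fps_X_power_mult_nth if_True)
qed

lemma res_v:
  assumes "j < b" "i + j = a + b"
  shows "res a ([:1, 1:] ^ i * ([:0, 1:]\<^sup>2) ^ j) =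
    (if 2 * j \<le> a then of_nat ((b - 1 - j) choose (a - 2 * j)) else 0)"
proof -
  note power_Suc [simp del]
  \<comment> \<open>The power (1 + s)^(a+1) cancels against the denominator, which leaves (1 +
    s)^(b-1-j): the source of the Adem coefficient.\<close>
  have i: "i = (b - 1 - j) + Suc a" using assms by linarith
  have X: "fps_of_poly [:1, 1::poly2:] = 1 + fps_X"
    by (simp add: fps_of_poly_pCons)
  have c: "fps_nth ((1 + fps_X) ^ n) k = (of_nat (n choose k) :: poly2)" for n k
  proof -
    have "fps_nth ((1 + fps_X) ^ n) k = coeff ([:1, 1::poly2:] ^ n) k"
      by (simp add: fps_of_poly_power flip: X fps_of_poly_nth)
    then show ?thesis
      by (cases "k \<le> n") (simp_all add: coeff_linear_poly_power coeff_eq_0 degree_linear_power binomial_eq_0)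
  qed
  have "res a ([:1, 1:] ^ i * ([:0, 1:]\<^sup>2) ^ j) =
      fps_nth (fps_X ^ (2 * j) * ((1 + fps_X) ^ (b - 1 - j) * (geom * (1 + fps_X)) ^ Suc a)) a"
    by (simp only: res_def fps_of_poly_power fps_of_poly_mult fps_of_poly_fps_X X i power_add
        power_mult[symmetric] power_mult_distrib mult_ac)
  then show ?thesis
    by (simp only: geom_inverse power_one mult_1_right fps_X_power_mult_nth c not_le if_distrib) simp
qed


subsection \<open>The unstable module of polynomials of given weight\<close>

definition wt :: "nat multiset \<Rightarrow> nat" where
  "wt M = (\<Sum>i\<in>#M. 2 ^ i)"

lemma wt_simps [simp]: "wt {#} = 0" "wt (add_mset i M) = 2 ^ i + wt M" "wt (M + N) = wt M + wt N"
  by (simp_all add: wt_def)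

definition Pm :: "nat \<Rightarrow> poly2 gmod" where
  "Pm n = \<lparr>carr = (\<lambda>m. {p. \<forall>M\<in>keys p. size M = m \<and> wt M = n}), zer = (\<lambda>m. 0),
     add = (\<lambda>m. (+)), sq = (\<lambda>i m. Sqp i)\<rparr>"

lemma Pm_simps [simp]:
  "zer (Pm n) m = 0" "add (Pm n) m = (+)" "sq (Pm n) i m = Sqp i"
  by (simp_all add: Pm_def)

lemma Pm_carr: "p \<in> carr (Pm n) m \<longleftrightarrow> (\<forall>M\<in>keys p. size M = m \<and> wt M = n)"
  by (simp add: Pm_def)

lemma Pm_zero [simp]: "0 \<in> carr (Pm n) m"
  by (simp add: Pm_carr)

lemma Pm_mon [simp]: "mon M \<in> carr (Pm n) m \<longleftrightarrow> size M = m \<and> wt M = n"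
  by (simp add: Pm_carr)

lemma Pm_one [simp]: "1 \<in> carr (Pm 0) 0"
  using Pm_mon[of "{#}"] by simp

lemma Pm_var: "n = 2 ^ i \<Longrightarrow> var i \<in> carr (Pm n) 1"
  by (simp add: var_def)

lemma Pm_add: "p \<in> carr (Pm n) m \<Longrightarrow> q \<in> carr (Pm n) m \<Longrightarrow> p + q \<in> carr (Pm n) m"
  by (auto simp: Pm_carr keys_add_poly2)

lemma Pm_mult: "p \<in> carr (Pm n) m \<Longrightarrow> q \<in> carr (Pm n') m' \<Longrightarrow> p * q \<in> carr (Pm (n + n')) (m + m')"
  using keys_mult[of p q] by (fastforce simp: Pm_carr)

lemma Pm_induct [consumes 1, case_names zero add]:
  assumes "p \<in> carr (Pm n) m" "Q 0"
    "\<And>M p. size M = m \<Longrightarrow> wt M = n \<Longrightarrow> p \<in> carr (Pm n) m \<Longrightarrow> Q p \<Longrightarrow> Q (mon M + p)"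
  shows "Q p"
  using assms(1)
proof (induction p rule: poly2_induct)
  case (add M p)
  then have "size M = m" "wt M = n" "p \<in> carr (Pm n) m"
    by (auto simp: Pm_carr keys_add_poly2)
  then show ?case using add.IH by (intro assms(3))
qed (rule assms(2))

text \<open>Doubling the weight 2^(i-1) of x_{i-1} gives the weight of x_i, which is why the
  operations preserve weight.\<close>

lemma low_square_carr: "(low i)\<^sup>2 \<in> carr (Pm (2 ^ i)) 2"
proof (cases i)
  case (Suc j)
  have "var j * var j \<in> carr (Pm (2 ^ j + 2 ^ j)) (1 + 1)" by (intro Pm_mult Pm_var) simp_all
  then show ?thesis by (simp add: Suc power2_eq_square mult_2 flip: mult_2)
qed simp

lemma mon_add_mset: "mon (add_mset i M) = var i * mon M"
  by (simp add: var_def mult_single)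

lemma Sqp_one: "Sqp k 1 = (if k = 0 then 1 else 0)"
  by (simp add: Sqp_def Sqt_simps coeff_1)

text \<open>Induction over the factors of a monomial. The claims are joined because the top
  operation on x_i M reduces to the top operation on M only after the operation one above the top of
  M has vanished.\<close>

lemma Sqp_mon:
  shows Sqp_mon_carr: "Sqp k (mon M) \<in> carr (Pm (wt M)) (size M + k)"
    and Sqp_mon_vanish: "size M < k \<Longrightarrow> Sqp k (mon M) = 0"
    and Sqp_mon_top: "Sqp (size M) (mon M) = (shift (mon M))\<^sup>2"
proof (induction M arbitrary: k)
  case (add i M)
  {
    case 1
    have "var i * Sqp k (mon M) \<in> carr (Pm (2 ^ i + wt M)) (1 + (size M + k))"
      by (intro Pm_mult Pm_var add.IH) simp
    moreover have "(low i)\<^sup>2 * Sqp l (mon M) \<in> carr (Pm (2 ^ i + wt M)) (2 + (size M + l))" for l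
      by (intro Pm_mult low_square_carr add.IH)
    ultimately show ?case
      unfolding mon_add_mset Sqp_var_mult by (cases k) (auto intro!: Pm_add)
  next
    case 2
    then show ?case unfolding mon_add_mset Sqp_var_mult using add.IH(2) by (cases k) simp_all
  next
    case 3
    then show ?case
      unfolding mon_add_mset Sqp_var_mult using add.IH(2,3)
      by (simp add: shift_simps power_mult_distrib)
  }
qed (simp_all add: Sqp_one shift_simps)

lemma Sqp_carr: "p \<in> carr (Pm n) m \<Longrightarrow> Sqp k p \<in> carr (Pm n) (m + k)"
  by (induction p rule: Pm_induct) (use Sqp_mon_carr Pm_add in \<open>auto simp: Sqp_add\<close>)

lemma Sqp_vanish: "p \<in> carr (Pm n) m \<Longrightarrow> m < k \<Longrightarrow> Sqp k p = 0"
  by (induction p rule: Pm_induct) (auto simp: Sqp_add Sqp_mon_vanish)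

lemma Sqp_top: "p \<in> carr (Pm n) m \<Longrightarrow> Sqp m p = (shift p)\<^sup>2"
  by (induction p rule: Pm_induct)
    (auto simp: Sqp_add Sqp_mon_top shift_simps square_add[OF poly2_double])

lemma lookup_of_nat_mult: "lookup (of_nat k * p) M = (if odd k then lookup p M else 0)"
  by (simp add: of_nat_poly2)

lemma Sqp_adem:
  assumes p: "p \<in> carr (Pm n) m" and ab: "a < 2 * b"
  shows "Sqp a (Sqp b p) =
    (\<Sum>j\<le>a div 2. of_nat ((b - 1 - j) choose (a - 2 * j)) * Sqp (a + b - j) (Sqp j p))"
    (is "?l = ?r")
proof (rule poly_mapping_eqI)
  fix M
  \<comment> \<open>The total square of Sq^j p has degree at most m + j, and Sq^j p = 0 for j > m,
    so 2m bounds all degrees. Adding a + b keeps the indices a, b and a + b - j inside the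
    sums.\<close>
  define B where "B = 2 * m + a + b"
  have B: "degree (Sqt p) \<le> B" "degree (Sqt (Sqp j p)) \<le> B" for j
  proof -
    show "degree (Sqt p) \<le> B"
      using Sqp_vanish[OF p] by (intro degree_le) (simp add: B_def flip: Sqp_def)
    show "degree (Sqt (Sqp j p)) \<le> B"
    proof (cases "j \<le> m")
      case True
      then show ?thesis
        using Sqp_vanish[OF Sqp_carr[OF p]] by (intro degree_le) (simp add: B_def flip: Sqp_def)
    qed (simp add: Sqp_vanish[OF p] Sqt_simps)
  qed
  let ?S = "\<lambda>i j. Sqp i (Sqp j p)"
  let ?v = "\<lambda>i j. res a ([:1, 1:] ^ i * ([:0, 1:]\<^sup>2) ^ j)"
  have grade: "?S i j \<in> carr (Pm n) (m + j + i)" for i j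
    by (intro Sqp_carr p)
  have off: "lookup (?S i j) M = 0" if "size M \<noteq> m + i + j" for i j
  proof -
    have "M \<notin> keys (?S i j)" using grade[of i j] that by (auto simp: Pm_carr)
    then show ?thesis by (simp add: in_keys_iff)
  qed
  have "Sq2 [:0, 1, 1:] 1 p = Sq2 [:1, 1:] ([:0, 1:]\<^sup>2) p"
    by (rule Sq2_cong) (simp_all add: one_pCons power2_eq_square poly2_double)
  then have "res a (Sq2 [:0, 1, 1:] 1 p) = res a (Sq2 [:1, 1:] ([:0, 1:]\<^sup>2) p)" by simp
  \<comment> \<open>On the left the residue keeps only i = a. In degree m + a + b only terms with i
    + j = a + b remain, by \<open>off\<close>: j = b on the left and i = a + b - j on the
    right.\<close>
  then have main: "(\<Sum>j\<le>B. \<Sum>i\<le>B. (if i = a then 1 else 0) * ?S i j) = (\<Sum>j\<le>B. \<Sum>i\<le>B. ?v i j * ?S i j)"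
    by (simp only: Sq2_expand[OF B] res_sum res_const power_one mult_1_right res_u)
  show "lookup ?l M = lookup ?r M"
  proof (cases "size M = m + a + b")
    case False
    have "lookup (?S (a + b - j) j) M = 0" if "j \<le> a div 2" for j
      by (rule off) (use that False in linarith)
    then show ?thesis using off[of a b] False
      by (auto simp: lookup_sum lookup_of_nat_mult intro!: sum.neutral)
  next
    case True
    have "lookup ?l M = (\<Sum>j\<le>B. if j = b then lookup (?S a j) M else 0)"
      by (simp add: B_def)
    also have "\<dots> = (\<Sum>j\<le>B. lookup (?S a j) M)"
      by (intro sum.cong refl) (auto simp: off True)
    also have "\<dots> = lookup (\<Sum>j\<le>B. \<Sum>i\<le>B. (if i = a then 1 else 0) * ?S i j) M"
    proof -
      have "(\<Sum>i\<le>B. (if i = a then 1 else 0) * ?S i j) = ?S a j" for j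
        by (simp add: if_distrib[of "\<lambda>x. x * _"] B_def cong: if_cong)
      then show ?thesis by (simp add: lookup_sum)
    qed
    also have "\<dots> = (\<Sum>j\<le>B. \<Sum>i\<le>B. lookup (?v i j * ?S i j) M)"
      by (simp only: main lookup_sum)
    also have "\<dots> = (\<Sum>j\<le>B. if j \<le> a div 2 then
        lookup (of_nat ((b - 1 - j) choose (a - 2 * j)) * ?S (a + b - j) j) M else 0)"
    proof (rule sum.cong[OF HOL.refl])
      fix j
      show "(\<Sum>i\<le>B. lookup (?v i j * ?S i j) M) = (if j \<le> a div 2 then
        lookup (of_nat ((b - 1 - j) choose (a - 2 * j)) * ?S (a + b - j) j) M else 0)"
      proof (cases "2 * j \<le> a")
        case False
        then show ?thesis by (simp add: res_v_zero)
      next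
        case j: True
        have "(\<Sum>i\<le>B. lookup (?v i j * ?S i j) M) =
            (\<Sum>i\<le>B. if i = a + b - j then lookup (?v i j * ?S i j) M else 0)"
        proof (rule sum.cong[OF HOL.refl])
          fix i
          obtain k where k: "?v i j = of_nat k" using res_v_const by blast
          show "lookup (?v i j * ?S i j) M = (if i = a + b - j then lookup (?v i j * ?S i j) M else 0)"
            using off[of i j] j True unfolding k by (auto simp: lookup_of_nat_mult)
        qed
        also have "\<dots> = lookup (?v (a + b - j) j * ?S (a + b - j) j) M"
          by (simp add: B_def)
        also have "?v (a + b - j) j = of_nat ((b - 1 - j) choose (a - 2 * j))"
          using j ab by (subst res_v[of j b]) auto
        finally show ?thesis using j by simp
      qed
    qed
    also have "\<dots> = (\<Sum>j\<le>a div 2.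
        lookup (of_nat ((b - 1 - j) choose (a - 2 * j)) * ?S (a + b - j) j) M)"
    proof -
      have "{..B} \<inter> {j. j \<le> a div 2} = {..a div 2}" by (auto simp: B_def)
      then show ?thesis by (simp add: sum.If_cases)
    qed
    finally show ?thesis by (simp add: lookup_sum)
  qed
qed

lemma gsum_Pm: "gsum (Pm n) m ps = sum_list ps"
  by (induction ps) simp_all

lemma Pm_unstable: "unstable_module (Pm n)"
proof -
  have "vec_ids (Pm n) \<subseteq> Id"
    unfolding vec_ids_iff by (simp add: add_ac poly2_double)
  moreover have "sq_additive_ids (Pm n) \<subseteq> Id"
    unfolding sq_additive_ids_iff by (simp add: Sqp_add)
  moreover have "instability_ids (Pm n) \<subseteq> Id"
    unfolding instability_ids_iff by (simp add: Sqp_vanish)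
  moreover have "steenrod_ids (Pm n) \<subseteq> Id"
  proof -
    have "Sqp a (Sqp b p) = gsum (Pm n) k
         (map (\<lambda>j. Sqp (a + b - j) (Sqp j p))
           (filter (\<lambda>j. odd ((b - 1 - j) choose (a - 2 * j))) [0..<Suc (a div 2)]))"
      if "p \<in> carr (Pm n) m" "a < 2 * b" for a b m p k
      unfolding gsum_Pm Sqp_adem[OF that] sum_list_map_filter'
      by (simp only: interv_sum_list_conv_sum_set_nat atLeast0LessThan lessThan_Suc_atMost of_nat_poly2)
        (intro sum.cong, auto)
    then show ?thesis unfolding steenrod_ids_iff Pm_simps using Sqp_0 by blast
  qed
  ultimately show ?thesis
    unfolding unstable_module_def unstable_ids_def closed_gmod_def by (simp add: Pm_add Sqp_carr)
qed

section \<open>Brown--Gitler modules as modules of polynomials\<close>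

subsection \<open>Preliminaries on unstable modules\<close>

lemma unstable_add_zer: "unstable_module M \<Longrightarrow> x \<in> carr M n \<Longrightarrow> add M n x (zer M n) = x"
  using unstable_vec(2,3)[of M] unstableD(1)[of M] by metis

lemma unstable_sq_zer: "unstable_module M \<Longrightarrow> sq M i n (zer M n) = zer M (n + i)"
  using unstable_sq_add[of M "zer M n" n "zer M n" i] unstable_vec(4)[of M] unstableD(1,3)[of M]
  by metis

lemma gsum_zeros:
  "unstable_module M \<Longrightarrow> \<forall>x\<in>set xs. x = zer M n \<Longrightarrow> gsum M n xs = zer M n"
  by (induction xs) (simp_all add: unstable_vec(3)[of M] unstableD(1)[of M])

lemma gsum_last:
  assumes M: "unstable_module M" and "\<forall>x\<in>set xs. x = zer M n" and y: "y \<in> carr M n"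
  shows "gsum M n (xs @ [y]) = y"
  using assms(2)
  by (induction xs) (simp_all add: unstable_vec(3)[OF M] unstable_add_zer[OF M] y)

text \<open>In the Adem relation for Sq^{2c} Sq^j on degree j the terms with k < c vanish by
  instability and the term k = c has coefficient 1. Outside the range of the relation the two sides
  coincide (c = 0 or c = j) or are both zero (c > j).\<close>

lemma sq_Sq0_even:
  assumes M: "unstable_module M" and y: "y \<in> carr M j"
  shows "sq M (2 * c) (j + j) (sq M j j y) = sq M (j + c) (j + c) (sq M c j y)"
proof (cases "c < j")
  case False
  show ?thesis
  proof (cases "c = j")
    case False
    with \<open>\<not> c < j\<close> have "j < c" by simp
    then have "sq M (2 * c) (j + j) (sq M j j y) = zer M (j + j + 2 * c)"
      "sq M c j y = zer M (j + c)"
      using unstable_vanish[OF M unstableD(3)[OF M y]] unstable_vanish[OF M y] by simp_all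
    moreover have "j + j + 2 * c = j + c + (j + c)" by simp
    ultimately show ?thesis by (simp only: unstable_sq_zer[OF M])
  qed (simp add: mult_2)
next
  case cj: True
  show ?thesis
  proof (cases "c = 0")
    case True
    then show ?thesis using unstable_sq0[OF M] y unstableD(3)[OF M y] by simp
  next
    case False
    let ?f = "\<lambda>k. sq M (2 * c + j - k) (j + k) (sq M k j y)"
    let ?P = "\<lambda>k. odd ((j - 1 - k) choose (2 * c - 2 * k))"
    have e: "j + 2 * c + j = j + c + (j + c)" by simp
    have "sq M (2 * c) (j + j) (sq M j j y) =
        gsum M (j + 2 * c + j) (map ?f (filter ?P [0..<Suc (2 * c div 2)]))"
      using unstable_adem[OF M y, of "2 * c" j] False cj by simp
    also have "filter ?P [0..<Suc (2 * c div 2)] = filter ?P [0..<c] @ [c]"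
      by simp
    also have "gsum M (j + 2 * c + j) (map ?f (filter ?P [0..<c] @ [c])) = ?f c"
      unfolding map_append list.map
    proof (rule gsum_last[OF M ballI])
      fix x assume "x \<in> set (map ?f (filter ?P [0..<c]))"
      then obtain k where k: "k < c" "x = ?f k" by auto
      then have "?f k = zer M (j + k + (2 * c + j - k))"
        using cj by (intro unstable_vanish[OF M] unstableD(3)[OF M y]) linarith
      moreover have "j + k + (2 * c + j - k) = j + 2 * c + j" using k(1) by linarith
      ultimately show "x = zer M (j + 2 * c + j)" using k(2) by metis
    next
      have "?f c \<in> carr M (j + c + (2 * c + j - c))"
        by (intro unstableD(3)[OF M] y)
      moreover have "j + c + (2 * c + j - c) = j + 2 * c + j" using cj by linarith
      ultimately show "?f c \<in> carr M (j + 2 * c + j)" by metis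
    qed
    also have "2 * c + j - c = j + c" by simp
    finally show ?thesis .
  qed
qed

text \<open>Now instability kills every term of the Adem relation, because k <= c gives 2c + 1 - k >
  k.\<close>

lemma sq_Sq0_odd:
  assumes M: "unstable_module M" and y: "y \<in> carr M j"
  shows "sq M (2 * c + 1) (j + j) (sq M j j y) = zer M (j + j + (2 * c + 1))"
proof (cases "c < j")
  case False
  then show ?thesis using unstable_vanish[OF M unstableD(3)[OF M y]] by simp
next
  case cj: True
  let ?f = "\<lambda>k. sq M (2 * c + 1 + j - k) (j + k) (sq M k j y)"
  let ?P = "\<lambda>k. odd ((j - 1 - k) choose (2 * c + 1 - 2 * k))"
  have "sq M (2 * c + 1) (j + j) (sq M j j y) =
      gsum M (j + (2 * c + 1) + j) (map ?f (filter ?P [0..<Suc ((2 * c + 1) div 2)]))"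
    using unstable_adem[OF M y, of "2 * c + 1" j] cj by simp
  also have "\<dots> = zer M (j + (2 * c + 1) + j)"
  proof (rule gsum_zeros[OF M ballI])
    fix x assume "x \<in> set (map ?f (filter ?P [0..<Suc ((2 * c + 1) div 2)]))"
    then obtain k where "k \<in> {0..<Suc ((2 * c + 1) div 2)}" and x: "x = ?f k"
      unfolding set_map set_filter set_upt by blast
    then have k: "k \<le> c" "x = ?f k" by auto
    then have "?f k = zer M (j + k + (2 * c + 1 + j - k))"
      using cj by (intro unstable_vanish[OF M] unstableD(3)[OF M y]) linarith
    moreover have "j + k + (2 * c + 1 + j - k) = j + (2 * c + 1) + j" using k(1) by linarith
    ultimately show "x = zer M (j + (2 * c + 1) + j)" using k(2) by metis
  qed
  finally show ?thesis by (simp add: ac_simps)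
qed

subsection \<open>Low degrees of free unstable modules\<close>

lemma F_induct [consumes 1, case_names iota zer add sq]:
  assumes z: "z \<in> carr (F m) k"
    and i: "Q m (iota m)"
    and o: "\<And>k. Q k (zer (F m) k)"
    and a: "\<And>k x y. x \<in> carr (F m) k \<Longrightarrow> y \<in> carr (F m) k \<Longrightarrow> Q k x \<Longrightarrow> Q k y \<Longrightarrow>
      Q k (add (F m) k x y)"
    and s: "\<And>i k x. x \<in> carr (F m) k \<Longrightarrow> Q k x \<Longrightarrow> Q (k + i) (sq (F m) i k x)"
  shows "Q k z"
proof -
  have "Q (tdeg t) (Fq.cl m t)" if "t \<in> F_terms m" for t
    using that
  proof (induction t)
    case (Gen n g)
    then have "m = n" by (auto simp: F_terms_def elim: mod_terms.cases split: if_splits)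
    then show ?case using i by (simp add: iota_def)
  next
    case (Zero n)
    then show ?case using o[of n] by (simp add: F_def)
  next
    case (Add t u)
    note tu = F_terms_D(1)[OF Add.prems]
    then show ?case using a[of "Fq.cl m t" "tdeg t" "Fq.cl m u"] Add.IH by (simp add: F_def)
  next
    case (Sq i t)
    note t = F_terms_D(2)[OF Sq.prems]
    then show ?case using s[of "Fq.cl m t" "tdeg t" i] Sq.IH by (simp add: F_def)
  qed (simp add: F_terms_D(3))
  moreover obtain t where "t \<in> F_terms m" "tdeg t = k" "z = Fq.cl m t"
    using z unfolding F_def by (meson Fq.cl_E)
  ultimately show ?thesis by blast
qed

text \<open>Operations of positive degree raise degrees, and on degree 0 they vanish by
  instability.\<close>

lemma F_low_degrees:
  assumes "z \<in> carr (F m) k"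
  shows "(k < m \<longrightarrow> z = zer (F m) k) \<and> (k = m \<longrightarrow> z = zer (F m) k \<or> z = iota m) \<and>
    (m = 0 \<and> 0 < k \<longrightarrow> z = zer (F m) k)"
  using assms
proof (induction rule: F_induct)
  case (add k x y)
  have z: "zer (F m) k \<in> carr (F m) k" by (rule unstableD(1)[OF F_unstable])
  have "add (F m) k (zer (F m) k) (zer (F m) k) = zer (F m) k"
    by (rule unstable_vec(3)[OF F_unstable z])
  moreover have "add (F m) k (zer (F m) k) w = w" "add (F m) k w (zer (F m) k) = w"
    "add (F m) k w w = zer (F m) k" if "w \<in> carr (F m) k" for w
    by (rule unstable_vec(3,4)[OF F_unstable that] unstable_add_zer[OF F_unstable that])+
  ultimately show ?case using add by metis
next
  case (sq i k x)
  show ?case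
  proof (cases "i = 0")
    case True
    then show ?thesis using sq.IH unstable_sq0[OF F_unstable sq.hyps] by (simp only: add_0_right)
  next
    case False
    have "sq (F m) i k x = zer (F m) (k + i)" if "k + i \<le> m \<or> m = 0"
    proof (cases "k < m \<or> m = 0 \<and> 0 < k")
      case True
      then have "x = zer (F m) k" using sq.IH by blast
      then show ?thesis by (simp only: unstable_sq_zer[OF F_unstable])
    next
      case 2: False
      with that False have "k < i" by linarith
      then show ?thesis by (rule unstable_vanish[OF F_unstable sq.hyps])
    qed
    then show ?thesis by (metis le_eq_less_or_eq)
  qed
qed auto

subsection \<open>The comparison map\<close>

lemma mor_J_eqI:
  assumes M: "unstable_module M" and f: "f \<in> mor M (J n)" and g: "g \<in> mor M (J n)"
    and eq: "\<And>x. x \<in> carr M n \<Longrightarrow> f n x (iota n) = g n x (iota n)"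
  shows "f = g"
proof -
  note s = bij_betw_imp_surj_on[OF J_represents[OF M]]
  obtain \<phi> where \<phi>: "\<phi> \<in> dual M n" "f = J_mor M n \<phi>" using f s by blast
  obtain \<psi> where \<psi>: "\<psi> \<in> dual M n" "g = J_mor M n \<psi>" using g s by blast
  have "\<phi> = \<psi>"
    using eq by (intro dual_eqI[OF \<phi>(1) \<psi>(1)]) (simp add: \<phi>(2) \<psi>(2) J_mor_iota[OF M])
  then show ?thesis using \<phi> \<psi> by simp
qed

lemma J_eqI:
  "f \<in> carr (J n) m \<Longrightarrow> g \<in> carr (J n) m \<Longrightarrow> (\<And>z. z \<in> carr (F m) n \<Longrightarrow> f z = g z) \<Longrightarrow> f = g"
  unfolding J_simps by (rule dual_eqI)

lemma F_mor_J_iota: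
  "f \<in> carr (J n) m \<Longrightarrow> z \<in> carr (F m) n \<Longrightarrow> F_mor (J n) m f n z (iota n) = f z"
  by (simp add: F_mor_J J_act_def iota_carr F_mor(2)[OF F_unstable])

text \<open>The monomial x_0^n is the only one of degree n and weight n, so this is the nonzero
  functional in degree n. The morphism to J(n) that it represents is \<open>kappa n\<close>.\<close>

definition coeff0 :: "nat \<Rightarrow> poly2 \<Rightarrow> bit" where
  "coeff0 n = (\<lambda>p\<in>carr (Pm n) n. lookup p (replicate_mset n 0))"

definition kappa :: "nat \<Rightarrow> nat \<Rightarrow> poly2 \<Rightarrow> unit trm set \<Rightarrow> bit" where
  "kappa n = J_mor (Pm n) n (coeff0 n)"

lemma coeff0_dual: "coeff0 n \<in> dual (Pm n) n"
  by (rule dualI) (simp_all only: coeff0_def Pm_simps restrict_apply Pm_add lookup_add if_False if_True)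

lemma kappa_mor: "kappa n \<in> mor (Pm n) (J n)"
  unfolding kappa_def by (rule J_mor_mor[OF Pm_unstable coeff0_dual])

lemmas kappa_carr = mor_carr[OF kappa_mor]
lemmas kappa_add = mor_add[OF kappa_mor, unfolded Pm_simps]
lemmas kappa_sq = mor_sq[OF kappa_mor, unfolded Pm_simps]
lemmas kappa_zer = mor_zer[OF kappa_mor Pm_unstable J_unstable, unfolded Pm_simps]

lemma kappa_eval:
  "p \<in> carr (Pm n) m \<Longrightarrow> z \<in> carr (F m) n \<Longrightarrow> kappa n m p z = coeff0 n (F_mor (Pm n) m p n z)"
  by (simp add: kappa_def J_mor_def)

lemma kappa_iota: "p \<in> carr (Pm n) n \<Longrightarrow> kappa n n p (iota n) = lookup p (replicate_mset n 0)"
  using J_mor_iota[OF Pm_unstable] by (simp add: kappa_def coeff0_def)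

subsection \<open>The shift\<close>

text \<open>A multiplicative section of the shift that serves to lift elements. It does not commute
  with the operations: Sq^1 x_0 = 0 but Sq^1 x_1 = x_0^2.\<close>

definition unshift :: "poly2 \<Rightarrow> poly2" where
  "unshift = subst (\<lambda>i. var (Suc i))"

lemma unshift_hom: "is_hom unshift"
  unfolding unshift_def by (rule subst_hom[OF poly2_char])

lemmas unshift_simps = is_homD[OF unshift_hom]

lemma shift_unshift: "shift (unshift p) = p"
  by (rule hom_eqI[OF is_hom_comp[OF unshift_hom shift_hom]]) (simp_all add: is_hom_def unshift_def)

lemma unshift_var [simp]: "unshift (var i) = var (Suc i)"
  by (simp add: unshift_def)

lemma unshift_mon: "unshift (mon M) = mon (image_mset Suc M)"
  by (induction M) (simp_all add: mon_add_mset unshift_simps)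

lemma wt_image_Suc: "wt (image_mset Suc M) = 2 * wt M"
  by (induction M) simp_all

lemma unshift_carr: "p \<in> carr (Pm n) m \<Longrightarrow> unshift p \<in> carr (Pm (2 * n)) m"
  by (induction p rule: Pm_induct)
    (simp_all add: unshift_simps unshift_mon Pm_add wt_image_Suc)

lemma image_Suc_obtain:
  assumes "0 \<notin># M" obtains N where "M = image_mset Suc N"
proof -
  have "\<exists>N. M = image_mset Suc N"
    using assms
  proof (induction M)
    case (add i M)
    then obtain N j where "M = image_mset Suc N" "i = Suc j" by (auto simp: gr0_conv_Suc)
    then show ?case by (intro exI[of _ "add_mset j N"]) simp
  qed simp
  then show ?thesis using that by blast
qed

lemma shift_mon_zero: "0 \<in># M \<Longrightarrow> shift (mon M) = 0"
  by (drule multi_member_split) (auto simp: mon_add_mset shift_simps)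

lemma shift_mon_Suc: "shift (mon (image_mset Suc M)) = mon M"
  by (metis shift_unshift unshift_mon)

lemma shift_carr: "p \<in> carr (Pm (2 * n)) m \<Longrightarrow> shift p \<in> carr (Pm n) m"
proof (induction p rule: Pm_induct)
  case (add M p)
  have "shift (mon M) \<in> carr (Pm n) m"
  proof (cases "0 \<in># M")
    case False
    then obtain N where "M = image_mset Suc N" by (rule image_Suc_obtain)
    then show ?thesis using add by (simp add: shift_mon_Suc wt_image_Suc)
  qed (simp add: shift_mon_zero)
  then show ?case using add.IH by (simp add: shift_simps Pm_add)
qed (simp add: shift_simps)

lemma shift_odd: "p \<in> carr (Pm n) m \<Longrightarrow> odd n \<Longrightarrow> shift p = 0"
proof (induction p rule: Pm_induct)
  case (add M p)
  have "0 \<in># M"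
  proof (rule ccontr)
    assume "0 \<notin># M"
    then obtain N where "M = image_mset Suc N" by (rule image_Suc_obtain)
    then show False using add by (auto simp: wt_image_Suc)
  qed
  then show ?case using add by (simp add: shift_simps shift_mon_zero)
qed (simp add: shift_simps)

text \<open>A monomial either contains x_0 or has all indices raised by one. Hence the kernel of the
  shift consists of the multiples of x_0, which is the polynomial form of the exactness of the
  Mahowald sequence.\<close>

lemma shift_decomp:
  "p \<in> carr (Pm (Suc n)) (Suc m) \<Longrightarrow> \<exists>q\<in>carr (Pm n) m. p = unshift (shift p) + var 0 * q"
proof (induction p rule: Pm_induct)
  case zero
  show ?case by (rule bexI[of _ 0]) (simp_all add: shift_simps unshift_simps)
next
  case (add M p)
  then obtain q where q: "q \<in> carr (Pm n) m" "p = unshift (shift p) + var 0 * q" by blast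
  show ?case
  proof (cases "0 \<in># M")
    case True
    then obtain N where N: "M = add_mset 0 N" by (rule mset_add)
    have "mon M + p = unshift (shift (mon M + p)) + var 0 * (mon N + q)"
      using q(2) by (simp add: shift_simps shift_mon_zero[OF True] distrib_left)
        (simp add: N mon_add_mset)
    moreover have "mon N + q \<in> carr (Pm n) m" using add q(1) N by (simp add: Pm_add)
    ultimately show ?thesis by blast
  next
    case False
    then obtain N where "M = image_mset Suc N" by (rule image_Suc_obtain)
    then have "mon M + p = unshift (shift (mon M + p)) + var 0 * q"
      using q(2) by (simp add: shift_simps shift_mon_Suc unshift_simps unshift_mon add.assoc)
    then show ?thesis using q(1) by blast
  qed
qed

lemma shift_mor: "(\<lambda>m. \<lambda>p\<in>carr (Pm (2 * n)) m. shift p) \<in> mor (Pm (2 * n)) (Pm n)"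
  by (rule morI) (simp_all add: shift_carr Pm_add Sqp_carr shift_simps Sqp_shift)

lemma lookup_square_0: "lookup (p\<^sup>2) (replicate_mset (2 * n) 0) = lookup p (replicate_mset n 0)"
proof (induction p rule: poly2_induct)
  case (add M p)
  have "M + M = replicate_mset (2 * n) 0 \<longleftrightarrow> M = replicate_mset n 0"
    by (auto simp: multiset_eq_iff)
  then have "lookup ((mon M)\<^sup>2) (replicate_mset (2 * n) 0) = lookup (mon M) (replicate_mset n 0)"
    by (simp add: power2_eq_square mult_single lookup_single when_def)
  then show ?case unfolding square_add[OF poly2_double] lookup_add add.IH by simp
qed simp

text \<open>The dual of Sq_0 becomes the shift: on polynomials Sq_0 is the square of the shift, and
  the coefficient of x_0^{2n} in a square is the coefficient of x_0^n in its root.\<close>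

lemma kappa_Sq0:
  assumes p: "p \<in> carr (Pm (2 * n)) m" and z: "z \<in> carr (F m) n"
  shows "kappa (2 * n) m p (sq (F m) n n z) = kappa n m (shift p) z"
proof -
  let ?y = "F_mor (Pm (2 * n)) m p n z"
  have y: "?y \<in> carr (Pm (2 * n)) n" by (rule F_mor_carr[OF Pm_unstable p z])
  have sz: "sq (F m) n n z \<in> carr (F m) (2 * n)" using unstableD(3)[OF F_unstable z, of n] by (simp add: mult_2)
  have "F_mor (Pm (2 * n)) m p (2 * n) (sq (F m) n n z) = Sqp n ?y"
    using mor_sq[OF F_mor(1)[OF Pm_unstable p] z, of n] by (simp add: mult_2)
  also have "\<dots> = (shift ?y)\<^sup>2" by (rule Sqp_top[OF y])
  also have "shift ?y = F_mor (Pm n) m (shift p) n z"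
    using F_mor_comp[OF Pm_unstable Pm_unstable shift_mor p z] y p by simp
  finally have "F_mor (Pm (2 * n)) m p (2 * n) (sq (F m) n n z) = (F_mor (Pm n) m (shift p) n z)\<^sup>2" .
  moreover have "F_mor (Pm n) m (shift p) n z \<in> carr (Pm n) n"
    by (rule F_mor_carr[OF Pm_unstable shift_carr[OF p] z])
  moreover have "Sqp n ?y \<in> carr (Pm (2 * n)) (n + n)" by (rule Sqp_carr[OF y])
  ultimately show ?thesis
    using F_mor_carr[OF Pm_unstable p sz]
    by (simp add: kappa_eval[OF p sz] kappa_eval[OF shift_carr[OF p] z] coeff0_def lookup_square_0)
qed

subsection \<open>The Mahowald sequence\<close>

text \<open>
  \<open>ker0 n m\<close> is the kernel of the map from \<open>J(n)\<close> to \<open>J(n/2)\<close> dual to \<open>Sq\<^sub>0\<close> (all of \<open>J(n)\<close> if \<open>n\<close> is odd).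
  It is a suspension, and \<open>desusp n\<close> is its desuspension.
\<close>

definition ker0 :: "nat \<Rightarrow> nat \<Rightarrow> (unit trm set \<Rightarrow> bit) set" where
  "ker0 n m = {f \<in> carr (J n) m. \<forall>k z. 2 * k = n \<longrightarrow> z \<in> carr (F m) k \<longrightarrow> f (sq (F m) k k z) = 0}"

definition desusp :: "nat \<Rightarrow> (unit trm set \<Rightarrow> bit) gmod" where
  "desusp n = \<lparr>carr = (\<lambda>m. ker0 n (Suc m)), zer = (\<lambda>m. zer (J n) (Suc m)),
     add = (\<lambda>m. add (J n) (Suc m)), sq = (\<lambda>i m. sq (J n) i (Suc m))\<rparr>"

lemma desusp_simps:
  "carr (desusp n) m = ker0 n (Suc m)" "zer (desusp n) m = zer (J n) (Suc m)"
  "add (desusp n) m = add (J n) (Suc m)" "sq (desusp n) i m = sq (J n) i (Suc m)"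
  by (simp_all add: desusp_def)

lemma ker0_J: "f \<in> ker0 n m \<Longrightarrow> f \<in> carr (J n) m"
  by (simp add: ker0_def)

lemma J_vals:
  "z \<in> carr (F m) n \<Longrightarrow> zer (J n) m z = 0"
  "z \<in> carr (F m) n \<Longrightarrow> add (J n) m f g z = f z + g z"
  by (simp_all only: J_simps restrict_apply if_True)

lemma J_dual: "f \<in> carr (J n) m \<longleftrightarrow> f \<in> dual (F m) n"
  by (simp add: J_simps)

lemma sq_F_carr: "2 * k = n \<Longrightarrow> z \<in> carr (F m) k \<Longrightarrow> sq (F m) k k z \<in> carr (F m) n"
  using unstableD(3)[OF F_unstable, of z m k k] by (simp flip: mult_2)

lemma ker0_zer: "zer (J n) m \<in> ker0 n m"
  by (simp add: ker0_def unstableD[OF J_unstable] J_vals sq_F_carr)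

lemma ker0_add: "f \<in> ker0 n m \<Longrightarrow> g \<in> ker0 n m \<Longrightarrow> add (J n) m f g \<in> ker0 n m"
  by (simp add: ker0_def unstableD[OF J_unstable] J_vals sq_F_carr)

lemma sq_J_val:
  "z \<in> carr (F (m + i)) n \<Longrightarrow>
    sq (J n) i m f z = f (F_mor (F m) (m + i) (sq (F m) i m (iota m)) n z)"
  by (simp add: J_simps J_act_def)

lemmas sq_iota_mor = F_mor(1)[OF F_unstable unstableD(3)[OF F_unstable iota_carr]]

lemma ker0_sq: "f \<in> ker0 n m \<Longrightarrow> sq (J n) i m f \<in> ker0 n (m + i)"
  using mor_carr[OF sq_iota_mor]
  by (auto simp: ker0_def unstableD[OF J_unstable] sq_J_val sq_F_carr mult_2 mor_sq[OF sq_iota_mor])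

text \<open>The values of Sq_0 are closed under sums because Sq_0 is additive, and closed under all
  Sq^i up to zero by \<open>sq_Sq0_even\<close> and \<open>sq_Sq0_odd\<close>.\<close>

lemma Sq0_image:
  assumes "w \<in> carr (F (m + m)) k"
  defines "v \<equiv> F_mor (F m) (m + m) (sq (F m) m m (iota m)) k w"
  shows "v = zer (F m) k \<or> (\<exists>j. \<exists>y\<in>carr (F m) j. j + j = k \<and> v = sq (F m) j j y)"
  using assms(1) unfolding v_def
proof (induction rule: F_induct)
  case iota
  then show ?case using F_mor(2)[OF F_unstable unstableD(3)[OF F_unstable iota_carr]] iota_carr by metis
next
  case (zer k)
  then show ?case using mor_zer[OF sq_iota_mor F_unstable F_unstable] by blast
next
  case (add k x y)
  note e = mor_add[OF sq_iota_mor[of m m] add.hyps] mor_carr[OF sq_iota_mor[of m m] add.hyps(1)]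
    mor_carr[OF sq_iota_mor[of m m] add.hyps(2)]
  let ?v = "F_mor (F m) (m + m) (sq (F m) m m (iota m)) k"
  show ?case
  proof (cases "?v x = zer (F m) k \<or> ?v y = zer (F m) k")
    case True
    then show ?thesis
      using add.IH e unstable_vec(3)[OF F_unstable] unstable_add_zer[OF F_unstable] by metis
  next
    case False
    then obtain j i a b where j: "a \<in> carr (F m) j" "j + j = k" "?v x = sq (F m) j j a"
      "b \<in> carr (F m) i" "i + i = k" "?v y = sq (F m) i i b"
      using add.IH by metis
    then have "i = j" by simp
    with j have "?v (add (F (m + m)) k x y) = sq (F m) j j (add (F m) j a b)"
      using e(1) unstable_sq_add[OF F_unstable] by metis
    then show ?thesis using unstableD(2)[OF F_unstable] j \<open>i = j\<close> by metis
  qed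
next
  case (sq i k x)
  note e = mor_sq[OF sq_iota_mor[of m m] sq.hyps]
  let ?v = "F_mor (F m) (m + m) (sq (F m) m m (iota m)) k"
  show ?case
  proof (cases "?v x = zer (F m) k")
    case True
    then show ?thesis using e unstable_sq_zer[OF F_unstable] by metis
  next
    case False
    then obtain j a where j: "a \<in> carr (F m) j" "j + j = k" "?v x = sq (F m) j j a"
      using sq.IH by metis
    show ?thesis
    proof (cases "even i")
      case True
      then obtain c where i: "i = 2 * c" by (rule evenE)
      have "sq (F m) i k (?v x) = sq (F m) (j + c) (j + c) (sq (F m) c j a)"
        using sq_Sq0_even[OF F_unstable j(1), of c] by (simp add: i j)
      moreover have "sq (F m) c j a \<in> carr (F m) (j + c)" by (rule unstableD(3)[OF F_unstable j(1)])
      moreover have "j + c + (j + c) = k + i" using i j(2) by simp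
      ultimately show ?thesis using e by metis
    next
      case False
      then obtain c where i: "i = 2 * c + 1" by (rule oddE)
      have "sq (F m) i k (?v x) = zer (F m) (k + i)"
        unfolding i j(3) by (rule sq_Sq0_odd[OF F_unstable j(1), unfolded j(2)])
      then show ?thesis using e by metis
    qed
  qed
qed

text \<open>Vanishing of Sq_0 is exactly what instability demands after lowering degrees by one, so
  this makes \<open>desusp\<close> unstable.\<close>

lemma ker0_Sq0:
  assumes f: "f \<in> ker0 n m" shows "sq (J n) m m f = zer (J n) (m + m)"
proof (rule J_eqI)
  fix z assume z: "z \<in> carr (F (m + m)) n"
  have "f (zer (F m) n) = 0" using dual_zer[OF _ F_unstable] ker0_J[OF f] by (simp add: J_dual)
  moreover have "f (sq (F m) j j y) = 0" if "y \<in> carr (F m) j" "j + j = n" for j y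
    using f that by (simp add: ker0_def mult_2)
  ultimately show "sq (J n) m m f z = zer (J n) (m + m) z"
    using Sq0_image[OF z] by (auto simp: sq_J_val[OF z] J_vals[OF z])
qed (simp_all add: unstableD[OF J_unstable] ker0_J[OF f])

lemma gsum_desusp: "gsum (desusp n) m xs = gsum (J n) (Suc m) xs"
  by (induction xs) (simp_all add: desusp_simps)

lemma desusp_unstable: "unstable_module (desusp n)"
proof -
  note JU = J_unstable[of n]
  have "closed_gmod (desusp n)"
    using ker0_sq by (simp add: closed_gmod_def desusp_simps ker0_zer ker0_add)
      (metis add_Suc)
  moreover have "vec_ids (desusp n) \<subseteq> Id"
    unfolding vec_ids_iff desusp_simps using unstable_vec[OF JU] ker0_J by metis
  moreover have "sq_additive_ids (desusp n) \<subseteq> Id"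
    unfolding sq_additive_ids_iff desusp_simps using unstable_sq_add[OF JU] ker0_J by (metis add_Suc)
  moreover have "steenrod_ids (desusp n) \<subseteq> Id"
    unfolding steenrod_ids_iff desusp_simps gsum_desusp add_Suc[symmetric]
    using unstable_sq0[OF JU] unstable_adem[OF JU] ker0_J by blast
  moreover have "instability_ids (desusp n) \<subseteq> Id"
    unfolding instability_ids_iff desusp_simps
  proof (intro allI ballI impI)
    fix i m f assume f: "f \<in> ker0 n (Suc m)" and "m < i"
    then show "sq (J n) i (Suc m) f = zer (J n) (Suc (m + i))"
      using ker0_Sq0[OF f] unstable_vanish[OF JU ker0_J[OF f], of i] by (cases "i = Suc m") auto
  qed
  ultimately show ?thesis by (simp add: unstable_module_def unstable_ids_def)
qed

text \<open>Degree n of the desuspension consists of elements of degree n + 1 of J(n+1), which can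
  be evaluated at the generator of F(n+1). The resulting morphism is inverse to the desuspension of
  the map from the suspension of J(n) onto the kernel in J(n+1).\<close>

definition omega :: "nat \<Rightarrow> nat \<Rightarrow> (unit trm set \<Rightarrow> bit) \<Rightarrow> unit trm set \<Rightarrow> bit" where
  "omega n = J_mor (desusp (Suc n)) n (\<lambda>f\<in>carr (desusp (Suc n)) n. f (iota (Suc n)))"

lemma omega_dual: "(\<lambda>f\<in>carr (desusp (Suc n)) n. f (iota (Suc n))) \<in> dual (desusp (Suc n)) n"
  by (rule dualI)
    (simp_all only: unstableD[OF desusp_unstable] restrict_apply if_True if_False,
     simp only: desusp_simps J_vals iota_carr)

lemma omega_mor: "omega n \<in> mor (desusp (Suc n)) (J n)"
  unfolding omega_def by (rule J_mor_mor[OF desusp_unstable omega_dual])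

text \<open>If z is theta applied to the generator of F(m+1), then w is theta applied to the
  generator of F(m): the desuspension keeps the operations and only renumbers degrees. The choice of
  w is uniform in \<open>f\<close>.\<close>

lemma desusp_action:
  assumes "z \<in> carr (F (Suc m)) (Suc k)"
  shows "\<exists>w\<in>carr (F m) k. \<forall>f\<in>ker0 n (Suc m).
    F_mor (desusp n) m f k w = F_mor (J n) (Suc m) f (Suc k) z"
proof -
  \<comment> \<open>The induction runs over all degrees of F(m+1), so the predecessor is quantified
    inside \<open>Q\<close>; in degree 0 nothing is claimed.\<close>
  define Q where "Q = (\<lambda>k' z. \<forall>k. k' = Suc k \<longrightarrow> (\<exists>w\<in>carr (F m) k. \<forall>f\<in>ker0 n (Suc m).
    F_mor (desusp n) m f k w = F_mor (J n) (Suc m) f (Suc k) z))"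
  have D: "f \<in> carr (desusp n) m" "f \<in> carr (J n) (Suc m)" if "f \<in> ker0 n (Suc m)" for f
    using that by (simp_all add: desusp_simps ker0_J)
  note FD = F_mor[OF desusp_unstable D(1)] and FJ = F_mor[OF J_unstable D(2)]
  from assms have "Q (Suc k) z"
  proof (induction rule: F_induct)
    case iota
    show ?case unfolding Q_def using FD(2) FJ(2) iota_carr by (metis nat.inject)
  next
    case (zer k)
    show ?case unfolding Q_def
      using mor_zer[OF FD(1) F_unstable desusp_unstable, unfolded desusp_simps]
        mor_zer[OF FJ(1) F_unstable J_unstable] unstableD(1)[OF F_unstable] by metis
  next
    case (add k' x y)
    show ?case unfolding Q_def
    proof (intro allI impI)
      fix k assume k: "k' = Suc k"
      obtain v w where vw: "v \<in> carr (F m) k" "w \<in> carr (F m) k"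
        "\<And>f. f \<in> ker0 n (Suc m) \<Longrightarrow> F_mor (desusp n) m f k v = F_mor (J n) (Suc m) f (Suc k) x"
        "\<And>f. f \<in> ker0 n (Suc m) \<Longrightarrow> F_mor (desusp n) m f k w = F_mor (J n) (Suc m) f (Suc k) y"
        using add.IH k unfolding Q_def by metis
      show "\<exists>w\<in>carr (F m) k. \<forall>f\<in>ker0 n (Suc m). F_mor (desusp n) m f k w =
          F_mor (J n) (Suc m) f (Suc k) (add (F (Suc m)) k' x y)"
        using add.hyps vw unstableD(2)[OF F_unstable vw(1,2)]
        by (intro bexI[of _ "add (F m) k v w"])
          (simp_all add: k mor_add[OF FD(1)] mor_add[OF FJ(1)] desusp_simps)
    qed
  next
    case (sq i k' x)
    show ?case unfolding Q_def
    proof (intro allI impI)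
      fix k assume k: "k' + i = Suc k"
      show "\<exists>w\<in>carr (F m) k. \<forall>f\<in>ker0 n (Suc m). F_mor (desusp n) m f k w =
          F_mor (J n) (Suc m) f (Suc k) (sq (F (Suc m)) i k' x)"
      proof (cases k')
        case 0
        then have "x = zer (F (Suc m)) 0" using F_low_degrees[OF sq.hyps] by simp
        then have "sq (F (Suc m)) i k' x = zer (F (Suc m)) (Suc k)"
          using unstable_sq_zer[OF F_unstable, of "Suc m" i 0] k 0 by simp
        then show ?thesis
          using mor_zer[OF FD(1) F_unstable desusp_unstable, unfolded desusp_simps]
            mor_zer[OF FJ(1) F_unstable J_unstable] unstableD(1)[OF F_unstable] by metis
      next
        case (Suc l)
        then have k': "k = l + i" using k by simp
        obtain w where w: "w \<in> carr (F m) l"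
          "\<And>f. f \<in> ker0 n (Suc m) \<Longrightarrow> F_mor (desusp n) m f l w = F_mor (J n) (Suc m) f (Suc l) x"
          using sq.IH Suc unfolding Q_def by metis
        have "F_mor (desusp n) m f k (sq (F m) i l w) =
            F_mor (J n) (Suc m) f (Suc k) (sq (F (Suc m)) i k' x)" if f: "f \<in> ker0 n (Suc m)" for f
          using mor_sq[OF FD(1)[OF f] w(1), of i] mor_sq[OF FJ(1)[OF f] sq.hyps, of i] w(2)[OF f]
          by (simp add: k' Suc desusp_simps)
        then show ?thesis using unstableD(3)[OF F_unstable w(1)] unfolding k' by metis
      qed
    qed
  qed
  then show ?thesis unfolding Q_def by blast
qed

text \<open>An element f is known from the values of theta f at the generator. By
  \<open>desusp_action\<close> each such theta also acts on the desuspension, where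
  \<open>omega\<close> records the same value.\<close>

lemma omega_injective:
  assumes f: "f \<in> ker0 (Suc n) (Suc m)" and 0: "omega n m f = zer (J n) m"
  shows "f = zer (J (Suc n)) (Suc m)"
proof (rule J_eqI[OF ker0_J[OF f] unstableD(1)[OF J_unstable]])
  fix z assume z: "z \<in> carr (F (Suc m)) (Suc n)"
  obtain w where w: "w \<in> carr (F m) n"
    "F_mor (desusp (Suc n)) m f n w = F_mor (J (Suc n)) (Suc m) f (Suc n) z"
    using desusp_action[OF z, of "Suc n"] f by blast
  have f': "f \<in> carr (desusp (Suc n)) m" using f by (simp add: desusp_simps)
  have "f z = F_mor (J (Suc n)) (Suc m) f (Suc n) z (iota (Suc n))"
    using F_mor_J_iota[OF ker0_J[OF f] z] by simp
  also have "\<dots> = omega n m f w"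
    using w f' F_mor_carr[OF desusp_unstable f' w(1)] by (simp add: omega_def J_mor_def)
  also have "\<dots> = 0" by (simp add: 0 J_vals w(1))
  finally show "f z = zer (J (Suc n)) (Suc m) z" using z by (simp add: J_vals)
qed

lemma var0_mult_carr: "p \<in> carr (Pm n) m \<Longrightarrow> var 0 * p \<in> carr (Pm (Suc n)) (Suc m)"
  using Pm_mult[OF Pm_var[of 1 0]] by fastforce

lemma lookup_var0_mult: "lookup (var 0 * p) (replicate_mset (Suc n) 0) = lookup p (replicate_mset n 0)"
proof (induction p rule: poly2_induct)
  case (add M p)
  have "lookup (var 0 * mon M) (replicate_mset (Suc n) 0) = lookup (mon M) (replicate_mset n 0)"
    by (simp add: lookup_single when_def flip: mon_add_mset)
  then show ?case unfolding distrib_left lookup_add add.IH by simp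
qed simp

lemma kappa_ker0:
  assumes p: "p \<in> carr (Pm n) m" and "shift p = 0"
  shows "kappa n m p \<in> ker0 n m"
  unfolding ker0_def
proof (intro CollectI conjI allI impI)
  show "kappa n m p \<in> carr (J n) m" by (rule kappa_carr[OF p])
  fix k z assume "2 * k = n" and z: "z \<in> carr (F m) k"
  with p show "kappa n m p (sq (F m) k k z) = 0"
    using kappa_Sq0[of p k m z] assms(2) by (auto simp: kappa_zer J_vals)
qed

lemma kappa_var0_mult:
  "p \<in> carr (Pm n) m \<Longrightarrow> kappa (Suc n) (Suc m) (var 0 * p) \<in> ker0 (Suc n) (Suc m)"
  by (rule kappa_ker0) (simp_all add: var0_mult_carr shift_simps)

text \<open>Multiplication by x_0 commutes with the operations since Sq^1 x_0 = 0. Both sides are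
  thus morphisms into J(n), and their functionals agree: the coefficient of x_0^(n+1) in x_0 p is
  that of x_0^n in p.\<close>

lemma omega_kappa:
  assumes p: "p \<in> carr (Pm n) m"
  shows "omega n m (kappa (Suc n) (Suc m) (var 0 * p)) = kappa n m p"
proof -
  let ?g = "\<lambda>m. \<lambda>p\<in>carr (Pm n) m. kappa (Suc n) (Suc m) (var 0 * p)"
  have g: "?g \<in> mor (Pm n) (desusp (Suc n))"
  proof (rule morI)
    fix m p q assume "p \<in> carr (Pm n) m" "q \<in> carr (Pm n) m"
    then show "?g m (add (Pm n) m p q) = add (desusp (Suc n)) m (?g m p) (?g m q)"
      by (simp add: Pm_add desusp_simps distrib_left kappa_add var0_mult_carr)
  next
    fix i m p assume p: "p \<in> carr (Pm n) m"
    then show "?g (m + i) (sq (Pm n) i m p) = sq (desusp (Suc n)) i m (?g m p)"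
      using kappa_sq[OF var0_mult_carr[OF p], of i] by (simp add: Sqp_carr desusp_simps Sqp_var0_mult)
  qed (simp_all add: desusp_simps kappa_var0_mult)
  have "(\<lambda>m. \<lambda>p\<in>carr (Pm n) m. omega n m (?g m p)) = kappa n"
  proof (rule mor_J_eqI[OF Pm_unstable mor_comp[OF g omega_mor unstable_closed[OF Pm_unstable]] kappa_mor])
    fix p assume p: "p \<in> carr (Pm n) n"
    have "kappa (Suc n) (Suc n) (var 0 * p) \<in> carr (desusp (Suc n)) n"
      using kappa_var0_mult[OF p] by (simp add: desusp_simps)
    then show "(\<lambda>p\<in>carr (Pm n) n. omega n n (?g n p)) p (iota n) = kappa n n p (iota n)"
      using p by (simp add: omega_def J_mor_iota[OF desusp_unstable] kappa_iota var0_mult_carr lookup_var0_mult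
          del: replicate_mset_Suc)
  qed
  from fun_cong[OF fun_cong[OF this, of m], of p] show ?thesis using p by simp
qed

lemma dual_Sq0:
  assumes f: "f \<in> carr (J (2 * k)) m"
  shows "(\<lambda>z\<in>carr (F m) k. f (sq (F m) k k z)) \<in> carr (J k) m"
  unfolding J_dual
proof (rule dualI)
  fix x y assume "x \<in> carr (F m) k" "y \<in> carr (F m) k"
  moreover have "f \<in> dual (F m) (2 * k)" using f by (simp add: J_dual)
  ultimately show "(\<lambda>z\<in>carr (F m) k. f (sq (F m) k k z)) (add (F m) k x y) =
    (\<lambda>z\<in>carr (F m) k. f (sq (F m) k k z)) x + (\<lambda>z\<in>carr (F m) k. f (sq (F m) k k z)) y"
    using dualD(2)[of f "F m" "2 * k"] sq_F_carr[of k "2 * k"]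
    by (simp add: unstableD[OF F_unstable] unstable_sq_add[OF F_unstable] mult_2 del: add_bit_eq_xor)
qed simp

text \<open>The inductive step lowers n and m by one, so it starts from these cases. For n = m = 0
  both sides have dimension one, and otherwise both vanish.\<close>

lemma kappa_bij_zero:
  assumes "n = 0 \<or> m = 0"
  shows "(\<forall>p\<in>carr (Pm n) m. kappa n m p = zer (J n) m \<longrightarrow> p = 0) \<and>
    (\<forall>f\<in>carr (J n) m. \<exists>p\<in>carr (Pm n) m. kappa n m p = f)"
proof (cases "n = m")
  case True
  with assms have [simp]: "n = 0" "m = 0" by auto
  have P: "p = 0 \<or> p = 1" if "p \<in> carr (Pm 0) 0" for p
    using that
  proof (induction p rule: Pm_induct)
    case (add M p)
    then have "M = {#}" by simp
    then show ?case using add poly2_char by auto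
  qed simp
  have k: "kappa 0 0 1 (iota 0) = 1" using kappa_iota[of 1 0] by simp
  then have "kappa 0 0 1 \<noteq> zer (J 0) 0" using J_vals(1)[OF iota_carr[of 0]] by force
  moreover have "f = zer (J 0) 0 \<or> f = kappa 0 0 1" if f: "f \<in> carr (J 0) 0" for f
  proof -
    have "f = g" if g: "g \<in> carr (J 0) 0" and "f (iota 0) = g (iota 0)" for g
    proof (rule J_eqI[OF f g])
      fix z assume "z \<in> carr (F 0) 0"
      then show "f z = g z"
        using F_low_degrees[of z 0 0] that dual_zer[of f "F 0" 0] dual_zer[of g "F 0" 0] F_unstable f g
        by (auto simp: J_dual)
    qed
    from this[of "zer (J 0) 0"] this[of "kappa 0 0 1"] show ?thesis
      using unstableD(1)[OF J_unstable] kappa_carr[of 1 0 0] k J_vals(1)[OF iota_carr[of 0]]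
      by (cases "f (iota 0)") simp_all
  qed
  ultimately show ?thesis using P Pm_one Pm_zero[of 0 0] kappa_zer[of 0 0] by (simp, metis)
next
  case False
  have "p = 0" if "p \<in> carr (Pm n) m" for p
    using that
  proof (induction p rule: Pm_induct)
    case (add M p)
    have "M \<noteq> {#}" using add False by auto
    then obtain i N where "M = add_mset i N" by (meson multiset_cases)
    then show ?case using add assms by auto
  qed simp
  moreover have "f = zer (J n) m" if f: "f \<in> carr (J n) m" for f
  proof (rule J_eqI[OF f unstableD(1)[OF J_unstable]])
    fix z assume z: "z \<in> carr (F m) n"
    then have "z = zer (F m) n" using F_low_degrees[OF z] assms False by auto
    then show "f z = zer (J n) m z" using z dual_zer[OF _ F_unstable] f J_vals(1) by (metis J_dual)
  qed
  ultimately show ?thesis using kappa_zer[of n m] Pm_zero by metis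
qed

lemma J_add_cancel:
  assumes "f \<in> carr (J n) m" "g \<in> carr (J n) m"
  shows "add (J n) m (add (J n) m f g) g = f"
  using unstable_vec(1,4)[OF J_unstable] unstable_add_zer[OF J_unstable] assms by metis

text \<open>For injectivity the case n/2 gives shift p = 0, so p = x_0 q, and the case n - 1 gives q
  = 0. For surjectivity an element is first moved into \<open>ker0\<close> by a lift along the
  shift, and the remainder is reached by a multiple of x_0.\<close>

lemma kappa_bij_aux:
  "(\<forall>p\<in>carr (Pm n) m. kappa n m p = zer (J n) m \<longrightarrow> p = 0) \<and>
    (\<forall>f\<in>carr (J n) m. \<exists>p\<in>carr (Pm n) m. kappa n m p = f)"
proof (induction n arbitrary: m rule: less_induct)
  case (less n)
  show ?case
  proof (cases "n = 0 \<or> m = 0")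
    case True
    then show ?thesis by (rule kappa_bij_zero)
  next
    case False
    then obtain n' m' where [simp]: "n = Suc n'" "m = Suc m'" by (metis not0_implies_Suc)
    have half: "shift p = 0" if p: "p \<in> carr (Pm n) m" and 0: "kappa n m p = zer (J n) m" for p
    proof (cases "even n")
      case True
      then obtain k where k: "n = 2 * k" by (rule evenE)
      have sp: "shift p \<in> carr (Pm k) m" using p k by (intro shift_carr) metis
      have "kappa k m (shift p) = zer (J k) m"
      proof (rule J_eqI[OF kappa_carr[OF sp] unstableD(1)[OF J_unstable]])
        fix z assume z: "z \<in> carr (F m) k"
        have "kappa k m (shift p) z = kappa n m p (sq (F m) k k z)"
          using kappa_Sq0[of p k m z] p z unfolding k by simp
        moreover have "sq (F m) k k z \<in> carr (F m) n" using k z by (intro sq_F_carr) simp_all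
        ultimately show "kappa k m (shift p) z = zer (J k) m z" using z by (simp only: 0 J_vals)
      qed
      moreover have "k < n" using k by simp
      ultimately show ?thesis using less.IH sp by blast
    qed (use shift_odd[OF p] in simp)
    have "p = 0" if p: "p \<in> carr (Pm n) m" and 0: "kappa n m p = zer (J n) m" for p
    proof -
      obtain q where q: "q \<in> carr (Pm n') m'" "p = unshift (shift p) + var 0 * q"
        using shift_decomp[of p n' m'] p by auto
      then have pq: "p = var 0 * q" using half[OF p 0] by (simp add: unshift_simps)
      have "kappa n' m' q = omega n' m' (zer (J (Suc n')) (Suc m'))"
        using omega_kappa[OF q(1)] 0 pq by simp
      also have "\<dots> = zer (J n') m'"
        using mor_zer[OF omega_mor desusp_unstable J_unstable] by (simp add: desusp_simps)
      finally have "q = 0" using less.IH[of n' m'] q(1) by simp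
      then show ?thesis using pq by simp
    qed
    moreover have "\<exists>p\<in>carr (Pm n) m. kappa n m p = f" if f: "f \<in> carr (J n) m" for f
    proof -
      obtain p where p: "p \<in> carr (Pm n) m" "add (J n) m f (kappa n m p) \<in> ker0 n m"
      proof (cases "even n")
        case True
        then obtain k where k: "n = 2 * k" by (rule evenE)
        \<comment> \<open>\<open>?r\<close> is the image of f under the dual of Sq_0. A polynomial
          preimage with raised indices has the same image, so subtracting it leaves an element of
          the kernel.\<close>
        let ?r = "\<lambda>z\<in>carr (F m) k. f (sq (F m) k k z)"
        have "?r \<in> carr (J k) m" using f k by (intro dual_Sq0) metis
        moreover have "k < n" using k by simp
        ultimately obtain s where s: "s \<in> carr (Pm k) m" "kappa k m s = ?r" using less.IH by blast
        have u: "unshift s \<in> carr (Pm n) m" using unshift_carr[OF s(1)] k by metis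
        moreover have "add (J n) m f (kappa n m (unshift s)) \<in> ker0 n m"
          unfolding ker0_def
        proof (intro CollectI conjI allI impI)
          show "add (J n) m f (kappa n m (unshift s)) \<in> carr (J n) m"
            by (rule unstableD(2)[OF J_unstable f kappa_carr[OF u]])
          fix l z assume "2 * l = n" and z: "z \<in> carr (F m) l"
          then have [simp]: "l = k" using k by simp
          have "kappa n m (unshift s) (sq (F m) k k z) = kappa k m s z"
            using kappa_Sq0[of "unshift s" k m z] u z unfolding k shift_unshift by simp
          also have "\<dots> = f (sq (F m) k k z)" using s(2) z by simp
          finally have "f (sq (F m) l l z) + kappa n m (unshift s) (sq (F m) l l z) = 0"
            by (simp only: \<open>l = k\<close> bit_double)
          moreover have "sq (F m) l l z \<in> carr (F m) n"
            using \<open>2 * l = n\<close> z by (rule sq_F_carr)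
          ultimately show "add (J n) m f (kappa n m (unshift s)) (sq (F m) l l z) = 0"
            by (simp only: J_vals)
        qed
        ultimately show thesis by (rule that)
      next
        case False
        \<comment> \<open>For odd n the condition in \<open>ker0\<close> is empty, so the zero
          polynomial serves as correction.\<close>
        have ne: "2 * k \<noteq> n" for k using False by (metis dvd_triv_left)
        have "add (J n) m f (kappa n m 0) \<in> ker0 n m"
          using ne f by (simp add: ker0_def kappa_zer unstable_add_zer[OF J_unstable])
        then show thesis by (rule that[rotated]) simp
      qed
      let ?f = "add (J n) m f (kappa n m p)"
      have "omega n' m' ?f \<in> carr (J n') m'"
        using mor_carr[OF omega_mor] p(2) by (simp add: desusp_simps)
      then obtain q where q: "q \<in> carr (Pm n') m'" "kappa n' m' q = omega n' m' ?f"
        using less.IH[of n' m'] by auto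
      have xq: "kappa n m (var 0 * q) \<in> ker0 n m" "var 0 * q \<in> carr (Pm n) m"
        using kappa_var0_mult[OF q(1)] var0_mult_carr[OF q(1)] by simp_all
      \<comment> \<open>The multiple of x_0 was chosen with the same value under
        \<open>omega\<close> as the remainder, so injectivity of \<open>omega\<close> identifies the
        two.\<close>
      have "omega n' m' (add (J n) m ?f (kappa n m (var 0 * q))) = zer (J n') m'"
      proof -
        have "omega n' m' (add (J n) m ?f (kappa n m (var 0 * q))) =
            add (J n') m' (omega n' m' ?f) (omega n' m' (kappa n m (var 0 * q)))"
          using mor_add[OF omega_mor, of ?f n' m' "kappa n m (var 0 * q)"] p(2) xq(1)
          by (simp add: desusp_simps)
        also have "omega n' m' (kappa n m (var 0 * q)) = omega n' m' ?f"
          using omega_kappa[OF q(1)] q(2) by simp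
        finally show ?thesis
          using unstable_vec(4)[OF J_unstable \<open>omega n' m' ?f \<in> carr (J n') m'\<close>] by simp
      qed
      then have "add (J n) m ?f (kappa n m (var 0 * q)) = zer (J n) m"
        using omega_injective ker0_add[OF p(2) xq(1)] by simp
      then have "?f = kappa n m (var 0 * q)"
        using J_add_cancel[OF ker0_J[OF p(2)] ker0_J[OF xq(1)]]
          unstable_vec(3)[OF J_unstable ker0_J[OF xq(1)]] by simp
      then have "kappa n m (var 0 * q + p) = f"
        using J_add_cancel[OF f kappa_carr[OF p(1)]] kappa_add[OF xq(2) p(1)] by simp
      then show ?thesis using Pm_add[OF xq(2) p(1)] by blast
    qed
    ultimately show ?thesis by blast
  qed
qed

theorem kappa_bij: "bij_betw (kappa n m) (carr (Pm n) m) (carr (J n) m)"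
proof (rule bij_betw_imageI)
  show "inj_on (kappa n m) (carr (Pm n) m)"
  proof (rule inj_onI)
    fix p q assume pq: "p \<in> carr (Pm n) m" "q \<in> carr (Pm n) m" "kappa n m p = kappa n m q"
    then have "kappa n m (p + q) = zer (J n) m"
      using kappa_add unstable_vec(4)[OF J_unstable kappa_carr] by simp
    then have "p + q = 0" using kappa_bij_aux Pm_add pq by blast
    then have "p + (p + q) = p" by simp
    then show "p = q" by (simp add: poly2_add_left)
  qed
  show "kappa n m ` carr (Pm n) m = carr (J n) m"
    using kappa_carr[of _ n m] kappa_bij_aux[of n m] by fast
qed

subsection \<open>The inverse of the comparison map\<close>

definition kinv :: "nat \<Rightarrow> nat \<Rightarrow> (unit trm set \<Rightarrow> bit) \<Rightarrow> poly2" where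
  "kinv n m = inv_into (carr (Pm n) m) (kappa n m)"

lemma kinv_carr: "f \<in> carr (J n) m \<Longrightarrow> kinv n m f \<in> carr (Pm n) m"
  and kappa_kinv: "f \<in> carr (J n) m \<Longrightarrow> kappa n m (kinv n m f) = f"
  using bij_betw_imp_surj_on[OF kappa_bij[of n m]]
  by (simp_all add: kinv_def inv_into_into f_inv_into_f)

lemma kinv_kappa: "p \<in> carr (Pm n) m \<Longrightarrow> kinv n m (kappa n m p) = p"
  using bij_betw_imp_inj_on[OF kappa_bij[of n m]] by (simp add: kinv_def inv_into_f_f)

lemma kinv_add:
  "f \<in> carr (J n) m \<Longrightarrow> g \<in> carr (J n) m \<Longrightarrow> kinv n m (add (J n) m f g) = kinv n m f + kinv n m g"
  using kinv_kappa[OF Pm_add[OF kinv_carr kinv_carr]] by (simp add: kappa_add kinv_carr kappa_kinv)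

lemma kinv_sq:
  "f \<in> carr (J n) m \<Longrightarrow> kinv n (m + i) (sq (J n) i m f) = Sqp i (kinv n m f)"
  using kinv_kappa[OF Sqp_carr[OF kinv_carr]] by (simp add: kappa_sq kinv_carr kappa_kinv)

lemma kappa_sum_list:
  "set ps \<subseteq> carr (Pm n) m \<Longrightarrow> kappa n m (sum_list ps) = gsum (J n) m (map (kappa n m) ps)"
proof (induction ps)
  case (Cons p ps)
  have "sum_list qs \<in> carr (Pm n) m" if "set qs \<subseteq> carr (Pm n) m" for qs
    using that by (induction qs) (simp_all add: Pm_add)
  with Cons show ?case by (simp add: kappa_add)
qed (simp add: kappa_zer)

subsection \<open>Maps out of a tensor product\<close>

lemma mod_terms_D:
  "Add s t \<in> mod_terms G \<Longrightarrow> s \<in> mod_terms G \<and> t \<in> mod_terms G \<and> tdeg s = tdeg t"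
  "Sq i t \<in> mod_terms G \<Longrightarrow> t \<in> mod_terms G"
  "Star s t \<notin> mod_terms G"
  "Gen n g \<in> mod_terms G \<Longrightarrow> g \<in> G n"
  by (auto elim: mod_terms.cases)

lemma closed_mod_terms: "closed_gmod (term_alg (mod_terms G))"
  by (auto simp: closed_gmod_def intro: mod_terms.intros)

lemma pure_tensor_terms:
  "x \<in> carr M m \<Longrightarrow> y \<in> carr N n \<Longrightarrow> pure m x n y \<in> tensor_terms M N"
  unfolding pure_def tensor_terms_def by (rule mod_terms.intros) simp

lemma tdeg_pure [simp]: "tdeg (pure m x n y) = m + n"
  by (simp add: pure_def)

lemma tensor_idsE:
  assumes "(s, t) \<in> tensor_ids M N"
  obtains "(s, t) \<in> unstable_ids (term_alg (tensor_terms M N))" |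
    m n x x' y where "x \<in> carr M m" "x' \<in> carr M m" "y \<in> carr N n"
      "s = pure m (add M m x x') n y" "t = Add (pure m x n y) (pure m x' n y)" |
    m n x y y' where "x \<in> carr M m" "y \<in> carr N n" "y' \<in> carr N n"
      "s = pure m x n (add N n y y')" "t = Add (pure m x n y) (pure m x n y')" |
    i m n x y where "x \<in> carr M m" "y \<in> carr N n" "s = Sq i (pure m x n y)"
      "t = gsum (term_alg (tensor_terms M N)) (m + n + i)
         (map (\<lambda>k. pure (m + k) (sq M k m x) (n + (i - k)) (sq N (i - k) n y)) [0..<Suc i])"
  using assms unfolding tensor_ids_def unstable_ids_def by blast

lemma cartan_pure_carr:
  assumes "unstable_module M" "unstable_module N" "x \<in> carr M m" "y \<in> carr N n"
  shows "set (map (\<lambda>k. pure (m + k) (sq M k m x) (n + (i - k)) (sq N (i - k) n y)) [0..<Suc i])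
    \<subseteq> {t \<in> tensor_terms M N. tdeg t = m + n + i}"
proof
  fix u assume "u \<in> set (map (\<lambda>k. pure (m + k) (sq M k m x) (n + (i - k)) (sq N (i - k) n y)) [0..<Suc i])"
  then obtain k where "k \<in> {0..<Suc i}"
    and u: "u = pure (m + k) (sq M k m x) (n + (i - k)) (sq N (i - k) n y)"
    unfolding set_map set_upt by blast
  then show "u \<in> {t \<in> tensor_terms M N. tdeg t = m + n + i}"
    using pure_tensor_terms[OF unstableD(3)[OF assms(1,3)] unstableD(3)[OF assms(2,4)], of k "i - k"]
    by simp
qed

lemma tensor_quotient:
  assumes M: "unstable_module M" and N: "unstable_module N"
  shows "term_quotient (tensor_terms M N) (tensor_ids M N)"
proof unfold_locales
  show c: "closed_gmod (term_alg (tensor_terms M N))"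
    unfolding tensor_terms_def by (rule closed_mod_terms)
  fix s t assume "(s, t) \<in> tensor_ids M N"
  then show "s \<in> tensor_terms M N \<and> t \<in> tensor_terms M N \<and> tdeg s = tdeg t"
  proof (cases rule: tensor_idsE)
    case 1
    then show ?thesis by (rule closed_ids[OF c])
  next
    case (4 i m n x y)
    have "t \<in> carr (term_alg (tensor_terms M N)) (m + n + i)"
      unfolding 4(4) using cartan_pure_carr[OF M N 4(1,2)]
      by (intro closed_gsum[OF c]) (auto simp del: upt_Suc)
    moreover have "s \<in> carr (term_alg (tensor_terms M N)) (m + n + i)"
      unfolding 4(3) using pure_tensor_terms[OF 4(1,2)] closed_gmodD(3)[OF c, of _ "m + n" i] by simp
    ultimately show ?thesis by simp
  qed (use c in \<open>auto simp: closed_gmod_def pure_tensor_terms unstableD[OF M] unstableD[OF N]\<close>)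
qed (auto simp: tensor_terms_def mod_terms_D(3) dest: mod_terms_D(1))

locale tensor_product =
  fixes M :: "('a, 'y) gmod_scheme" and N :: "('b, 'z) gmod_scheme"
  assumes M: "unstable_module M" and N: "unstable_module N"

sublocale tensor_product \<subseteq> tq: term_quotient "tensor_terms M N" "tensor_ids M N"
  using tensor_quotient[OF M N] .

context tensor_product
begin

abbreviation T :: "(nat \<times> 'a \<times> nat \<times> 'b) trm set gmod" where
  "T \<equiv> tensor M N"

lemma T_closed: "closed_gmod T"
  unfolding tensor_def by (rule tq.closed_Q)

lemma T_vec: "vec_ids T \<subseteq> Id"
  unfolding tensor_def by (rule tq.vec_Q) (auto simp: tensor_ids_def)

lemma T_sq_add: "sq_additive_ids T \<subseteq> Id"
  unfolding tensor_def by (rule tq.sq_additive_Q) (auto simp: tensor_ids_def)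

lemma T_double: "v \<in> carr T k \<Longrightarrow> add T k v v = zer T k"
  using T_vec unfolding vec_ids_iff by blast

lemma T_sq_zer: "sq T i k (zer T k) = zer T (k + i)"
proof -
  have z: "zer T k \<in> carr T k" by (rule closed_gmodD(1)[OF T_closed])
  have "sq T i k (zer T k) = sq T i k (add T k (zer T k) (zer T k))"
    by (simp only: T_double[OF z])
  also have "\<dots> = add T (k + i) (sq T i k (zer T k)) (sq T i k (zer T k))"
    using T_sq_add z unfolding sq_additive_ids_iff by blast
  also have "\<dots> = zer T (k + i)" by (rule T_double[OF closed_gmodD(3)[OF T_closed z]])
  finally show ?thesis .
qed

lemma tens_eq: "tens M N m x n y = tq.cl (pure m x n y)"
  by (simp add: tens_def)

lemma tens_carr: "x \<in> carr M m \<Longrightarrow> y \<in> carr N n \<Longrightarrow> tens M N m x n y \<in> carr T (m + n)"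
  unfolding tens_eq tensor_def by (rule tq.cl_carr) (simp_all add: pure_tensor_terms)

lemma tens_add:
  "x \<in> carr M m \<Longrightarrow> x' \<in> carr M m \<Longrightarrow> y \<in> carr N n \<Longrightarrow>
    tens M N m (add M m x x') n y = add T (m + n) (tens M N m x n y) (tens M N m x' n y)"
  "x \<in> carr M m \<Longrightarrow> y \<in> carr N n \<Longrightarrow> y' \<in> carr N n \<Longrightarrow>
    tens M N m x n (add N n y y') = add T (m + n) (tens M N m x n y) (tens M N m x n y')"
  unfolding tens_eq tensor_def
  by (simp_all only: tq.add_Q[OF pure_tensor_terms pure_tensor_terms] tdeg_pure)
    (rule tq.cl_eqI, rule congr.base, force simp: tensor_ids_def)+

lemma tens_zer:
  "y \<in> carr N n \<Longrightarrow> tens M N m (zer M m) n y = zer T (m + n)"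
  "x \<in> carr M m \<Longrightarrow> tens M N m x n (zer N n) = zer T (m + n)"
proof -
  show "tens M N m (zer M m) n y = zer T (m + n)" if y: "y \<in> carr N n"
    using tens_add(1)[OF unstableD(1)[OF M] unstableD(1)[OF M] y, of m]
      T_double[OF tens_carr[OF unstableD(1)[OF M] y], of m]
    by (simp only: unstable_vec(3)[OF M unstableD(1)[OF M]])
  show "tens M N m x n (zer N n) = zer T (m + n)" if x: "x \<in> carr M m"
    using tens_add(2)[OF x unstableD(1)[OF N] unstableD(1)[OF N], of n]
      T_double[OF tens_carr[OF x unstableD(1)[OF N]], of n]
    by (simp only: unstable_vec(3)[OF N unstableD(1)[OF N]])
qed

text \<open>The formal tensor product also contains terms \<open>Sq i t\<close>. That pure tensors
  nevertheless span it (\<open>tspan_all\<close>) allows morphisms to be tested on pure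
  tensors.\<close>

inductive_set tspan :: "nat \<Rightarrow> (nat \<times> 'a \<times> nat \<times> 'b) trm set set" for k where
  zer: "zer T k \<in> tspan k"
| tens: "x \<in> carr M m \<Longrightarrow> y \<in> carr N n \<Longrightarrow> m + n = k \<Longrightarrow> tens M N m x n y \<in> tspan k"
| add: "v \<in> tspan k \<Longrightarrow> w \<in> tspan k \<Longrightarrow> add T k v w \<in> tspan k"

lemma tspan_carr: "v \<in> tspan k \<Longrightarrow> v \<in> carr T k"
  by (induction rule: tspan.induct) (use closed_gmodD[OF T_closed] tens_carr in auto)

lemma tspan_gsum: "set vs \<subseteq> tspan k \<Longrightarrow> gsum T k vs \<in> tspan k"
  by (induction vs) (simp_all add: tspan.intros)

lemma tspan_sq: "v \<in> tspan k \<Longrightarrow> sq T i k v \<in> tspan (k + i)"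
proof (induction rule: tspan.induct)
  case zer
  show ?case by (simp add: T_sq_zer tspan.zer)
next
  case (tens x m y n)
  let ?l = "map (\<lambda>k. pure (m + k) (sq M k m x) (n + (i - k)) (sq N (i - k) n y)) [0..<Suc i]"
  note l = cartan_pure_carr[OF M N tens(1,2), of i]
  have "sq T i k (tens M N m x n y) = tq.cl (Sq i (pure m x n y))"
    unfolding tens_eq tensor_def by (rule tq.sq_Q[OF pure_tensor_terms[OF tens(1,2)]])
  also have "\<dots> = tq.cl (gsum (term_alg (tensor_terms M N)) (m + n + i) ?l)"
    by (rule tq.cl_eqI, rule congr.base) (use tens(1,2) in \<open>auto simp: tensor_ids_def simp del: upt_Suc\<close>)
  also have "\<dots> = gsum T (m + n + i) (map tq.cl ?l)"
    unfolding tensor_def by (rule tq.gsum_Q[OF l, symmetric])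
  also have "\<dots> \<in> tspan (m + n + i)"
  proof (rule tspan_gsum, rule subsetI)
    fix v assume "v \<in> set (map tq.cl ?l)"
    then obtain k where "k \<in> {0..<Suc i}"
      "v = tens M N (m + k) (sq M k m x) (n + (i - k)) (sq N (i - k) n y)"
      unfolding set_map set_upt tens_eq by blast
    then show "v \<in> tspan (m + n + i)"
      using tspan.tens[OF unstableD(3)[OF M tens(1), of k] unstableD(3)[OF N tens(2), of "i - k"],
          of "m + n + i"] by simp
  qed
  finally show ?case using tens(3) by simp
next
  case (add v w)
  have "sq T i k (add T k v w) = add T (k + i) (sq T i k v) (sq T i k w)"
    using T_sq_add tspan_carr[OF add.hyps(1)] tspan_carr[OF add.hyps(2)]
    unfolding sq_additive_ids_iff by blast
  then show ?case using add.IH by (simp add: tspan.add)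
qed

lemma tspan_all:
  assumes v: "v \<in> carr T k" shows "v \<in> tspan k"
proof -
  have "tq.cl t \<in> tspan (tdeg t)" if "t \<in> tensor_terms M N" for t
    using that
  proof (induction t)
    case (Gen d g)
    then obtain m x n y where g: "g = (m, x, n, y)" "m + n = d" "x \<in> carr M m" "y \<in> carr N n"
      unfolding tensor_terms_def using mod_terms_D(4) by fastforce
    then show ?case using tspan.tens[of x m y n d] by (simp add: tens_eq pure_def)
  next
    case (Zero d)
    then show ?case using tspan.zer[of d] by (simp add: tensor_def)
  next
    case (Add s t)
    then have "s \<in> tensor_terms M N" "t \<in> tensor_terms M N" "tdeg s = tdeg t"
      unfolding tensor_terms_def using mod_terms_D(1) by blast+
    then show ?case using tspan.add[of "tq.cl s" "tdeg s" "tq.cl t"] Add.IH by (simp add: tensor_def)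
  next
    case (Sq i t)
    then have "t \<in> tensor_terms M N"
      unfolding tensor_terms_def using mod_terms_D(2) by blast
    then show ?case using tspan_sq[of "tq.cl t" "tdeg t" i] Sq.IH by (simp add: tensor_def)
  next
    case (Star s t)
    then show ?case unfolding tensor_terms_def using mod_terms_D(3) by blast
  qed
  moreover obtain t where "t \<in> tensor_terms M N" "tdeg t = k" "v = tq.cl t"
    using v unfolding tensor_def by (meson tq.cl_E)
  ultimately show ?thesis by blast
qed

lemma tensor_lift:
  assumes K: "unstable_module K"
    and c: "\<And>m n x y. x \<in> carr M m \<Longrightarrow> y \<in> carr N n \<Longrightarrow> B m x n y \<in> carr K (m + n)"
    and l: "\<And>m n x x' y. x \<in> carr M m \<Longrightarrow> x' \<in> carr M m \<Longrightarrow> y \<in> carr N n \<Longrightarrow>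
      B m (add M m x x') n y = add K (m + n) (B m x n y) (B m x' n y)"
    and r: "\<And>m n x y y'. x \<in> carr M m \<Longrightarrow> y \<in> carr N n \<Longrightarrow> y' \<in> carr N n \<Longrightarrow>
      B m x n (add N n y y') = add K (m + n) (B m x n y) (B m x n y')"
    and s: "\<And>i m n x y. x \<in> carr M m \<Longrightarrow> y \<in> carr N n \<Longrightarrow> sq K i (m + n) (B m x n y) =
      gsum K (m + n + i)
        (map (\<lambda>k. B (m + k) (sq M k m x) (n + (i - k)) (sq N (i - k) n y)) [0..<Suc i])"
  shows "\<exists>f\<in>mor T K. \<forall>m n x y. x \<in> carr M m \<longrightarrow> y \<in> carr N n \<longrightarrow>
    f (m + n) (tens M N m x n y) = B m x n y"
proof -
  let ?h = "\<lambda>k (m, x, n, y). B m x n y"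
  have tc: "teval K undefined ?h t \<in> carr K (tdeg t)" if "t \<in> tensor_terms M N" for t
    using that unfolding tensor_terms_def
    by (induction rule: mod_terms.induct) (use c unstableD[OF K] in auto)
  interpret te: term_eval "tensor_terms M N" "tensor_ids M N" K undefined ?h
  proof unfold_locales
    fix s t assume "(s, t) \<in> tensor_ids M N"
    then show "teval K undefined ?h s = teval K undefined ?h t"
    proof (cases rule: tensor_idsE)
      case 1
      show ?thesis by (rule teval_unstable_ids[OF K tc 1])
    next
      case (4 i m n x y)
      let ?l = "map (\<lambda>k. pure (m + k) (sq M k m x) (n + (i - k)) (sq N (i - k) n y)) [0..<Suc i]"
      have "teval K undefined ?h t = gsum K (m + n + i) (map (teval K undefined ?h) ?l)"
        unfolding 4(4) using cartan_pure_carr[OF M N 4(1,2), of i] by (intro teval_gsum) blast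
      also have "map (teval K undefined ?h) ?l =
          map (\<lambda>k. B (m + k) (sq M k m x) (n + (i - k)) (sq N (i - k) n y)) [0..<Suc i]"
        by (simp only: map_map comp_def pure_def teval.simps prod.case)
      finally show ?thesis unfolding 4(3) by (simp only: s[OF 4(1,2)] pure_def teval.simps tdeg.simps prod.case)
    qed (simp_all add: pure_def l r)
  qed (rule tc)
  show ?thesis
    using te.qmap_mor te.qmap_cl[OF pure_tensor_terms]
    by (intro bexI[of _ te.qmap]) (simp_all add: tens_eq tensor_def, simp add: pure_def)
qed

end

subsection \<open>The external product\<close>

lemma mor_zer_vec:
  assumes f: "f \<in> mor M K" and M: "closed_gmod M" "vec_ids M \<subseteq> Id" and K: "unstable_module K"
  shows "f k (zer M k) = zer K k"
proof -
  have z: "zer M k \<in> carr M k" by (rule closed_gmodD(1)[OF M(1)])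
  then have "add M k (zer M k) (zer M k) = zer M k" using M(2) unfolding vec_ids_iff by blast
  then show ?thesis using mor_add[OF f z z] unstable_vec(4)[OF K mor_carr[OF f z]] by simp
qed

text \<open>\<open>M\<close> need not be unstable here, so that this applies to formal tensor products.\<close>

lemma mor_J_eqI_vec:
  assumes M: "closed_gmod M" "vec_ids M \<subseteq> Id" and f: "f \<in> mor M (J n)" and g: "g \<in> mor M (J n)"
    and eq: "\<And>x. x \<in> carr M n \<Longrightarrow> f n x (iota n) = g n x (iota n)"
  shows "f = g"
proof (rule mor_eqI[OF f g])
  fix m w assume w: "w \<in> carr M m"
  \<comment> \<open>A substitute for \<open>F_mor M m w d z\<close> when M is not known to be
    unstable: an element v that depends on z and w and that every morphism sends to the operation z
    on its value at w.\<close>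
  have *: "\<exists>v\<in>carr M d. \<forall>f\<in>mor M (J n). f d v = F_mor (J n) m (f m w) d z"
    if "z \<in> carr (F m) d" for d z
    using that
  proof (induction rule: F_induct)
    case iota
    show ?case using w F_mor(2)[OF J_unstable mor_carr] by metis
  next
    case (zer d)
    show ?case
      using mor_zer[OF F_mor(1)[OF J_unstable mor_carr[OF _ w]] F_unstable J_unstable]
        mor_zer_vec[OF _ M J_unstable] closed_gmodD(1)[OF M(1)] by metis
  next
    case (add d x y)
    obtain u where u: "u \<in> carr M d" "\<And>f. f \<in> mor M (J n) \<Longrightarrow> f d u = F_mor (J n) m (f m w) d x"
      using add.IH by blast
    obtain v where v: "v \<in> carr M d" "\<And>f. f \<in> mor M (J n) \<Longrightarrow> f d v = F_mor (J n) m (f m w) d y"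
      using add.IH by blast
    have "f d (add M d u v) = F_mor (J n) m (f m w) d (add (F m) d x y)" if f: "f \<in> mor M (J n)" for f
      using mor_add[OF f u(1) v(1)] mor_add[OF F_mor(1)[OF J_unstable mor_carr[OF f w]] add.hyps]
        u(2)[OF f] v(2)[OF f] by simp
    then show ?case using closed_gmodD(2)[OF M(1) u(1) v(1)] by blast
  next
    case (sq i d x)
    obtain u where u: "u \<in> carr M d" "\<And>f. f \<in> mor M (J n) \<Longrightarrow> f d u = F_mor (J n) m (f m w) d x"
      using sq.IH by blast
    have "f (d + i) (sq M i d u) = F_mor (J n) m (f m w) (d + i) (sq (F m) i d x)"
      if f: "f \<in> mor M (J n)" for f
      using mor_sq[OF f u(1)] mor_sq[OF F_mor(1)[OF J_unstable mor_carr[OF f w]] sq.hyps] u(2)[OF f]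
      by simp
    then show ?case using closed_gmodD(3)[OF M(1) u(1)] by blast
  qed
  show "f m w = g m w"
  proof (rule J_eqI[OF mor_carr[OF f w] mor_carr[OF g w]])
    fix z assume z: "z \<in> carr (F m) n"
    obtain v where v: "v \<in> carr M n" "\<And>f. f \<in> mor M (J n) \<Longrightarrow> f n v = F_mor (J n) m (f m w) n z"
      using *[OF z] by blast
    then have "F_mor (J n) m (f m w) n z (iota n) = F_mor (J n) m (g m w) n z (iota n)"
      using eq f g by metis
    then show "f m w z = g m w z"
      using F_mor_J_iota[OF mor_carr[OF f w] z] F_mor_J_iota[OF mor_carr[OF g w] z] by simp
  qed
qed

lemma J_high_degrees: "f \<in> carr (J n) m \<Longrightarrow> n < m \<Longrightarrow> f = zer (J n) m"
proof (rule J_eqI[OF _ unstableD(1)[OF J_unstable]])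
  fix z assume "f \<in> carr (J n) m" "n < m" and z: "z \<in> carr (F m) n"
  moreover from this have "z = zer (F m) n" using F_low_degrees[OF z] by simp
  ultimately show "f z = zer (J n) m z"
    using z dual_zer[OF _ F_unstable] J_vals(1) by (metis J_dual)
qed

lemma J_top_eqI:
  assumes "f \<in> carr (J n) n" "g \<in> carr (J n) n" "f (iota n) = g (iota n)"
  shows "f = g"
proof (rule J_eqI[OF assms(1,2)])
  fix z assume "z \<in> carr (F n) n"
  then have "z = zer (F n) n \<or> z = iota n" using F_low_degrees by blast
  then show "f z = g z"
    using assms dual_zer[of f "F n" n] dual_zer[of g "F n" n] F_unstable by (auto simp: J_dual)
qed

definition topJ :: "nat \<Rightarrow> unit trm set \<Rightarrow> bit" where
  "topJ n = kappa n n (mon (replicate_mset n 0))"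

lemma wt_replicate_0 [simp]: "wt (replicate_mset n 0) = n"
  by (induction n) simp_all

lemma topJ_carr: "topJ n \<in> carr (J n) n"
  unfolding topJ_def by (rule kappa_carr) simp

lemma topJ_iota: "topJ n (iota n) = 1"
  unfolding topJ_def by (subst kappa_iota) simp_all

lemma J_top: "f \<in> carr (J n) n \<Longrightarrow> f = zer (J n) n \<or> f = topJ n"
  using J_top_eqI[OF _ unstableD(1)[OF J_unstable], of f n] J_top_eqI[OF _ topJ_carr, of f n]
    J_vals(1)[OF iota_carr, of n] topJ_iota[of n]
  by (cases "f (iota n)") simp_all

interpretation JJ: tensor_product "J n" "J m" for n m
  by unfold_locales (rule J_unstable)+

text \<open>J(n) vanishes above degree n and is one-dimensional there, so degree n + m of the tensor
  product is spanned by the product of the two top classes. A morphism is therefore determined by a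
  single bit.\<close>

lemma mor_JJ_eqI:
  assumes f: "f \<in> mor (tensor (J n) (J m)) (J (n + m))" and g: "g \<in> mor (tensor (J n) (J m)) (J (n + m))"
    and eq: "f (n + m) (tens (J n) (J m) n (topJ n) m (topJ m)) (iota (n + m)) =
      g (n + m) (tens (J n) (J m) n (topJ n) m (topJ m)) (iota (n + m))"
  shows "f = g"
proof (rule mor_J_eqI_vec[OF JJ.T_closed JJ.T_vec f g])
  note z = mor_zer_vec[OF f JJ.T_closed JJ.T_vec J_unstable]
    mor_zer_vec[OF g JJ.T_closed JJ.T_vec J_unstable]
  fix v assume "v \<in> carr (tensor (J n) (J m)) (n + m)"
  then have "v \<in> JJ.tspan n m (n + m)" by (rule JJ.tspan_all)
  then show "f (n + m) v (iota (n + m)) = g (n + m) v (iota (n + m))"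
  proof (induction rule: JJ.tspan.induct)
    case zer
    show ?case by (simp only: z)
  next
    case (tens x i y j)
    consider "n < i" | "m < j" | "i = n" "j = m" using tens(3) by linarith
    then show ?case
    proof cases
      case 1
      then show ?thesis using J_high_degrees[OF tens(1)] JJ.tens_zer(1)[OF tens(2)] tens(3) z by metis
    next
      case 2
      then show ?thesis using J_high_degrees[OF tens(2)] JJ.tens_zer(2)[OF tens(1)] tens(3) z by metis
    next
      case 3
      then show ?thesis
        using J_top[of x n] J_top[of y m] tens JJ.tens_zer(1)[OF tens(2)] JJ.tens_zer(2)[OF tens(1)] z eq
        by metis
    qed
  next
    case (add v w)
    note vw = JJ.tspan_carr[OF add.hyps(1)] JJ.tspan_carr[OF add.hyps(2)]
    show ?case
      by (simp only: mor_add[OF f vw] mor_add[OF g vw] J_vals(2)[OF iota_carr] add.IH)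
  qed
qed

lemma mu_exists:
  "\<exists>f\<in>mor (tensor (J n) (J m)) (J (n + m)). \<forall>i j x y. x \<in> carr (J n) i \<longrightarrow> y \<in> carr (J m) j \<longrightarrow>
    f (i + j) (tens (J n) (J m) i x j y) = kappa (n + m) (i + j) (kinv n i x * kinv m j y)"
proof (rule JJ.tensor_lift[OF J_unstable])
  fix i j x y assume x: "x \<in> carr (J n) i" and y: "y \<in> carr (J m) j"
  note c = Pm_mult[OF kinv_carr kinv_carr]
  show "kappa (n + m) (i + j) (kinv n i x * kinv m j y) \<in> carr (J (n + m)) (i + j)"
    by (rule kappa_carr[OF c[OF x y]])
  fix x' assume x': "x' \<in> carr (J n) i"
  show "kappa (n + m) (i + j) (kinv n i (add (J n) i x x') * kinv m j y) =
    add (J (n + m)) (i + j) (kappa (n + m) (i + j) (kinv n i x * kinv m j y))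
      (kappa (n + m) (i + j) (kinv n i x' * kinv m j y))"
    by (simp only: kinv_add[OF x x'] distrib_right kappa_add[OF c[OF x y] c[OF x' y]])
next
  fix i j x y y' assume x: "x \<in> carr (J n) i" and y: "y \<in> carr (J m) j" and y': "y' \<in> carr (J m) j"
  note c = Pm_mult[OF kinv_carr kinv_carr]
  show "kappa (n + m) (i + j) (kinv n i x * kinv m j (add (J m) j y y')) =
    add (J (n + m)) (i + j) (kappa (n + m) (i + j) (kinv n i x * kinv m j y))
      (kappa (n + m) (i + j) (kinv n i x * kinv m j y'))"
    by (simp only: kinv_add[OF y y'] distrib_left kappa_add[OF c[OF x y] c[OF x y']])
next
  fix l i j x y assume x: "x \<in> carr (J n) i" and y: "y \<in> carr (J m) j"
  let ?p = "\<lambda>k. Sqp k (kinv n i x) * Sqp (l - k) (kinv m j y)"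
  have "sq (J (n + m)) l (i + j) (kappa (n + m) (i + j) (kinv n i x * kinv m j y)) =
      kappa (n + m) (i + j + l) (Sqp l (kinv n i x * kinv m j y))"
    by (rule kappa_sq[OF Pm_mult[OF kinv_carr[OF x] kinv_carr[OF y]], symmetric])
  also have "Sqp l (kinv n i x * kinv m j y) = sum_list (map ?p [0..<Suc l])"
    by (simp only: Sqp_mult interv_sum_list_conv_sum_set_nat set_upt atLeast0LessThan lessThan_Suc_atMost)
  also have "kappa (n + m) (i + j + l) \<dots> =
      gsum (J (n + m)) (i + j + l) (map (kappa (n + m) (i + j + l)) (map ?p [0..<Suc l]))"
  proof (rule kappa_sum_list, rule subsetI)
    fix p assume "p \<in> set (map ?p [0..<Suc l])"
    then obtain k where k: "k \<in> {0..<Suc l}" "p = ?p k" unfolding set_map set_upt by blast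
    have "?p k \<in> carr (Pm (n + m)) ((i + k) + (j + (l - k)))"
      by (intro Pm_mult Sqp_carr kinv_carr x y)
    moreover have "(i + k) + (j + (l - k)) = i + j + l" using k(1) by simp
    ultimately show "p \<in> carr (Pm (n + m)) (i + j + l)" using k(2) by metis
  qed
  also have "map (kappa (n + m) (i + j + l)) (map ?p [0..<Suc l]) =
      map (\<lambda>k. kappa (n + m) ((i + k) + (j + (l - k)))
        (kinv n (i + k) (sq (J n) k i x) * kinv m (j + (l - k)) (sq (J m) (l - k) j y))) [0..<Suc l]"
    unfolding map_map
  proof (rule map_cong[OF HOL.refl])
    fix k assume "k \<in> set [0..<Suc l]"
    then have e: "i + k + (j + (l - k)) = i + j + l" by auto
    show "(kappa (n + m) (i + j + l) \<circ> ?p) k = kappa (n + m) ((i + k) + (j + (l - k)))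
        (kinv n (i + k) (sq (J n) k i x) * kinv m (j + (l - k)) (sq (J m) (l - k) j y))"
      by (simp only: comp_def e kinv_sq[OF x] kinv_sq[OF y])
  qed
  finally show "sq (J (n + m)) l (i + j) (kappa (n + m) (i + j) (kinv n i x * kinv m j y)) =
    gsum (J (n + m)) (i + j + l)
      (map (\<lambda>k. kappa (n + m) ((i + k) + (j + (l - k)))
        (kinv n (i + k) (sq (J n) k i x) * kinv m (j + (l - k)) (sq (J m) (l - k) j y))) [0..<Suc l])" .
qed

lemma mu_tens:
  assumes x: "x \<in> carr (J n) i" and y: "y \<in> carr (J m) j"
  shows "mu m n (i + j) (tens (J n) (J m) i x j y) = kappa (n + m) (i + j) (kinv n i x * kinv m j y)"
proof -
  let ?T = "tensor (J n) (J m)"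
  let ?t = "tens (J n) (J m) n (topJ n) m (topJ m)"
  obtain f where f: "f \<in> mor ?T (J (n + m))"
    and ft: "\<And>i j x y. x \<in> carr (J n) i \<Longrightarrow> y \<in> carr (J m) j \<Longrightarrow>
      f (i + j) (tens (J n) (J m) i x j y) = kappa (n + m) (i + j) (kinv n i x * kinv m j y)"
    using mu_exists[of n m] by blast
  have t: "?t \<in> carr ?T (n + m)" by (rule JJ.tens_carr[OF topJ_carr topJ_carr])
  have "f (n + m) ?t = topJ (n + m)"
  proof -
    have k: "kinv n n (topJ n) = mon (replicate_mset n 0)" for n
      unfolding topJ_def by (rule kinv_kappa) simp
    have "replicate_mset n 0 + replicate_mset m 0 = replicate_mset (n + m) (0::nat)"
      by (induction n) simp_all
    then have "mon (replicate_mset n 0) * mon (replicate_mset m 0) = mon (replicate_mset (n + m) 0)"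
      by (simp flip: mon_add)
    then show ?thesis by (simp only: ft[OF topJ_carr topJ_carr] k topJ_def[of "n + m"])
  qed
  then have f1: "f (n + m) ?t (iota (n + m)) = 1" by (simp only: topJ_iota)
  \<comment> \<open>If the single bit were 0, g would agree with the zero morphism. So every nonzero
    morphism has bit 1, as f does, which is the uniqueness needed for the description in
    \<open>mu_def\<close>.\<close>
  have nz: "g (n + m) ?t (iota (n + m)) = 1"
    if g: "g \<in> mor ?T (J (n + m))" and k: "w \<in> carr ?T k" "g k w \<noteq> zer (J (n + m)) k" for g k w
  proof (rule ccontr)
    assume "g (n + m) ?t (iota (n + m)) \<noteq> 1"
    then have 0: "g (n + m) ?t (iota (n + m)) = 0" by simp
    let ?Z = "\<lambda>k. \<lambda>w\<in>carr ?T k. zer (J (n + m)) k"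
    have "?Z \<in> mor ?T (J (n + m))"
      by (rule morI) (simp_all add: closed_gmodD[OF JJ.T_closed] unstableD[OF J_unstable]
          unstable_sq_zer[OF J_unstable] unstable_add_zer[OF J_unstable])
    then have "g = ?Z"
      by (rule mor_JJ_eqI[OF g]) (simp only: 0 t restrict_apply if_True J_vals(1)[OF iota_carr])
    then show False using k by simp
  qed
  have "mu m n = f"
    unfolding mu_def
  proof (rule the_equality)
    have "f (n + m) ?t \<noteq> zer (J (n + m)) (n + m)"
      using f1 J_vals(1)[OF iota_carr[of "n + m"]] by force
    then show "f \<in> mor ?T (J (n + m)) \<and> (\<exists>k. \<exists>w\<in>carr ?T k. f k w \<noteq> zer (J (n + m)) k)"
      using f t by blast
    fix g assume "g \<in> mor ?T (J (n + m)) \<and> (\<exists>k. \<exists>w\<in>carr ?T k. g k w \<noteq> zer (J (n + m)) k)"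
    then show "g = f" using mor_JJ_eqI[OF _ f] nz f1 by metis
  qed
  then show ?thesis using ft[OF x y] by simp
qed

subsection \<open>The internal product\<close>

text \<open>Sending the generator of F(n) to z takes Sq_0 of the generator to Sq_0 z. Thus
  \<open>dot_Sq n\<close> is precomposition with Sq_0, and \<open>kappa_Sq0\<close> applies.\<close>

lemma dot_Sq_kappa:
  assumes p: "p \<in> carr (Pm (2 * n)) m"
  shows "dot_Sq n m (kappa (2 * n) m p) = kappa n m (shift p)"
proof -
  let ?\<phi> = "\<lambda>f\<in>carr (J (2 * n)) n. f (sq (F n) n n (iota n))"
  note k = kappa_carr[OF p]
  have sq: "sq (F l) n n z \<in> carr (F l) (2 * n)" if "z \<in> carr (F l) n" for l z
    using sq_F_carr[OF HOL.refl that] .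
  have "?\<phi> \<in> dual (J (2 * n)) n"
    by (rule dualI)
      (simp_all only: unstableD[OF J_unstable] restrict_apply if_True if_False J_vals sq iota_carr)
  then have "dot_Sq n \<in> mor (J (2 * n)) (J n)"
    unfolding dot_Sq_def by (rule J_mor_mor[OF J_unstable])
  then have c: "dot_Sq n m (kappa (2 * n) m p) \<in> carr (J n) m" by (rule mor_carr[OF _ k])
  show ?thesis
  proof (rule J_eqI[OF c kappa_carr[OF shift_carr[OF p]]])
    fix z assume z: "z \<in> carr (F m) n"
    have "dot_Sq n m (kappa (2 * n) m p) z = F_mor (J (2 * n)) m (kappa (2 * n) m p) n z (sq (F n) n n (iota n))"
      using k z F_mor_carr[OF J_unstable k z] by (simp add: dot_Sq_def J_mor_def)
    also have "\<dots> = kappa (2 * n) m p (F_mor (F m) n z (2 * n) (sq (F n) n n (iota n)))"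
      unfolding F_mor_J[OF k z] by (simp add: J_act_def sq iota_carr)
    also have "F_mor (F m) n z (2 * n) (sq (F n) n n (iota n)) = sq (F m) n n z"
      using mor_sq[OF F_mor(1)[OF F_unstable z] iota_carr, of n] F_mor(2)[OF F_unstable z]
      by (simp add: mult_2)
    also have "kappa (2 * n) m p (sq (F m) n n z) = kappa n m (shift p) z"
      by (rule kappa_Sq0[OF p z])
    finally show "dot_Sq n m (kappa (2 * n) m p) z = kappa n m (shift p) z" .
  qed
qed

lemma J_alg_simps [simp]:
  "carr (J_alg n) = carr (J n)" "zer (J_alg n) = zer (J n)" "add (J_alg n) = add (J n)"
  "sq (J_alg n) = sq (J n)"
  by (simp_all add: J_alg_def gmod.defs)

lemma J_alg_star:
  assumes x: "x \<in> carr (J n) i" and y: "y \<in> carr (J n) j"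
  shows "star (J_alg n) i j x y = kappa n (i + j) (shift (kinv n i x * kinv n j y))"
proof -
  have "kinv n i x * kinv n j y \<in> carr (Pm (2 * n)) (i + j)"
    using Pm_mult[OF kinv_carr[OF x] kinv_carr[OF y]] by (simp add: mult_2)
  from dot_Sq_kappa[OF this] show ?thesis
    using mu_tens[OF x y] by (simp add: J_alg_def gmod.defs mult_2)
qed

section \<open>The polynomial model as a \<open>\<star>\<close>-unstable algebra\<close>

definition P_alg :: "nat \<Rightarrow> poly2 salg" where
  "P_alg n = gmod.extend (Pm n) \<lparr>star = (\<lambda>i j p q. shift (p * q))\<rparr>"

lemma P_alg_simps [simp]:
  "carr (P_alg n) = carr (Pm n)" "zer (P_alg n) m = 0" "add (P_alg n) m = (+)"
  "sq (P_alg n) i m = Sqp i" "star (P_alg n) i j p q = shift (p * q)"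
  by (simp_all add: P_alg_def gmod.defs)

lemma P_alg_gmod:
  "zer (P_alg n) = zer (Pm n)" "add (P_alg n) = add (Pm n)" "sq (P_alg n) = sq (Pm n)"
  by (simp_all add: P_alg_def gmod.defs)

lemmas P_alg_cong = gmod_cong[OF P_alg_simps(1) P_alg_gmod]

lemma shift_mult_carr:
  "p \<in> carr (Pm n) i \<Longrightarrow> q \<in> carr (Pm n) j \<Longrightarrow> shift (p * q) \<in> carr (Pm n) (i + j)"
  using Pm_mult[of p n i q n j] by (simp add: shift_carr mult_2)

lemma shift_funpow_zero [simp]: "(shift ^^ k) 0 = 0"
  by (induction k) (simp_all add: shift_simps)

lemma shift_funpow_mult: "(shift ^^ k) (p * q) = (shift ^^ k) p * (shift ^^ k) q"
  by (induction k) (simp_all add: shift_simps)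

text \<open>Each shift halves the weight; after q of them the weight is 1, and weight 1 is odd, so
  the next shift gives zero.\<close>

lemma shift_funpow_vanish:
  "p \<in> carr (Pm (2 ^ q)) m \<Longrightarrow> q < k \<Longrightarrow> (shift ^^ k) p = 0"
proof (induction q arbitrary: p k)
  case 0
  then obtain l where l: "k = Suc l" by (cases k) auto
  have "shift p = 0" using 0(1) by (rule shift_odd) simp
  then show ?case unfolding l funpow_Suc_right by simp
next
  case (Suc q)
  then obtain l where l: "k = Suc l" by (cases k) auto
  have "shift p \<in> carr (Pm (2 ^ q)) m" using Suc.prems(1) by (intro shift_carr) simp
  then show ?case using Suc.IH[of "shift p" l] Suc.prems(2) unfolding l funpow_Suc_right by simp
qed

text \<open>Every vertex of the tree contributes one shift to each of its two subtrees. The number k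
  of shifts already collected is carried along, and a leaf is hit by more than q of them.\<close>

lemma seval_P_alg_vanish:
  assumes "\<forall>(n, x)\<in>leaves t. x \<in> carr (Pm (2 ^ q)) n" and "q < k + sheight t"
  shows "(shift ^^ k) (seval (P_alg (2 ^ q)) t) = 0"
  using assms
proof (induction t arbitrary: k)
  case (Leaf x)
  then show ?case by (auto intro: shift_funpow_vanish)
next
  case (Node s t)
  have "(shift ^^ k) (seval (P_alg (2 ^ q)) (Node s t)) =
      (shift ^^ Suc k) (seval (P_alg (2 ^ q)) s) * (shift ^^ Suc k) (seval (P_alg (2 ^ q)) t)"
    by (simp add: funpow_swap1 shift_funpow_mult flip: shift_simps(3))
      (simp add: shift_simps shift_funpow_mult funpow_swap1)
  moreover have "q < Suc k + sheight s \<or> q < Suc k + sheight t"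
    using Node.prems(2) by auto
  ultimately show ?case using Node.IH[of "Suc k"] Node.prems(1) by auto
qed

lemma P_alg_star_unstable: "star_unstable_algebra q (P_alg (2 ^ q))"
proof -
  have "lev_ids (P_alg (2 ^ q)) \<subseteq> Id"
    unfolding lev_ids_iff by (simp add: shift_simps distrib_left distrib_right mult_ac)
  moreover have "truncation_ids q (P_alg (2 ^ q)) \<subseteq> Id"
    unfolding truncation_ids_iff using seval_P_alg_vanish[of _ q 0] by simp
  moreover have "cartan_ids (P_alg (2 ^ q)) \<subseteq> Id"
    unfolding cartan_ids_iff P_alg_simps P_alg_cong(3) gsum_Pm
    by (simp add: Sqp_shift Sqp_mult shift_simps interv_sum_list_conv_sum_set_nat
        atLeast0LessThan lessThan_Suc_atMost del: upt_Suc)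
  moreover have "star_sq0_ids (P_alg (2 ^ q)) \<subseteq> Id"
    unfolding star_sq0_ids_iff by (simp add: Sqp_top shift_simps power2_eq_square)
  ultimately show ?thesis
    using Pm_unstable[of "2 ^ q"] unfolding star_unstable_algebra_def star_unstable_ids_def closed_salg_def
      unstable_module_def P_alg_cong by (simp add: shift_mult_carr)
qed

section \<open>Transport of the algebra structure along a surjective morphism\<close>

lemma alg_mor_mor: "f \<in> alg_mor A B \<Longrightarrow> f \<in> mor A B"
  and alg_mor_star: "f \<in> alg_mor A B \<Longrightarrow> x \<in> carr A m \<Longrightarrow> y \<in> carr A n \<Longrightarrow>
    f (m + n) (star A m n x y) = star B m n (f m x) (f n y)"
  by (simp_all add: alg_mor_def)

lemma mor_gsum:
  assumes f: "f \<in> mor A B" and A: "unstable_module A" and B: "unstable_module B"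
  shows "set xs \<subseteq> carr A n \<Longrightarrow> f n (gsum A n xs) = gsum B n (map (f n) xs)"
  by (induction xs)
    (simp_all add: mor_zer[OF f A B] mor_add[OF f] closed_gsum[OF unstable_closed[OF A]] subset_iff)

text \<open>All axioms are equations, so they pass to a surjective image by lifting the arguments.
  This transfers them from polynomials to \<open>J_alg\<close> along \<open>kappa\<close>.\<close>

lemma star_unstable_image:
  assumes A: "star_unstable_algebra q A" and B: "unstable_module B"
    and f: "f \<in> alg_mor A B" and surj: "\<And>n. f n ` carr A n = carr B n"
  shows "star_unstable_algebra q B"
proof -
  note AU = star_unstableD(1)[OF A] and Ac = star_unstableD(2)[OF A]
  note fm = alg_mor_mor[OF f]
  note f_simps = alg_mor_star[OF f] mor_add[OF fm] mor_sq[OF fm] mor_carr[OF fm]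
  have ids: "lev_ids A \<subseteq> Id" "truncation_ids q A \<subseteq> Id" "cartan_ids A \<subseteq> Id" "star_sq0_ids A \<subseteq> Id"
    using A by (auto simp: star_unstable_algebra_def star_unstable_ids_def)
  have lift: "\<exists>x\<in>carr A n. y = f n x" if "y \<in> carr B n" for y n
    using that surj[of n] by auto
  have star: "star B m n x y \<in> carr B (m + n)" if xy: "x \<in> carr B m" "y \<in> carr B n" for m n x y
  proof -
    obtain a b where "a \<in> carr A m" "x = f m a" "b \<in> carr A n" "y = f n b"
      using lift[OF xy(1)] lift[OF xy(2)] by blast
    then show ?thesis using mor_carr[OF fm Ac[of a m b n]] f_simps(1)[of a m b n] by simp
  qed
  have "lev_ids B \<subseteq> Id"
  proof
    fix p assume "p \<in> lev_ids B"
    moreover obtain s t where p: "p = (s, t)" by (rule prod.exhaust)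
    ultimately have "(s, t) \<in> lev_ids B" by simp
    then have "s = t"
    proof (cases rule: lev_memE)
      case (1 m n x x' y)
      obtain a a' b where "a \<in> carr A m" "x = f m a" "a' \<in> carr A m" "x' = f m a'" "b \<in> carr A n" "y = f n b"
        using lift[OF 1(1)] lift[OF 1(2)] lift[OF 1(3)] by blast
      then show ?thesis using arg_cong[OF Id_D[OF ids(1) lev_memI(1)], of a m a' b n "f (m + n)"]
        unstableD(2)[OF AU] Ac by (simp add: 1 f_simps)
    next
      case (2 m n x y y')
      obtain a b b' where "a \<in> carr A m" "x = f m a" "b \<in> carr A n" "y = f n b" "b' \<in> carr A n" "y' = f n b'"
        using lift[OF 2(1)] lift[OF 2(2)] lift[OF 2(3)] by blast
      then show ?thesis using arg_cong[OF Id_D[OF ids(1) lev_memI(2)], of a m b n b' "f (m + n)"]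
        unstableD(2)[OF AU] Ac by (simp add: 2 f_simps)
    next
      case (3 m n x y)
      obtain a b where "a \<in> carr A m" "x = f m a" "b \<in> carr A n" "y = f n b"
        using lift[OF 3(1)] lift[OF 3(2)] by blast
      then show ?thesis
        using arg_cong[OF Id_D[OF ids(1) lev_memI(3)], of a m b n "f (m + n)"] f_simps(1)[of a m b n]
          f_simps(1)[of b n a m] by (simp add: 3 add.commute)
    next
      case (4 k l m n x y z w)
      obtain a b c d where abcd: "a \<in> carr A k" "x = f k a" "b \<in> carr A l" "y = f l b"
        "c \<in> carr A m" "z = f m c" "d \<in> carr A n" "w = f n d"
        using lift[OF 4(1)] lift[OF 4(2)] lift[OF 4(3)] lift[OF 4(4)] by blast
      have e: "k + l + (m + n) = k + m + (l + n)" by simp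
      have "f (k + l + (m + n)) (star A (k + l) (m + n) (star A k l a b) (star A m n c d)) =
          f (k + m + (l + n)) (star A (k + m) (l + n) (star A k m a c) (star A l n b d))"
        unfolding e using Id_D[OF ids(1) lev_memI(4)] abcd by metis
      then show ?thesis using abcd
        by (simp only: 4 f_simps(1) Ac)
    qed
    then show "p \<in> Id" by (simp add: p)
  qed
  moreover have "truncation_ids q B \<subseteq> Id"
    unfolding truncation_ids_iff
  proof (intro allI impI)
    have tree: "\<exists>t'. (\<forall>(n, x)\<in>leaves t'. x \<in> carr A n) \<and> sheight t' = sheight t \<and> sdeg t' = sdeg t \<and>
        seval A t' \<in> carr A (sdeg t) \<and> seval B t = f (sdeg t) (seval A t')"
      if "\<forall>(n, x)\<in>leaves t. x \<in> carr B n" for t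
      using that
    proof (induction t)
      case (Leaf p)
      then obtain x where "x \<in> carr A (fst p)" "snd p = f (fst p) x"
        using lift[of "snd p" "fst p"] by auto
      then show ?case by (intro exI[of _ "Leaf (fst p, x)"]) simp
    next
      case (Node s t)
      then obtain s' t' where
        "\<forall>(n, x)\<in>leaves s'. x \<in> carr A n" "sheight s' = sheight s" "sdeg s' = sdeg s"
        "seval A s' \<in> carr A (sdeg s)" "seval B s = f (sdeg s) (seval A s')"
        "\<forall>(n, x)\<in>leaves t'. x \<in> carr A n" "sheight t' = sheight t" "sdeg t' = sdeg t"
        "seval A t' \<in> carr A (sdeg t)" "seval B t = f (sdeg t) (seval A t')"
        by (metis UnCI stree.set(2))
      then show ?case by (intro exI[of _ "Node s' t'"]) (auto simp: f_simps Ac)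
    qed
    fix t assume "\<forall>(n, x)\<in>leaves t. x \<in> carr B n" and h: "q < sheight t"
    then obtain t' where "\<forall>(n, x)\<in>leaves t'. x \<in> carr A n" "sheight t' = sheight t" "sdeg t' = sdeg t"
      "seval B t = f (sdeg t) (seval A t')"
      using tree by blast
    then show "seval B t = zer B (sdeg t)"
      using ids(2) h mor_zer[OF fm AU B] unfolding truncation_ids_iff by metis
  qed
  moreover have "cartan_ids B \<subseteq> Id"
    unfolding cartan_ids_iff
  proof (intro allI ballI)
    fix i m n x y assume xy: "x \<in> carr B m" "y \<in> carr B n"
    obtain a b where ab: "a \<in> carr A m" "x = f m a" "b \<in> carr A n" "y = f n b"
      using lift[OF xy(1)] lift[OF xy(2)] by blast
    let ?a = "\<lambda>k. star A (m + k) (n + (i - k)) (sq A k m a) (sq A (i - k) n b)"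
    have deg: "m + k + (n + (i - k)) = m + n + i" if "k \<in> set [0..<Suc i]" for k using that by auto
    have c: "?a k \<in> carr A (m + k + (n + (i - k)))" for k
      by (intro Ac unstableD(3)[OF AU] ab)
    have "sq B i (m + n) (star B m n x y) = f (m + n + i) (sq A i (m + n) (star A m n a b))"
      using ab by (simp add: f_simps Ac)
    also have "\<dots> = f (m + n + i) (gsum A (m + n + i) (map ?a [0..<Suc i]))"
      using Id_D[OF ids(3) cartan_memI[OF ab(1,3)]] by simp
    also have "\<dots> = gsum B (m + n + i) (map (f (m + n + i)) (map ?a [0..<Suc i]))"
    proof (rule mor_gsum[OF fm AU B], rule subsetI)
      fix z assume "z \<in> set (map ?a [0..<Suc i])"
      then obtain k where "k \<in> set [0..<Suc i]" "z = ?a k" unfolding set_map by blast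
      then show "z \<in> carr A (m + n + i)" using c[of k] deg by metis
    qed
    also have "map (f (m + n + i)) (map ?a [0..<Suc i]) =
        map (\<lambda>k. star B (m + k) (n + (i - k)) (sq B k m x) (sq B (i - k) n y)) [0..<Suc i]"
      unfolding map_map
    proof (rule map_cong[OF HOL.refl])
      fix k assume k: "k \<in> set [0..<Suc i]"
      show "(f (m + n + i) \<circ> ?a) k = star B (m + k) (n + (i - k)) (sq B k m x) (sq B (i - k) n y)"
        unfolding comp_def deg[OF k, symmetric] using ab
        by (simp only: f_simps(1,3) unstableD(3)[OF AU])
    qed
    finally show "sq B i (m + n) (star B m n x y) = gsum B (m + n + i)
        (map (\<lambda>k. star B (m + k) (n + (i - k)) (sq B k m x) (sq B (i - k) n y)) [0..<Suc i])" .
  qed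
  moreover have "star_sq0_ids B \<subseteq> Id"
    unfolding star_sq0_ids_iff
  proof (intro allI ballI)
    fix n x assume "x \<in> carr B n"
    then obtain a where a: "a \<in> carr A n" "x = f n a" using lift by blast
    then have "f (n + n) (sq A n n a) = f (n + n) (star A n n a a)"
      using ids(4) unfolding star_sq0_ids_iff by simp
    then show "sq B n n x = star B n n x x" using a by (simp add: f_simps)
  qed
  ultimately show ?thesis
    using B star by (simp add: star_unstable_algebra_def star_unstable_ids_def closed_salg_def
        unstable_module_def)
qed

lemma kappa_alg_mor: "kappa n \<in> alg_mor (P_alg n) (J_alg n)"
proof -
  have "kappa n \<in> mor (P_alg n) (J_alg n)"
    using kappa_mor[of n] unfolding mor_def by (simp add: P_alg_gmod del: P_alg_simps(2,3,4))
  moreover have "kappa n (i + j) (shift (p * q)) = star (J_alg n) i j (kappa n i p) (kappa n j q)"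
    if "p \<in> carr (Pm n) i" "q \<in> carr (Pm n) j" for i j p q
    using J_alg_star[OF kappa_carr[OF that(1)] kappa_carr[OF that(2)]] that by (simp add: kinv_kappa)
  ultimately show ?thesis by (simp add: alg_mor_def)
qed

lemma J_alg_star_unstable: "star_unstable_algebra q (J_alg (2 ^ q))"
proof (rule star_unstable_image[OF P_alg_star_unstable _ kappa_alg_mor])
  show "unstable_module (J_alg (2 ^ q))"
    using J_unstable gmod_cong[of "J_alg (2 ^ q)" "J (2 ^ q)"] by (simp add: unstable_module_def)
  show "kappa (2 ^ q) n ` carr (P_alg (2 ^ q)) n = carr (J_alg (2 ^ q)) n" for n
    using bij_betw_imp_surj_on[OF kappa_bij] by simp
qed

section \<open>Composition and inversion of algebra isomorphisms\<close>

lemma alg_iso_trans: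
  assumes "alg_iso A B" "alg_iso B C" and A: "star_unstable_algebra q A"
  shows "alg_iso A C"
proof -
  obtain f where f: "f \<in> alg_mor A B" "\<And>n. bij_betw (f n) (carr A n) (carr B n)"
    using assms(1) unfolding alg_iso_def by blast
  obtain g where g: "g \<in> alg_mor B C" "\<And>n. bij_betw (g n) (carr B n) (carr C n)"
    using assms(2) unfolding alg_iso_def by blast
  let ?h = "\<lambda>n. \<lambda>x\<in>carr A n. g n (f n x)"
  have "?h \<in> mor A C"
    by (rule mor_comp[OF alg_mor_mor[OF f(1)] alg_mor_mor[OF g(1)] unstable_closed[OF star_unstableD(1)[OF A]]])
  then have "?h \<in> alg_mor A C"
    using star_unstableD(2)[OF A] alg_mor_star[OF f(1)] alg_mor_star[OF g(1)]
      mor_carr[OF alg_mor_mor[OF f(1)]] by (simp add: alg_mor_def)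
  moreover have "bij_betw (?h n) (carr A n) (carr C n)" for n
    using bij_betw_trans[OF f(2) g(2), of n] by (rule bij_betw_cong[THEN iffD1, rotated]) simp
  ultimately show ?thesis unfolding alg_iso_def by (intro bexI[of _ ?h] allI)
qed

lemma alg_iso_sym:
  assumes "alg_iso A B" and A: "star_unstable_algebra q A" and B: "star_unstable_algebra q B"
  shows "alg_iso B A"
proof -
  obtain f where f: "f \<in> alg_mor A B" and bij: "\<And>n. bij_betw (f n) (carr A n) (carr B n)"
    using assms(1) unfolding alg_iso_def by blast
  note fm = alg_mor_mor[OF f]
  note AD = unstableD[OF star_unstableD(1)[OF A]] star_unstableD(2)[OF A]
  note BD = unstableD[OF star_unstableD(1)[OF B]] star_unstableD(2)[OF B]
  let ?g = "\<lambda>n. \<lambda>y\<in>carr B n. inv_into (carr A n) (f n) y"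
  have g: "?g n y \<in> carr A n" "f n (?g n y) = y" if "y \<in> carr B n" for n y
    using that bij_betw_imp_surj_on[OF bij[of n]] by (simp_all add: inv_into_into f_inv_into_f)
  have inj: "x = y" if "x \<in> carr A n" "y \<in> carr A n" "f n x = f n y" for x y n
    using that bij_betw_imp_inj_on[OF bij[of n]] by (simp add: inj_on_def)
  have gi: "?g n y = x" if "x \<in> carr A n" "y \<in> carr B n" "f n x = y" for n x y
    using inj[OF g(1)[OF that(2)] that(1)] g(2)[OF that(2)] that(3) by simp
  have "?g \<in> mor B A"
  proof (rule morI)
    fix n x y assume "x \<in> carr B n" "y \<in> carr B n"
    then show "?g n (add B n x y) = add A n (?g n x) (?g n y)"
      using g by (intro gi AD(2) BD(2)) (simp_all only: mor_add[OF fm])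
  next
    fix i n x assume "x \<in> carr B n"
    then show "?g (n + i) (sq B i n x) = sq A i n (?g n x)"
      using g by (intro gi AD(3) BD(3)) (simp_all only: mor_sq[OF fm])
  qed (use g in simp_all)
  moreover have "?g (m + n) (star B m n x y) = star A m n (?g m x) (?g n y)"
    if "x \<in> carr B m" "y \<in> carr B n" for m n x y
    using that g by (intro gi AD(4) BD(4)) (simp_all only: alg_mor_star[OF f])
  ultimately have "?g \<in> alg_mor B A" unfolding alg_mor_def by blast
  moreover have "bij_betw (?g n) (carr B n) (carr A n)" for n
    using bij_betw_inv_into[OF bij[of n]] by (rule bij_betw_cong[THEN iffD1, rotated]) simp
  ultimately show ?thesis unfolding alg_iso_def by (intro bexI[of _ ?g] allI)
qed

section \<open>Monomials in a \<open>\<star>\<close>-unstable algebra\<close>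

lemma wt_image_mset_Suc_add:
  "M + N = image_mset Suc L \<Longrightarrow> wt M + wt N = 2 * wt L"
  using wt_image_Suc[of L] wt_simps(3)[of M N] by simp

lemma wt_mem: "i \<in># M \<Longrightarrow> 2 ^ i \<le> wt M"
  by (drule multi_member_split) auto

lemma wt_eq_0 [simp]: "wt M = 0 \<longleftrightarrow> M = {#}"
  by (cases M) auto

lemma wt_singleton: "i \<in># M \<Longrightarrow> wt M = 2 ^ i \<Longrightarrow> M = {#i#}"
  by (auto dest!: multi_member_split)

text \<open>If the part 2^(r+1) does not occur, all parts are at most 2^r. A submultiset of weight
  2^r can be split off, and the remainder still weighs at least 2^r, so this can be done a second
  time.\<close>

lemma wt_split:
  assumes "\<forall>i\<in>#M. i \<le> r" "2 ^ r \<le> wt M"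
  shows "\<exists>N. N \<subseteq># M \<and> wt N = 2 ^ r"
  using assms
proof (induction r arbitrary: M)
  case 0
  then obtain i where "i \<in># M" by (metis multiset_nonemptyE not_one_le_zero power_0 wt_simps(1))
  then show ?case using 0 by (intro exI[of _ "{#0#}"]) auto
next
  case (Suc r)
  show ?case
  proof (cases "Suc r \<in># M")
    case True
    then show ?thesis by (intro exI[of _ "{#Suc r#}"]) simp
  next
    case False
    then have le: "\<forall>i\<in>#M. i \<le> r" using Suc.prems(1) le_Suc_eq by blast
    obtain N where N: "N \<subseteq># M" "wt N = 2 ^ r" using Suc.IH[OF le] Suc.prems(2) by auto
    then obtain M' where M': "M = N + M'" by (metis subset_mset.le_iff_add)
    have "\<forall>i\<in>#M'. i \<le> r" "2 ^ r \<le> wt M'" using le Suc.prems(2) N(2) by (simp_all add: M')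
    then obtain N' where "N' \<subseteq># M'" "wt N' = 2 ^ r" using Suc.IH by blast
    then show ?thesis using N by (intro exI[of _ "N + N'"]) (simp add: M')
  qed
qed

text \<open>Raising all indices by one doubles the weight, and \<open>wt_split\<close> cuts the
  result in two. This writes a monomial as the shift of a product of two smaller ones, which drives
  every later induction over monomials.\<close>

lemma halves_exist:
  assumes "wt M = 2 ^ q" "M \<noteq> {#q#}"
  shows "\<exists>N N'. N + N' = image_mset Suc M \<and> wt N = 2 ^ q \<and> wt N' = 2 ^ q \<and>
    size N < size M \<and> size N' < size M"
proof -
  have "i < q" if i: "i \<in># M" for i
  proof -
    have "i \<le> q" using wt_mem[OF i] assms(1) by (simp add: power_le_imp_le_exp)
    moreover have "i \<noteq> q" using wt_singleton[OF i] assms by blast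
    ultimately show ?thesis by simp
  qed
  then have "\<forall>i\<in>#image_mset Suc M. i \<le> q" by (auto simp: Suc_le_eq)
  moreover have w: "wt (image_mset Suc M) = 2 ^ q + 2 ^ q" by (simp add: wt_image_Suc assms)
  moreover have "2 ^ q \<le> wt (image_mset Suc M)" by (simp only: w)
  ultimately obtain N where N: "N \<subseteq># image_mset Suc M" "wt N = 2 ^ q" using wt_split by blast
  then obtain N' where N': "N + N' = image_mset Suc M" by (metis subset_mset.le_iff_add)
  then have w': "wt N' = 2 ^ q" using N(2) w wt_simps(3)[of N N'] by simp
  have "N \<noteq> {#}" "N' \<noteq> {#}" using N(2) w' by auto
  moreover have "size M = size N + size N'" using arg_cong[OF N', of size] by simp
  ultimately show ?thesis using N' N(2) w' by (intro exI[of _ N] exI[of _ N']) (simp add: nonempty_has_size)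
qed

locale level_element =
  fixes q :: nat and A :: "('a, 'z) salg_scheme" and u :: 'a
  assumes A: "star_unstable_algebra q A" and u: "u \<in> carr A 1"
begin

lemma A_unstable: "unstable_module A"
  and star_carr: "x \<in> carr A m \<Longrightarrow> y \<in> carr A n \<Longrightarrow> star A m n x y \<in> carr A (m + n)"
  using star_unstableD[OF A] by blast+

lemma A_lev: "lev_ids A \<subseteq> Id" and A_trunc: "truncation_ids q A \<subseteq> Id"
  and A_cartan: "cartan_ids A \<subseteq> Id" and A_sq0: "star_sq0_ids A \<subseteq> Id"
  using A by (auto simp: star_unstable_algebra_def star_unstable_ids_def)

lemma star_add_left: "x \<in> carr A m \<Longrightarrow> x' \<in> carr A m \<Longrightarrow> y \<in> carr A n \<Longrightarrow>
    star A m n (add A m x x') y = add A (m + n) (star A m n x y) (star A m n x' y)"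
  by (rule Id_D[OF A_lev lev_memI(1)])

lemma star_add_right: "x \<in> carr A m \<Longrightarrow> y \<in> carr A n \<Longrightarrow> y' \<in> carr A n \<Longrightarrow>
    star A m n x (add A n y y') = add A (m + n) (star A m n x y) (star A m n x y')"
  by (rule Id_D[OF A_lev lev_memI(2)])

lemma star_commute: "x \<in> carr A m \<Longrightarrow> y \<in> carr A n \<Longrightarrow> star A m n x y = star A n m y x"
  by (rule Id_D[OF A_lev lev_memI(3)])

lemma star_zer_left: "y \<in> carr A n \<Longrightarrow> star A m n (zer A m) y = zer A (m + n)"
  using star_add_left[of "zer A m" m "zer A m" y n] unstableD(1)[OF A_unstable, of m]
    unstable_vec(3)[OF A_unstable, of "zer A m" m] unstable_vec(4)[OF A_unstable star_carr] by simp

lemma star_zer_right: "x \<in> carr A m \<Longrightarrow> star A m n x (zer A n) = zer A (m + n)"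
  using star_add_right[of x m "zer A n" n "zer A n"] unstableD(1)[OF A_unstable, of n]
    unstable_vec(3)[OF A_unstable, of "zer A n" n] unstable_vec(4)[OF A_unstable star_carr] by simp

text \<open>A tree represents \<open>M\<close> if it has one leaf of depth \<open>q - i\<close> for every element \<open>i\<close> of \<open>M\<close>.\<close>

inductive rep :: "nat multiset \<Rightarrow> (nat \<times> 'a) stree \<Rightarrow> bool" where
  leaf: "rep {#q#} (Leaf (1, u))"
| node: "rep M S \<Longrightarrow> rep N T \<Longrightarrow> M + N = image_mset Suc L \<Longrightarrow> rep L (Node S T)"

lemma rep_wt: "rep M T \<Longrightarrow> wt M = 2 ^ q"
  by (induction rule: rep.induct) (use wt_image_mset_Suc_add in force)+

lemma rep_sdeg: "rep M T \<Longrightarrow> sdeg T = size M"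
  by (induction rule: rep.induct) (simp, metis sdeg.simps(2) size_union size_image_mset)

lemma rep_leaves: "rep M T \<Longrightarrow> leaves T = {(1, u)}"
  by (induction rule: rep.induct) simp_all

lemma rep_carr: "rep M T \<Longrightarrow> seval A T \<in> carr A (size M)"
proof (induction rule: rep.induct)
  case (node M S N T L)
  have "size M + size N = size L" using arg_cong[OF node.hyps(3), of size] by simp
  then show ?case using node star_carr[OF node.IH] by (simp add: rep_sdeg)
qed (use u in simp)

lemma rep_height: "rep M T \<Longrightarrow> i \<in># M \<Longrightarrow> q \<le> sheight T + i"
proof (induction arbitrary: i rule: rep.induct)
  case (node M S N T L)
  have "Suc i \<in># M + N" using node.prems by (simp add: node.hyps(3))
  then show ?case using node.IH[of "Suc i"] by force
qed simp

lemma rep_exists: "wt M = 2 ^ q \<Longrightarrow> \<exists>T. rep M T"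
proof (induction "size M" arbitrary: M rule: less_induct)
  case less
  show ?case
  proof (cases "M = {#q#}")
    case True
    then show ?thesis using rep.leaf by blast
  next
    case False
    then obtain N N' where "N + N' = image_mset Suc M" "wt N = 2 ^ q" "wt N' = 2 ^ q"
      "size N < size M" "size N' < size M" using halves_exist[OF less.prems] by blast
    then show ?thesis using less.hyps rep.node by metis
  qed
qed

lemma rep_leaf_unique:
  assumes "rep {#q#} T" shows "T = Leaf (1, u)"
  using assms
proof (cases rule: rep.cases)
  case (node M S N T')
  have "size (M + N) = 1" unfolding node(4) by simp
  then have "size M + size N = 1" by (simp only: size_union)
  moreover have "M \<noteq> {#}" "N \<noteq> {#}" using rep_wt[OF node(2)] rep_wt[OF node(3)] by auto
  ultimately show ?thesis by (auto simp: nonempty_has_size)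
qed simp_all

lemma seval_node_commute:
  "rep M S \<Longrightarrow> rep N T \<Longrightarrow> seval A (Node S T) = seval A (Node T S)"
  using star_commute[OF rep_carr rep_carr] by (simp add: rep_sdeg)

lemma seval_node_interchange:
  assumes "rep M1 S1" "rep M2 S2" "rep M3 S3" "rep M4 S4"
  shows "seval A (Node (Node S1 S2) (Node S3 S4)) = seval A (Node (Node S1 S3) (Node S2 S4))"
  using Id_D[OF A_lev lev_memI(4)[OF assms[THEN rep_carr]]] assms[THEN rep_sdeg] by simp

text \<open>Independence for trees that branch at the root, phrased by their two subtrees so that
  different splittings of the same multiset can be compared. Leaves are covered by
  \<open>rep_leaf_unique\<close>.\<close>

definition swap_ok :: "nat multiset \<Rightarrow> bool" where
  "swap_ok L \<longleftrightarrow> (\<forall>M N M' N' S T S' T'. rep M S \<longrightarrow> rep N T \<longrightarrow> rep M' S' \<longrightarrow> rep N' T' \<longrightarrow>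
     M + N = image_mset Suc L \<longrightarrow> M' + N' = image_mset Suc L \<longrightarrow>
     seval A (Node S T) = seval A (Node S' T'))"

lemma rep_unique_aux:
  assumes "swap_ok M" "rep M S" "rep M T"
  shows "seval A S = seval A T"
  using assms(2)
proof (cases rule: rep.cases)
  case leaf
  then show ?thesis using rep_leaf_unique assms(3) by blast
next
  case 1: (node M1 S1 N1 T1)
  show ?thesis
    using assms(3)
  proof (cases rule: rep.cases)
    case leaf
    then show ?thesis using rep_leaf_unique assms(2) by blast
  next
    case 2: (node M2 S2 N2 T2)
    then show ?thesis using assms(1) 1 unfolding swap_ok_def by blast
  qed
qed

text \<open>
  Exchanging \<open>M2\<close>, \<open>N2\<close> for \<open>M2'\<close>, \<open>N2'\<close> in the product of \<open>M1 + M2\<close> and \<open>N1 + N2\<close>: interchange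
  \<open>M2\<close> with \<open>N1\<close>, use the exchange for the smaller multiset \<open>M2 + N2\<close>, and interchange back.
\<close>

lemma swap_halves:
  assumes IH: "\<And>K. size K < size M1 + size M2 + (size N1 + size N2) \<Longrightarrow> swap_ok K"
    and reps: "rep (M1 + M2) S" "rep (N1 + N2) T" "rep (M1 + M2') S'" "rep (N1 + N2') T'"
    and e: "M2 + N2 = M2' + N2'"
    and w: "2 * wt M1 = 2 ^ q" "2 * wt N1 = 2 ^ q"
  shows "seval A (Node S T) = seval A (Node S' T')"
proof -
  note rw = reps[THEN rep_wt]
  have w2: "2 * wt M2 = 2 ^ q" "2 * wt N2 = 2 ^ q" "2 * wt M2' = 2 ^ q" "2 * wt N2' = 2 ^ q"
    using rw w by simp_all
  \<comment> \<open>Each of the six pieces weighs half of 2^q. With indices raised by one it has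
    full weight and is represented by a tree, which serves as one of the two branches below a child
    of the root.\<close>
  have ex: "\<exists>T. rep (image_mset Suc K) T" if "2 * wt K = 2 ^ q" for K
    using that by (intro rep_exists) (simp add: wt_image_Suc)
  obtain a1 b1 a2 b2 c2 d2 where r: "rep (image_mset Suc M1) a1" "rep (image_mset Suc N1) b1"
    "rep (image_mset Suc M2) a2" "rep (image_mset Suc N2) b2"
    "rep (image_mset Suc M2') c2" "rep (image_mset Suc N2') d2"
    using ex[OF w(1)] ex[OF w(2)] ex[OF w2(1)] ex[OF w2(2)] ex[OF w2(3)] ex[OF w2(4)] by blast
  have n: "rep (M1 + M2) (Node a1 a2)" "rep (N1 + N2) (Node b1 b2)"
    "rep (M1 + M2') (Node a1 c2)" "rep (N1 + N2') (Node b1 d2)"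
    using r by (auto intro: rep.node)
  have pos: "0 < size M1" "0 < size N1" "0 < size M2" "0 < size N2" "0 < size M2'" "0 < size N2'"
    using w w2 by (auto simp: nonempty_has_size[symmetric])
  have sz: "size M2 + size N2 = size M2' + size N2'" using arg_cong[OF e, of size] by simp
  have v: "seval A S = seval A (Node a1 a2)" "seval A T = seval A (Node b1 b2)"
    "seval A S' = seval A (Node a1 c2)" "seval A T' = seval A (Node b1 d2)"
    using pos sz rep_unique_aux[OF IH[of "M1 + M2"] reps(1) n(1)]
      rep_unique_aux[OF IH[of "N1 + N2"] reps(2) n(2)]
      rep_unique_aux[OF IH[of "M1 + M2'"] reps(3) n(3)]
      rep_unique_aux[OF IH[of "N1 + N2'"] reps(4) n(4)]
    by simp_all
  have m: "seval A (Node a2 b2) = seval A (Node c2 d2)"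
  proof -
    have "swap_ok (M2 + N2)" using pos by (intro IH) simp
    then show ?thesis using r(3-6) e unfolding swap_ok_def by (metis image_mset_union)
  qed
  have d: "sdeg (Node a2 b2) = sdeg (Node c2 d2)"
    using r[THEN rep_sdeg] sz by simp
  have "seval A (Node S T) = seval A (Node (Node a1 a2) (Node b1 b2))"
    using v reps[THEN rep_sdeg] n[THEN rep_sdeg] by simp
  also have "\<dots> = seval A (Node (Node a1 b1) (Node a2 b2))"
    by (rule seval_node_interchange[OF r(1,3,2,4)])
  also have "\<dots> = seval A (Node (Node a1 b1) (Node c2 d2))"
    using m d by simp
  also have "\<dots> = seval A (Node (Node a1 c2) (Node b1 d2))"
    by (rule seval_node_interchange[OF r(1,2,5,6)])
  also have "\<dots> = seval A (Node S' T')"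
    using v reps[THEN rep_sdeg] n[THEN rep_sdeg] by simp
  finally show ?thesis .
qed

lemma swap_all: "swap_ok L"
proof (induction "size L" arbitrary: L rule: less_induct)
  case less
  have uniq: "seval A S = seval A T" if "rep M S" "rep M T" "size M < size L" for M S T
    using rep_unique_aux[OF less.hyps] that by blast
  show ?case
    unfolding swap_ok_def
  proof (intro allI impI)
    fix M N M' N' S T S' T'
    assume r: "rep M S" "rep N T" "rep M' S'" "rep N' T'"
      and e: "M + N = image_mset Suc L" "M' + N' = image_mset Suc L"
    note w = r[THEN rep_wt]
    note d = r[THEN rep_sdeg]
    have MN: "M + N = M' + N'" using e by simp
    have sz: "size M + size N = size L" "size M' + size N' = size L"
      using arg_cong[OF e(1), of size] arg_cong[OF e(2), of size] by simp_all
    have ne: "M \<noteq> {#}" "N \<noteq> {#}" "M' \<noteq> {#}" "N' \<noteq> {#}" using w by auto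
    then have lt: "size M < size L" "size N < size L" "size M' < size L" "size N' < size L"
      using sz by (auto simp: nonempty_has_size)
    have same: "seval A (Node S T) = seval A (Node S' T')" if "M = M'" "N = N'"
      using uniq[OF r(1)] uniq[OF r(2)] r(3,4) that lt d by simp
    have crossed: "seval A (Node S T) = seval A (Node S' T')" if "M = N'" "N = M'"
    proof -
      have "seval A (Node S T) = seval A (Node T' S')"
        using uniq[OF r(1)] uniq[OF r(2)] r(3,4) that lt d by simp
      then show ?thesis using seval_node_commute[OF r(4,3)] by simp
    qed
    show "seval A (Node S T) = seval A (Node S' T')"
    \<comment> \<open>An index q alone has the full weight 2^q, so a factor containing it is that
      single variable, and the two splittings agree up to order.\<close>
    proof (cases "q \<in># M + N")
      case True
      then have "q \<in># M' + N'" by (simp only: MN)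
      then have "M = {#q#} \<or> N = {#q#}" "M' = {#q#} \<or> N' = {#q#}"
        using True wt_singleton w by auto
      then have "M = M' \<and> N = N' \<or> M = N' \<and> N = M'"
        using MN by (auto simp: add.commute)
      then show ?thesis using same crossed by blast
    next
      case False
      have q: "0 < q"
      proof (rule ccontr)
        assume "\<not> 0 < q"
        obtain i where "i \<in># M" using ne(1) by (meson multiset_nonemptyE)
        moreover from this have "(2::nat) ^ i \<le> 2 ^ q" using wt_mem w(1) by metis
        ultimately show False using False \<open>\<not> 0 < q\<close> by auto
      qed
      define r' where "r' = q - 1"
      have qr: "q = Suc r'" using q by (simp add: r'_def)
      have small: "\<forall>i\<in>#K. i \<le> r'" if "K \<subseteq># M \<or> K \<subseteq># N" for K
      proof
        fix i assume "i \<in># K"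
        then have i: "i \<in># M \<or> i \<in># N" using that mset_subset_eqD by metis
        then have "(2::nat) ^ i \<le> 2 ^ q" using wt_mem w(1,2) by metis
        then have "i \<le> q" by (simp add: power_le_imp_le_exp)
        moreover have "i \<noteq> q" using i False by auto
        ultimately show "i \<le> r'" by (simp add: qr)
      qed
      have IH: "swap_ok K" if "size K < size L" for K using less.hyps that by blast
      show ?thesis
      \<comment> \<open>M weighs twice 2^r', so either M and M' share half of it or half lies in M -
        M'. In the first case N and N' share a half too. In the second, M - M' lies in N' and M' - M
        lies in N, and the argument applies with S' and T' exchanged.\<close>
      proof (cases "2 ^ r' \<le> wt (M \<inter># M')")
        case True
        \<comment> \<open>Since M + N = M' + N', the multiset \<open>N' - (M - M')\<close> is the
          intersection of N and N'.\<close>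
        have s: "M \<inter># M' \<subseteq># M" "M \<inter># M' \<subseteq># M'" "N' - (M - M') \<subseteq># N" "N' - (M - M') \<subseteq># N'"
        proof -
          show "N' - (M - M') \<subseteq># N"
          proof (rule mset_subset_eqI)
            fix i show "count (N' - (M - M')) i \<le> count N i"
              using arg_cong[OF MN, of "\<lambda>X. count X i"] by simp
          qed
        qed simp_all
        have "M = (M \<inter># M') + (M - M')"
          by (rule multiset_eqI) simp
        then have w1: "wt M = wt (M \<inter># M') + wt (M - M')" by (metis wt_simps(3))
        have "N' = (N' - (M - M')) + (M - M')"
        proof (rule multiset_eqI)
          fix i show "count N' i = count ((N' - (M - M')) + (M - M')) i"
            using arg_cong[OF MN, of "\<lambda>X. count X i"] by simp
        qed
        then have w2: "wt N' = wt (N' - (M - M')) + wt (M - M')" by (metis wt_simps(3))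
        have ge: "2 ^ r' \<le> wt (N' - (M - M'))" using True w1 w2 w by simp
        obtain N1 where N1: "N1 \<subseteq># N' - (M - M')" "wt N1 = 2 ^ r'"
          using wt_split[OF small[OF disjI2[OF s(3)]] ge] by blast
        then have N1: "N1 \<subseteq># N" "N1 \<subseteq># N'" "wt N1 = 2 ^ r'"
          using subset_mset.order_trans[OF _ s(3)] subset_mset.order_trans[OF _ s(4)] by blast+
        obtain M1 where M1: "M1 \<subseteq># M \<inter># M'" "wt M1 = 2 ^ r'"
          using wt_split[OF small[OF disjI1[OF s(1)]] True] by blast
        then have M1: "M1 \<subseteq># M" "M1 \<subseteq># M'" "wt M1 = 2 ^ r'"
          using subset_mset.order_trans[OF _ s(1)] subset_mset.order_trans[OF _ s(2)] by blast+
        obtain M2 M2' N2 N2' where p: "M = M1 + M2" "M' = M1 + M2'" "N = N1 + N2" "N' = N1 + N2'"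
          using M1(1,2) N1(1,2) by (metis subset_mset.le_iff_add)
        show ?thesis
        proof (rule swap_halves)
          show "rep (M1 + M2) S" "rep (N1 + N2) T" "rep (M1 + M2') S'" "rep (N1 + N2') T'"
            using r p by simp_all
          show "M2 + N2 = M2' + N2'" using MN by (simp add: p)
          show "swap_ok K" if "size K < size M1 + size M2 + (size N1 + size N2)" for K
            using that sz(1) by (intro IH) (simp add: p)
        qed (simp_all add: M1 N1 qr)
      next
        case False
        have s: "M - M' \<subseteq># M" "M - M' \<subseteq># N'" "M' - M \<subseteq># M'" "M' - M \<subseteq># N"
        proof -
          show "M - M' \<subseteq># N'"
          proof (rule mset_subset_eqI)
            fix i show "count (M - M') i \<le> count N' i"
              using arg_cong[OF MN, of "\<lambda>X. count X i"] by simp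
          qed
          show "M' - M \<subseteq># N"
          proof (rule mset_subset_eqI)
            fix i show "count (M' - M) i \<le> count N i"
              using arg_cong[OF MN, of "\<lambda>X. count X i"] by simp
          qed
        qed simp_all
        have "M = (M \<inter># M') + (M - M')" "M' = (M \<inter># M') + (M' - M)"
          by (rule multiset_eqI, simp)+
        then have "wt M = wt (M \<inter># M') + wt (M - M')" "wt M' = wt (M \<inter># M') + wt (M' - M)"
          by (metis wt_simps(3))+
        then have ge: "2 ^ r' \<le> wt (M - M')" "2 ^ r' \<le> wt (M' - M)" using False w by (simp_all add: qr)
        obtain M1 where M1: "M1 \<subseteq># M - M'" "wt M1 = 2 ^ r'"
          using wt_split[OF small[OF disjI1[OF s(1)]] ge(1)] by blast
        then have M1: "M1 \<subseteq># M" "M1 \<subseteq># N'" "wt M1 = 2 ^ r'"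
          using subset_mset.order_trans[OF _ s(1)] subset_mset.order_trans[OF _ s(2)] by blast+
        obtain N1 where N1: "N1 \<subseteq># M' - M" "wt N1 = 2 ^ r'"
          using wt_split[OF small[OF disjI2[OF s(4)]] ge(2)] by blast
        then have N1: "N1 \<subseteq># N" "N1 \<subseteq># M'" "wt N1 = 2 ^ r'"
          using subset_mset.order_trans[OF _ s(4)] subset_mset.order_trans[OF _ s(3)] by blast+
        obtain M2 M2' N2 N2' where p: "M = M1 + M2" "N' = M1 + M2'" "N = N1 + N2" "M' = N1 + N2'"
          using M1(1,2) N1(1,2) by (metis subset_mset.le_iff_add)
        have "seval A (Node S T) = seval A (Node T' S')"
        proof (rule swap_halves)
          show "rep (M1 + M2) S" "rep (N1 + N2) T" "rep (M1 + M2') T'" "rep (N1 + N2') S'"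
            using r p by simp_all
          show "M2 + N2 = M2' + N2'" using MN by (simp add: p)
          show "swap_ok K" if "size K < size M1 + size M2 + (size N1 + size N2)" for K
            using that sz(1) by (intro IH) (simp add: p)
        qed (simp_all add: M1 N1 qr)
        then show ?thesis using seval_node_commute[OF r(4,3)] by simp
      qed
    qed
  qed
qed

lemma rep_unique: "rep M S \<Longrightarrow> rep M T \<Longrightarrow> seval A S = seval A T"
  by (rule rep_unique_aux[OF swap_all])

definition tau :: "nat multiset \<Rightarrow> 'a" where
  "tau M = seval A (SOME T. rep M T)"

lemma tau_rep: "rep M T \<Longrightarrow> tau M = seval A T"
  unfolding tau_def by (rule rep_unique) (rule someI)

lemma tau_carr: "wt M = 2 ^ q \<Longrightarrow> tau M \<in> carr A (size M)"
  using rep_exists[of M] rep_carr tau_rep by metis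

lemma tau_generator: "tau {#q#} = u"
  using tau_rep[OF rep.leaf] by simp

lemma tau_star:
  assumes "wt M = 2 ^ q" "wt N = 2 ^ q" "M + N = image_mset Suc L"
  shows "star A (size M) (size N) (tau M) (tau N) = tau L"
proof -
  obtain S T where r: "rep M S" "rep N T" using rep_exists assms by blast
  then show ?thesis
    using tau_rep[OF rep.node[OF r assms(3)]] r[THEN tau_rep] r[THEN rep_sdeg] by simp
qed

lemma tau_star_zero:
  assumes "wt M = 2 ^ q" "wt N = 2 ^ q" "0 \<in># M + N"
  shows "star A (size M) (size N) (tau M) (tau N) = zer A (size M + size N)"
proof -
  obtain S T where r: "rep M S" "rep N T" using rep_exists assms by blast
  \<comment> \<open>An index 0 is a leaf of depth q in one of the two trees, so that tree has height
    at least q and the joined tree exceeds q.\<close>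
  have "q < sheight (Node S T)"
    using rep_height[OF r(1), of 0] rep_height[OF r(2), of 0] assms(3) by auto
  moreover have "\<forall>(n, x)\<in>leaves (Node S T). x \<in> carr A n"
    using r[THEN rep_leaves] u by simp
  ultimately have "seval A (Node S T) = zer A (sdeg (Node S T))"
    using A_trunc unfolding truncation_ids_iff by blast
  then show ?thesis using r[THEN tau_rep] r[THEN rep_sdeg] by simp
qed

end

section \<open>The polynomial model is free on \<open>F(1)\<close>\<close>

context level_element
begin

text \<open>The linear extension of \<open>tau\<close>. The sum is a \<open>finprod\<close> because
  the addition of A is a record field on a carrier set.\<close>

definition sigma :: "nat \<Rightarrow> poly2 \<Rightarrow> 'a" where
  "sigma m = (\<lambda>p\<in>carr (Pm (2 ^ q)) m.
     finprod \<lparr>carrier = carr A m, monoid.mult = add A m, one = zer A m\<rparr> tau (keys p))"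

lemma sigma_insert:
  assumes M: "size M = m" "wt M = 2 ^ q" and p: "p \<in> carr (Pm (2 ^ q)) m" and "M \<notin> keys p"
  shows "sigma m (mon M + p) = add A m (tau M) (sigma m p) \<and> sigma m p \<in> carr A m"
proof -
  interpret G: comm_group "\<lparr>carrier = carr A m, monoid.mult = add A m, one = zer A m\<rparr>"
    by (rule unstable_comm_group[OF A_unstable])
  have k: "keys (mon M + p) = insert M (keys p)" using assms(4) by (auto simp: keys_add_poly2)
  have t: "tau N \<in> carr A m" if "N \<in> insert M (keys p)" for N
    using that tau_carr[of N] M p by (auto simp: Pm_carr)
  show ?thesis
    using G.finprod_insert[of "keys p" M tau] G.finprod_closed[of tau "keys p"] t assms(4) p
      Pm_add[of "mon M" "2 ^ q" m p] M
    by (simp add: sigma_def k Pi_iff)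
qed

lemma sigma_zero: "sigma m 0 = zer A m"
proof -
  interpret G: comm_group "\<lparr>carrier = carr A m, monoid.mult = add A m, one = zer A m\<rparr>"
    by (rule unstable_comm_group[OF A_unstable])
  show ?thesis using G.finprod_empty[of tau] by (simp add: sigma_def)
qed

text \<open>If M already occurs in p, it cancels in mon M + p. The insertion rule is then applied to
  that polynomial, and \<open>tau M\<close> added twice disappears.\<close>

lemma sigma_mon_add:
  assumes M: "size M = m" "wt M = 2 ^ q" and p: "p \<in> carr (Pm (2 ^ q)) m"
  shows "sigma m (mon M + p) = add A m (tau M) (sigma m p) \<and> sigma m p \<in> carr A m"
proof (cases "M \<in> keys p")
  case False
  then show ?thesis by (rule sigma_insert[OF assms])
next
  case True
  let ?p = "mon M + p"
  have p': "?p \<in> carr (Pm (2 ^ q)) m" using M p by (simp add: Pm_add)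
  have "M \<notin> keys ?p" using True by (auto simp: keys_add_poly2)
  then have s: "sigma m (mon M + ?p) = add A m (tau M) (sigma m ?p)" "sigma m ?p \<in> carr A m"
    using sigma_insert[OF M p'] by blast+
  have t: "tau M \<in> carr A m" using tau_carr M by metis
  have "sigma m p = add A m (tau M) (sigma m ?p)" using s(1) by (simp only: poly2_add_left)
  moreover have "add A m (tau M) (add A m (tau M) (sigma m ?p)) = sigma m ?p"
    using unstable_vec(1)[OF A_unstable t t s(2)] unstable_vec(3)[OF A_unstable s(2)]
      unstable_vec(4)[OF A_unstable t] by simp
  ultimately show ?thesis using unstableD(2)[OF A_unstable t s(2)] by simp
qed

lemma sigma_carr: "p \<in> carr (Pm (2 ^ q)) m \<Longrightarrow> sigma m p \<in> carr A m"
proof (induction p rule: Pm_induct)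
  case zero
  show ?case by (simp add: sigma_zero unstableD[OF A_unstable])
next
  case (add M p)
  then show ?case
    using sigma_mon_add[OF add.hyps] tau_carr[of M] unstableD(2)[OF A_unstable] by metis
qed

lemma sigma_mon: "wt M = 2 ^ q \<Longrightarrow> sigma (size M) (mon M) = tau M"
  using sigma_mon_add[of M "size M" 0] tau_carr[of M]
  by (simp add: sigma_zero unstable_add_zer[OF A_unstable])

lemma sigma_add:
  assumes "p \<in> carr (Pm (2 ^ q)) m" and r: "r \<in> carr (Pm (2 ^ q)) m"
  shows "sigma m (p + r) = add A m (sigma m p) (sigma m r)"
  using assms(1)
proof (induction p rule: Pm_induct)
  case zero
  show ?case by (simp add: sigma_zero unstable_vec(3)[OF A_unstable sigma_carr[OF r]])
next
  case (add M p)
  have t: "tau M \<in> carr A m" using tau_carr add.hyps by metis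
  show ?case
    using sigma_mon_add[OF add.hyps(1,2) add.hyps(3)] sigma_mon_add[OF add.hyps(1,2) Pm_add[OF add.hyps(3) r]]
      add.IH unstable_vec(1)[OF A_unstable t sigma_carr[OF add.hyps(3)] sigma_carr[OF r]]
    by (simp add: add.assoc)
qed

lemma sigma_sum_list:
  "set ps \<subseteq> carr (Pm (2 ^ q)) m \<Longrightarrow> sigma m (sum_list ps) = gsum A m (map (sigma m) ps)"
proof (induction ps)
  case (Cons p ps)
  have "sum_list rs \<in> carr (Pm (2 ^ q)) m" if "set rs \<subseteq> carr (Pm (2 ^ q)) m" for rs
    using that by (induction rs) (simp_all add: Pm_add)
  with Cons show ?case by (simp add: sigma_add)
qed (simp add: sigma_zero)

text \<open>A factor x_0 is killed by the shift on one side and by truncation on the other. Without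
  such a factor both sides come from joining two trees at a new root.\<close>

lemma sigma_star_mon:
  assumes M: "wt M = 2 ^ q" and N: "wt N = 2 ^ q"
  shows "sigma (size M + size N) (shift (mon M * mon N)) = star A (size M) (size N) (tau M) (tau N)"
proof (cases "0 \<in># M + N")
  case True
  then show ?thesis
    using tau_star_zero[OF M N True] shift_mon_zero[OF True] by (simp only: sigma_zero flip: mon_add)
next
  case False
  then obtain L where L: "M + N = image_mset Suc L" by (rule image_Suc_obtain)
  have w: "wt L = 2 ^ q" using wt_image_mset_Suc_add[OF L] M N by simp
  have sz: "size M + size N = size L" using L by (metis size_image_mset size_union)
  have "shift (mon M * mon N) = mon L" by (simp only: L shift_mon_Suc flip: mon_add)
  then show ?thesis using tau_star[OF M N L] sigma_mon[OF w] by (simp only: sz)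
qed

lemma sigma_star:
  assumes "p \<in> carr (Pm (2 ^ q)) m" "r \<in> carr (Pm (2 ^ q)) n"
  shows "sigma (m + n) (shift (p * r)) = star A m n (sigma m p) (sigma n r)"
proof -
  have mon: "sigma (m + n) (shift (mon M * r)) = star A m n (tau M) (sigma n r)"
    if M: "size M = m" "wt M = 2 ^ q" for M
    using assms(2)
  proof (induction r rule: Pm_induct)
    case zero
    show ?case using star_zer_right[OF tau_carr[OF M(2)]] M by (simp add: shift_simps sigma_zero)
  next
    case (add N r)
    have mM: "mon M \<in> carr (Pm (2 ^ q)) m" and mN: "mon N \<in> carr (Pm (2 ^ q)) n"
      using M add.hyps by simp_all
    have t: "tau M \<in> carr A m" "tau N \<in> carr A n" using tau_carr M add.hyps by metis+
    have "sigma (m + n) (shift (mon M * (mon N + r))) =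
        add A (m + n) (sigma (m + n) (shift (mon M * mon N))) (sigma (m + n) (shift (mon M * r)))"
      using sigma_add[OF shift_mult_carr[OF mM mN] shift_mult_carr[OF mM add.hyps(3)]]
      by (simp only: distrib_left shift_simps)
    also have "\<dots> = star A m n (tau M) (add A n (tau N) (sigma n r))"
      using star_add_right[OF t sigma_carr[OF add.hyps(3)]] sigma_star_mon[OF M(2) add.hyps(2)]
        add.IH M(1) add.hyps(1) by simp
    finally show ?case using sigma_mon_add[OF add.hyps] by simp
  qed
  show ?thesis
    using assms(1)
  proof (induction p rule: Pm_induct)
    case zero
    show ?case using star_zer_left[OF sigma_carr[OF assms(2)]] by (simp add: shift_simps sigma_zero)
  next
    case (add M p)
    have mM: "mon M \<in> carr (Pm (2 ^ q)) m" using add.hyps by simp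
    have t: "tau M \<in> carr A m" using tau_carr add.hyps by metis
    have "sigma (m + n) (shift ((mon M + p) * r)) =
        add A (m + n) (sigma (m + n) (shift (mon M * r))) (sigma (m + n) (shift (p * r)))"
      using sigma_add[OF shift_mult_carr[OF mM assms(2)] shift_mult_carr[OF add.hyps(3) assms(2)]]
      by (simp only: distrib_right shift_simps)
    also have "\<dots> = star A m n (add A m (tau M) (sigma m p)) (sigma n r)"
      using star_add_left[OF t sigma_carr[OF add.hyps(3)] sigma_carr[OF assms(2)]]
        mon[OF add.hyps(1,2)] add.IH by simp
    finally show ?case using sigma_mon_add[OF add.hyps] by simp
  qed
qed

lemma sigma_generator: "sigma 1 (var q) = u"
  using sigma_mon[of "{#q#}"] by (simp add: tau_generator var_def)

text \<open>In degree 1 only Sq^0 and Sq^1 survive, and Sq^1 u is the star square of u. Here the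
  axiom on Sq_0 enters.\<close>

lemma sigma_sq_generator: "sigma (1 + k) (Sqp k (var q)) = sq A k 1 u"
proof -
  consider "k = 0" | "k = 1" | "1 < k" by linarith
  then show ?thesis
  proof cases
    case 1
    then show ?thesis using sigma_generator u by (simp add: Sqp_0 unstable_sq0[OF A_unstable])
  next
    case 2
    have "Sqp 1 (var q) = shift (var q * var q)"
      using Sqp_top[OF Pm_var[OF HOL.refl]] by (simp only: shift_simps power2_eq_square)
    then have "sigma (1 + 1) (Sqp 1 (var q)) = star A 1 1 u u"
      using sigma_star[OF Pm_var[OF HOL.refl] Pm_var[OF HOL.refl]] by (simp only: sigma_generator)
    also have "\<dots> = sq A 1 1 u"
      using A_sq0 u unfolding star_sq0_ids_iff by metis
    finally show ?thesis by (simp only: 2)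
  next
    case 3
    then show ?thesis
      using Sqp_vanish[OF Pm_var[OF HOL.refl]] unstable_vanish[OF A_unstable u] by (simp only: sigma_zero)
  qed
qed

text \<open>The Cartan formulas on both sides reduce a monomial to the two smaller ones of
  \<open>halves_exist\<close>, ending at the generator.\<close>

lemma sigma_sq_mon: "wt M = 2 ^ q \<Longrightarrow> sigma (size M + k) (Sqp k (mon M)) = sq A k (size M) (tau M)"
proof (induction "size M" arbitrary: M k rule: less_induct)
  case less
  show ?case
  proof (cases "M = {#q#}")
    case True
    then show ?thesis using sigma_sq_generator[of k] by (simp add: tau_generator var_def)
  next
    case False
    then obtain N N' where e: "N + N' = image_mset Suc M" and N: "wt N = 2 ^ q" "wt N' = 2 ^ q"
      and lt: "size N < size M" "size N' < size M"
      using halves_exist[OF less.prems] by blast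
    have sz: "size M = size N + size N'" using e by (metis size_image_mset size_union)
    have mon: "mon M = shift (mon N * mon N')" by (simp only: e shift_mon_Suc flip: mon_add)
    let ?p = "\<lambda>i. shift (Sqp i (mon N) * Sqp (k - i) (mon N'))"
    have c: "Sqp i (mon N) \<in> carr (Pm (2 ^ q)) (size N + i)"
      "Sqp i (mon N') \<in> carr (Pm (2 ^ q)) (size N' + i)" for i
      using Sqp_mon_carr N by metis+
    have deg: "size N + i + (size N' + (k - i)) = size M + k" if "i \<in> set [0..<Suc k]" for i
      using that sz by auto
    have "Sqp k (mon M) = sum_list (map ?p [0..<Suc k])"
      by (simp only: mon Sqp_shift Sqp_mult shift_simps interv_sum_list_conv_sum_set_nat set_upt
          atLeast0LessThan lessThan_Suc_atMost)
    then have "sigma (size M + k) (Sqp k (mon M)) =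
        sigma (size M + k) (sum_list (map ?p [0..<Suc k]))" by simp
    also have "\<dots> = gsum A (size M + k) (map (sigma (size M + k)) (map ?p [0..<Suc k]))"
    proof (rule sigma_sum_list, rule subsetI)
      fix r assume "r \<in> set (map ?p [0..<Suc k])"
      then obtain i where "i \<in> set [0..<Suc k]" "r = ?p i" unfolding set_map by blast
      then show "r \<in> carr (Pm (2 ^ q)) (size M + k)"
        using shift_mult_carr[OF c(1)[of i] c(2)[of "k - i"]] deg by metis
    qed
    also have "map (sigma (size M + k)) (map ?p [0..<Suc k]) =
        map (\<lambda>i. star A (size N + i) (size N' + (k - i)) (sq A i (size N) (tau N))
          (sq A (k - i) (size N') (tau N'))) [0..<Suc k]"
      unfolding map_map
    proof (rule map_cong[OF HOL.refl])
      fix i assume i: "i \<in> set [0..<Suc k]"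
      show "(sigma (size M + k) \<circ> ?p) i = star A (size N + i) (size N' + (k - i))
          (sq A i (size N) (tau N)) (sq A (k - i) (size N') (tau N'))"
        unfolding comp_def deg[OF i, symmetric] sigma_star[OF c]
        using less.hyps[OF lt(1) N(1)] less.hyps[OF lt(2) N(2)] by simp
    qed
    also have "gsum A (size M + k) \<dots> = sq A k (size N + size N') (star A (size N) (size N') (tau N) (tau N'))"
      unfolding sz by (rule Id_D[OF A_cartan cartan_memI[OF tau_carr[OF N(1)] tau_carr[OF N(2)]], symmetric])
    finally show ?thesis using tau_star[OF N e] sz by simp
  qed
qed

lemma sigma_sq:
  "p \<in> carr (Pm (2 ^ q)) m \<Longrightarrow> sigma (m + k) (Sqp k p) = sq A k m (sigma m p)"
proof (induction p rule: Pm_induct)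
  case zero
  show ?case by (simp add: sigma_zero unstable_sq_zer[OF A_unstable])
next
  case (add M p)
  have mM: "mon M \<in> carr (Pm (2 ^ q)) m" using add.hyps by simp
  have t: "tau M \<in> carr A m" using tau_carr add.hyps by metis
  have "sigma (m + k) (Sqp k (mon M + p)) = add A (m + k) (sigma (m + k) (Sqp k (mon M))) (sigma (m + k) (Sqp k p))"
    using sigma_add[OF Sqp_carr[OF mM] Sqp_carr[OF add.hyps(3)]] by (simp only: Sqp_add)
  also have "\<dots> = sq A k m (add A m (tau M) (sigma m p))"
    using unstable_sq_add[OF A_unstable t sigma_carr[OF add.hyps(3)]] sigma_sq_mon[OF add.hyps(2)]
      add.hyps(1) add.IH by simp
  finally show ?case using sigma_mon_add[OF add.hyps] by simp
qed

lemma sigma_alg_mor: "sigma \<in> alg_mor (P_alg (2 ^ q)) A"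
proof -
  have "sigma \<in> mor (P_alg (2 ^ q)) A"
    by (rule morI) (simp_all add: sigma_carr sigma_add sigma_sq, simp add: sigma_def)
  then show ?thesis by (simp add: alg_mor_def sigma_star)
qed

text \<open>An algebra map sending u to x_q must send \<open>tau M\<close> to the monomial M, since
  both are built from these elements by the same products along \<open>halves_exist\<close>.\<close>

lemma sigma_left_inverse:
  assumes g: "g \<in> alg_mor A (P_alg (2 ^ q))" and gu: "g 1 u = var q" and p: "p \<in> carr (Pm (2 ^ q)) m"
  shows "g m (sigma m p) = p"
proof -
  note gm = alg_mor_mor[OF g]
  have mon: "g (size M) (tau M) = mon M" if "wt M = 2 ^ q" for M
    using that
  proof (induction "size M" arbitrary: M rule: less_induct)
    case less
    show ?case
    proof (cases "M = {#q#}")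
      case True
      then show ?thesis using gu by (simp add: tau_generator var_def)
    next
      case False
      then obtain N N' where e: "N + N' = image_mset Suc M" and N: "wt N = 2 ^ q" "wt N' = 2 ^ q"
        and lt: "size N < size M" "size N' < size M"
        using halves_exist[OF less.prems] by blast
      have sz: "size M = size N + size N'" using e by (metis size_image_mset size_union)
      have "g (size M) (tau M) = shift (mon N * mon N')"
        using alg_mor_star[OF g tau_carr[OF N(1)] tau_carr[OF N(2)]] tau_star[OF N e]
          less.hyps[OF lt(1) N(1)] less.hyps[OF lt(2) N(2)] sz by simp
      also have "\<dots> = mon M" by (simp only: e shift_mon_Suc flip: mon_add)
      finally show ?thesis .
    qed
  qed
  show ?thesis
    using p
  proof (induction p rule: Pm_induct)
    case zero
    show ?case
      using mor_zer[OF gm A_unstable star_unstableD(1)[OF P_alg_star_unstable]] by (simp add: sigma_zero)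
  next
    case (add M p)
    have t: "tau M \<in> carr A m" using tau_carr add.hyps by metis
    show ?case
      using sigma_mon_add[OF add.hyps] mor_add[OF gm t] mon[OF add.hyps(2)] add.hyps(1) add.IH by simp
  qed
qed

end

section \<open>Generation of the free algebra and the final isomorphism\<close>

text \<open>The image of an algebra map is closed under all operations that form terms, so it is
  everything once it contains the generators.\<close>

lemma free_alg_generated:
  assumes N: "unstable_module N" and B: "star_unstable_algebra q' B"
    and f: "f \<in> alg_mor B (free_alg q N)"
    and gen: "\<And>n x. x \<in> carr N n \<Longrightarrow> free_unit q N n x \<in> f n ` carr B n"
  shows "f n ` carr B n = carr (free_alg q N) n"
proof -
  interpret aq: alg_quotient "alg_terms (carr N)" "free_ids q N" by (rule free_quotient[OF N])
  note fm = alg_mor_mor[OF f]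
  note BU = star_unstableD(1)[OF B]
  note FU = star_unstableD(1)[OF free_alg_algebra[OF N]]
  have "aq.cl t \<in> f (tdeg t) ` carr B (tdeg t)" if "t \<in> alg_terms (carr N)" for t
    using that
  proof (induction rule: alg_terms.induct)
    case (1 x n)
    then show ?case using gen[of x n] by (simp add: free_unit_def)
  next
    case (2 n)
    have "f n (zer B n) = aq.cl (Zero n)"
      using mor_zer[OF fm BU FU] by (simp add: free_alg_def)
    then show ?case using unstableD(1)[OF BU, of n] by (auto simp: image_iff intro: bexI[of _ "zer B n"])
  next
    case (3 s t)
    then obtain x y where xy: "x \<in> carr B (tdeg s)" "aq.cl s = f (tdeg s) x"
      "y \<in> carr B (tdeg s)" "aq.cl t = f (tdeg s) y" by auto
    then have "aq.cl (Add s t) = f (tdeg s) (add B (tdeg s) x y)"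
      using mor_add[OF fm xy(1,3)] aq.add_Q[OF 3(1,2,3), of "tdeg s"] by (simp add: free_alg_def)
    then show ?case using unstableD(2)[OF BU xy(1,3)] by simp
  next
    case (4 t i)
    then obtain x where x: "x \<in> carr B (tdeg t)" "aq.cl t = f (tdeg t) x" by auto
    then have "aq.cl (Sq i t) = f (tdeg t + i) (sq B i (tdeg t) x)"
      using mor_sq[OF fm x(1), of i] aq.sq_Q[OF 4(1), of i "tdeg t"] by (simp add: free_alg_def)
    then show ?case using unstableD(3)[OF BU x(1)] by simp
  next
    case (5 s t)
    then obtain x y where xy: "x \<in> carr B (tdeg s)" "aq.cl s = f (tdeg s) x"
      "y \<in> carr B (tdeg t)" "aq.cl t = f (tdeg t) y" by auto
    then have "aq.cl (Star s t) = f (tdeg s + tdeg t) (star B (tdeg s) (tdeg t) x y)"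
      using alg_mor_star[OF f xy(1,3)] aq.star_Q[OF 5(1,2), of "tdeg s" "tdeg t"] by (simp add: free_alg_def)
    then show ?case using star_unstableD(2)[OF B xy(1,3)] by simp
  qed
  then have "carr (free_alg q N) n \<subseteq> f n ` carr B n"
    by (auto simp: free_alg_def elim!: aq.cl_E)
  moreover have "f n ` carr B n \<subseteq> carr (free_alg q N) n" using mor_carr[OF fm] by blast
  ultimately show ?thesis by blast
qed

text \<open>The universal property extends the map from F(1) sending its generator to x_q. This
  extension is a left inverse of \<open>sigma\<close>, and \<open>sigma\<close> is onto because its
  image contains the image of F(1), which is generated by one class.\<close>

lemma P_alg_free: "alg_iso (P_alg (2 ^ q)) (free_alg q (F 1))"
proof -
  let ?Fr = "free_alg q (F 1)"
  let ?u = "free_unit q (F 1) 1 (iota 1)"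
  note um = free_unit_mor[OF F_unstable, of q 1]
  interpret L: level_element q ?Fr ?u
    using free_alg_algebra[OF F_unstable] mor_carr[OF um iota_carr] by unfold_locales
  note PU = star_unstableD(1)[OF P_alg_star_unstable, of q]
  have v: "var q \<in> carr (P_alg (2 ^ q)) 1" using Pm_var[of "2 ^ q" q] by simp
  note h = F_mor[OF PU v]
  obtain g where g: "g \<in> alg_mor ?Fr (P_alg (2 ^ q))"
    "\<And>n x. x \<in> carr (F 1) n \<Longrightarrow> g n (free_unit q (F 1) n x) = F_mor (P_alg (2 ^ q)) 1 (var q) n x"
    using free_alg_universal[OF F_unstable P_alg_star_unstable h(1)] by blast
  have gu: "g 1 ?u = var q" using g(2)[OF iota_carr] h(2) by simp
  have "inj_on (L.sigma n) (carr (P_alg (2 ^ q)) n)" for n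
    by (rule inj_on_inverseI[where g = "g n"]) (use L.sigma_left_inverse[OF g(1) gu] in simp)
  moreover have "L.sigma n ` carr (P_alg (2 ^ q)) n = carr ?Fr n" for n
  proof (rule free_alg_generated[OF F_unstable P_alg_star_unstable L.sigma_alg_mor])
    note sm = alg_mor_mor[OF L.sigma_alg_mor]
    fix k x assume "x \<in> carr (F 1) k"
    then show "free_unit q (F 1) k x \<in> L.sigma k ` carr (P_alg (2 ^ q)) k"
    proof (induction rule: F_induct)
      case iota
      show ?case using v L.sigma_generator by (intro image_eqI[of _ _ "var q"]) simp_all
    next
      case (zer k)
      show ?case
        using mor_zer[OF um F_unstable L.A_unstable] by (intro image_eqI[of _ _ 0]) (simp_all add: L.sigma_zero del: One_nat_def)
    next
      case (add k x y)
      then obtain a b where "a \<in> carr (P_alg (2 ^ q)) k" "free_unit q (F 1) k x = L.sigma k a"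
        "b \<in> carr (P_alg (2 ^ q)) k" "free_unit q (F 1) k y = L.sigma k b" by auto
      then show ?case
        using mor_add[OF um add.hyps] mor_add[OF sm, of a k b]
        by (intro image_eqI[of _ _ "a + b"]) (simp_all add: Pm_add)
    next
      case (sq i k x)
      then obtain a where "a \<in> carr (P_alg (2 ^ q)) k" "free_unit q (F 1) k x = L.sigma k a" by auto
      then show ?case
        using mor_sq[OF um sq.hyps, of i] mor_sq[OF sm, of a k i]
        by (intro image_eqI[of _ _ "Sqp i a"]) (simp_all add: Sqp_carr)
    qed
  qed
  ultimately show ?thesis
    using L.sigma_alg_mor unfolding alg_iso_def bij_betw_def by blast
qed

theorem proposition9p13:
  fixes q :: nat
  shows "star_unstable_algebra q (J_alg (2 ^ q)) \<and> alg_iso (J_alg (2 ^ q)) (free_alg q (F 1))"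
proof
  show J: "star_unstable_algebra q (J_alg (2 ^ q))" by (rule J_alg_star_unstable)
  have "alg_iso (P_alg (2 ^ q)) (J_alg (2 ^ q))"
    unfolding alg_iso_def using kappa_alg_mor kappa_bij by (metis P_alg_simps(1) J_alg_simps(1))
  then have "alg_iso (J_alg (2 ^ q)) (P_alg (2 ^ q))"
    by (rule alg_iso_sym[OF _ P_alg_star_unstable J])
  then show "alg_iso (J_alg (2 ^ q)) (free_alg q (F 1))"
    by (rule alg_iso_trans[OF _ P_alg_free J])
qed

end
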